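(* Let $\Omega,U,H,L,\mathcal{M}_0$ be as in the context, under assumptions (H1), (H2), (H3), (H4) and (A1) listed there, and let $u^\gamma$ ($\gamma\in\mathbb{R}$) be the functions defined there. Set $$c^{(1)}_-=\min_{\mu\in\mathcal{M}_0}\big\langle\mu,(-x)\cdot D_xL(x,v)\big\rangle.$$ If $u^0(z)=u^\gamma(z)$ for some $z\in\Omega$ and $\gamma>0$, then $c^{(1)}_-=0$.
   Context: $\Omega\subset\mathbb{R}^n$ is open, bounded, connected, with $0\in\Omega$. $U=B(0,R_0)$ is an open ball with $2\Omega\subseteq U$, and $H:\overline U\times\mathbb{R}^n\to\mathbb{R}$ is continuous. The Lagrangian is $L(x,v)=\sup_{p\in\mathbb{R}^n}(p\cdot v-H(x,p))$, $(x,v)\in\overline U\times\mathbb{R}^n$. Assumptions: (H1) for each $R>0$ there is $C_R$ with $|H(x,p)-H(y,p)|\le C_R|x-y|$ and $|H(x,p)-H(x,q)|\le C_R|p-q|$ for $x,y\in\overline U$, $|p|,|q|\le R$; (H2) $\lim_{|p|\to\infty}\min_{x\in\overline U}H(x,p)=+\infty$; (H3) $p\mapsto H(x,p)$ is convex for each $x\in\overline U$; (H4) for $v\in\mathbb{R}^n$, $x\mapsto L(x,v)$ is continuously differentiable on $\overline U$; (A1) $\Omega$ is star-shaped with respect to the origin and there is $\kappa>0$ such that $\mathrm{dist}(x,\overline\Omega)\ge\kappa s$ for all $s>0$ and $x\in(1+s)\partial\Omega$. $c(0)=\inf\{c\in\mathbb{R}:H(x,Dv)\le c\text{ has a viscosity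 subsolution in }\Omega\}$ is the additive eigenvalue of $H$ in $\Omega$. Normalization (made without loss of generality; not an additional restriction on $H$): the solutions considered satisfy an a priori gradient bound $|Du|\le C_H$ with $C_H$ depending only on $H$, so the values of $H(x,p)$ for large $|p|$ are irrelevant; after modifying $H$ for large $|p|$ one may assume that there is $h>0$ such that $H(x,p)=\sup_{|v|\le h}(p\cdot v-L(x,v))$ for $(x,p)\in\overline\Omega\times\mathbb{R}^n$ and $L(x,v)=\sup_{p}(p\cdot v-H(x,p))$ for $(x,v)\in\overline\Omega\times\overline B_h$, with $L\in C(\overline\Omega\times\overline B_h)$, where $\overline B_h$ is the closed ball of radius $h$ at $0$ in $\mathbb{R}^n$. The measures below are defined with this normalization. Viscosity Mather measures: for $f\in C(\overline\Omega\times\overline B_h)$ put $H_f(x,p)=\max_{|v|\le h}(p\cdot v-f(x,v))$. Let $\mathcal{G}_{0,\Omega}$ be the set of $f\in C(\overline\Omega\times\overline B_h)$ for which there is $u\in C(\overline\Omega)$ that is a viscosity subsolution of $H_f(x,Du)\le0$ in $\Omega$. For a Radon measure $\mu$ on $\overline\Omega\times\overline B_h$ write $\langle\mu,f\rangle=\int f\,d\mu$ (functions of $x$ alone are viewed as functions of $(x,v)$), and let $\mathcal{G}'_{0,\Omega}$ be the set of Radon measures with $\langle\mu,f\rangle\ge0$ for all $f\in\mathcal{G}_{0,\Omega}$. $\mathcal{M}_0$ is the set of probability measures $\mu\in\mathcal{G}'_{0,\Omega}$ with $\langle\mu,L\rangle=-c(0)$ (the minimum of $\langle\mu,L\rangle$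 over probability measures in $\mathcal{G}'_{0,\Omega}$). For $\gamma\in\mathbb{R}$ (including $\gamma=0$), $\mathcal{E}^\gamma$ is the family of viscosity subsolutions $w\in C(\overline\Omega)$ of $H(x,Dw)\le c(0)$ in $\Omega$ with $\gamma\langle\mu,(-x)\cdot D_xL(x,v)\rangle+\langle\mu,w\rangle\le0$ for all $\mu\in\mathcal{M}_0$, and $u^\gamma=\sup_{w\in\mathcal{E}^\gamma}w$. It is also the locally uniform limit in $\Omega$ as $\lambda\to0^+$ of $u_\lambda+c(0)/\phi(\lambda)$, where $u_\lambda$ is the state-constraint viscosity solution of $\phi(\lambda)u_\lambda+H(x,Du_\lambda)=0$ in $(1+r(\lambda))\Omega$ (subsolution in the open set, supersolution on its closure), whenever $\phi>0$ is continuous nondecreasing, $r$ is continuous, $\phi,r\to0$ and $r(\lambda)/\phi(\lambda)\to\gamma$ as $\lambda\to0^+$. *)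

theory Defs
  imports "HOL-Probability.Probability"
begin

section \<open>Viscosity subsolutions and the additive eigenvalue\<close>

text \<open>\<open>viscosity_subsolution S H c u\<close>: on the open set \<open>S\<close>, the continuous function \<open>u\<close> satisfies
  \<open>H(x, Du) \<le> c\<close> in the viscosity sense, with \<open>C\<^sup>1\<close> test functions \<open>\<phi>\<close> of gradient \<open>D\<phi>\<close>.\<close>

definition viscosity_subsolution ::
    "'a::euclidean_space set \<Rightarrow> ('a \<Rightarrow> 'a \<Rightarrow> real) \<Rightarrow> real \<Rightarrow> ('a \<Rightarrow> real) \<Rightarrow> bool" where
  "viscosity_subsolution S H c u \<longleftrightarrow>
     continuous_on S u \<and>
     (\<forall>\<phi> D\<phi>. \<forall>x0\<in>S.
        (\<forall>x\<in>S. GDERIV \<phi> x :> D\<phi> x) \<and> continuous_on S D\<phi> \<and>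
        (\<forall>\<^sub>F x in nhds x0. u x - \<phi> x \<le> u x0 - \<phi> x0)
        \<longrightarrow> H x0 (D\<phi> x0) \<le> c)"

definition additive_eigenvalue ::
    "'a::euclidean_space set \<Rightarrow> ('a \<Rightarrow> 'a \<Rightarrow> real) \<Rightarrow> real" where
  "additive_eigenvalue \<Omega> H = Inf {c. \<exists>v. viscosity_subsolution \<Omega> H c v}"


section \<open>The Lagrangian and the assumptions\<close>

text \<open>The supremum is taken in the reals; its finiteness is part of \<open>assm_H4\<close>.\<close>

definition lagrangian :: "('a::euclidean_space \<Rightarrow> 'a \<Rightarrow> real) \<Rightarrow> 'a \<Rightarrow> 'a \<Rightarrow> real" where
  "lagrangian H x v = (SUP p. p \<bullet> v - H x p)"

definition assm_H1 :: "real \<Rightarrow> ('a::euclidean_space \<Rightarrow> 'a \<Rightarrow> real) \<Rightarrow> bool" where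
  "assm_H1 R0 H \<longleftrightarrow>
     (\<forall>R>0. \<exists>C. \<forall>x\<in>cball 0 R0. \<forall>y\<in>cball 0 R0. \<forall>p\<in>cball 0 R. \<forall>q\<in>cball 0 R.
        \<bar>H x p - H y p\<bar> \<le> C * norm (x - y) \<and> \<bar>H x p - H x q\<bar> \<le> C * norm (p - q))"

definition assm_H2 :: "real \<Rightarrow> ('a::euclidean_space \<Rightarrow> 'a \<Rightarrow> real) \<Rightarrow> bool" where
  "assm_H2 R0 H \<longleftrightarrow> filterlim (\<lambda>p. INF x\<in>cball 0 R0. H x p) at_top at_infinity"

definition assm_H3 :: "real \<Rightarrow> ('a::euclidean_space \<Rightarrow> 'a \<Rightarrow> real) \<Rightarrow> bool" where
  "assm_H3 R0 H \<longleftrightarrow> (\<forall>x\<in>cball 0 R0. convex_on UNIV (H x))"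

definition assm_H4 :: "real \<Rightarrow> ('a::euclidean_space \<Rightarrow> 'a \<Rightarrow> real) \<Rightarrow> bool" where
  "assm_H4 R0 H \<longleftrightarrow>
     (\<forall>v. (\<forall>x\<in>cball 0 R0. bdd_above (range (\<lambda>p. p \<bullet> v - H x p))) \<and>
          (\<exists>D. continuous_on (cball 0 R0) D \<and>
               (\<forall>x\<in>cball 0 R0.
                  ((\<lambda>y. lagrangian H y v) has_derivative (\<lambda>y. D x \<bullet> y)) (at x within cball 0 R0))))"

definition assm_A1 :: "'a::euclidean_space set \<Rightarrow> bool" where
  "assm_A1 \<Omega> \<longleftrightarrow>
     (\<forall>x\<in>\<Omega>. closed_segment 0 x \<subseteq> \<Omega>) \<and>
     (\<exists>\<kappa>>0. \<forall>s>0. \<forall>x\<in>(\<lambda>y. (1 + s) *\<^sub>R y) ` frontier \<Omega>. infdist x (closure \<Omega>) \<ge> \<kappa> * s)"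

text \<open>The gradient \<open>D\<^sub>xL\<close>. It is only used at points of the closure of \<open>\<Omega>\<close>, which lie in the
  interior of the ball on which \<open>assm_H4\<close> gives differentiability.\<close>

definition grad_x_lagrangian :: "('a::euclidean_space \<Rightarrow> 'a \<Rightarrow> real) \<Rightarrow> 'a \<Rightarrow> 'a \<Rightarrow> 'a" where
  "grad_x_lagrangian H x v = (THE D. GDERIV (\<lambda>y. lagrangian H y v) x :> D)"


section \<open>Viscosity Mather measures\<close>

text \<open>\<open>H\<^sub>f(x, p)\<close>, the maximum of \<open>p \<bullet> v - f(x, v)\<close> over the closed ball of radius \<open>h\<close>.\<close>

definition hamiltonian_of ::
    "real \<Rightarrow> ('a::euclidean_space \<Rightarrow> 'a \<Rightarrow> real) \<Rightarrow> 'a \<Rightarrow> 'a \<Rightarrow> real" where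
  "hamiltonian_of h f x p = (SUP v\<in>cball 0 h. p \<bullet> v - f x v)"

text \<open>The velocity bound \<open>h\<close>. The modification of \<open>H\<close> for large \<open>\<bar>p\<bar>\<close> is
  \<open>hamiltonian_of h (lagrangian H)\<close>; its Legendre transform is \<open>L\<close> on the closed ball of radius
  \<open>h\<close> and \<open>+\<infinity>\<close> outside. Hence the identity cannot be imposed on \<open>H\<close> itself for all \<open>p\<close>:
  with \<open>L\<close> finite everywhere, as in \<open>assm_H4\<close>, \<open>H\<close> is superlinear. What is required is that
  the modification leaves \<open>H\<close> unchanged on a ball of radius \<open>C\<close> that strictly bounds the
  gradients of subsolutions of \<open>H(x, Du) \<le> c(0)\<close>. Every sufficiently large \<open>h\<close> has this property,
  because \<open>H\<close> is coercive, convex in \<open>p\<close> and Lipschitz on bounded sets.\<close>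

definition normalizing_bound ::
    "'a::euclidean_space set \<Rightarrow> ('a \<Rightarrow> 'a \<Rightarrow> real) \<Rightarrow> real \<Rightarrow> bool" where
  "normalizing_bound \<Omega> H h \<longleftrightarrow>
     h > 0 \<and>
     (\<exists>C. \<forall>x\<in>closure \<Omega>. \<forall>p.
        (H x p \<le> additive_eigenvalue \<Omega> H \<longrightarrow> norm p < C) \<and>
        (norm p \<le> C \<longrightarrow> H x p = hamiltonian_of h (lagrangian H) x p))"

definition G0 :: "'a::euclidean_space set \<Rightarrow> real \<Rightarrow> ('a \<Rightarrow> 'a \<Rightarrow> real) set" where
  "G0 \<Omega> h =
     {f. continuous_on (closure \<Omega> \<times> cball 0 h) (\<lambda>(x, v). f x v) \<and>
         (\<exists>u. continuous_on (closure \<Omega>) u \<and> viscosity_subsolution \<Omega> (hamiltonian_of h f) 0 u)}"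

definition pairing :: "('a \<times> 'a) measure \<Rightarrow> ('a::euclidean_space \<Rightarrow> 'a \<Rightarrow> real) \<Rightarrow> real" where
  "pairing \<mu> f = (LINT z|\<mu>. f (fst z) (snd z))"

text \<open>On a compact subset of a Euclidean space the (nonnegative) Radon measures are exactly the
  finite Borel measures.\<close>

definition G0_dual :: "'a::euclidean_space set \<Rightarrow> real \<Rightarrow> ('a \<times> 'a) measure set" where
  "G0_dual \<Omega> h =
     {\<mu>. finite_measure \<mu> \<and> sets \<mu> = sets (restrict_space borel (closure \<Omega> \<times> cball 0 h)) \<and>
         (\<forall>f\<in>G0 \<Omega> h. pairing \<mu> f \<ge> 0)}"

definition mather_measures ::
    "'a::euclidean_space set \<Rightarrow> ('a \<Rightarrow> 'a \<Rightarrow> real) \<Rightarrow> real \<Rightarrow> ('a \<times> 'a) measure set" where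
  "mather_measures \<Omega> H h =
     {\<mu> \<in> G0_dual \<Omega> h. prob_space \<mu> \<and> pairing \<mu> (lagrangian H) = - additive_eigenvalue \<Omega> H}"


section \<open>The functions \<open>u\<^sup>\<gamma>\<close>\<close>

definition scaling_density :: "('a::euclidean_space \<Rightarrow> 'a \<Rightarrow> real) \<Rightarrow> 'a \<Rightarrow> 'a \<Rightarrow> real" where
  "scaling_density H x v = (- x) \<bullet> grad_x_lagrangian H x v"

definition E_family ::
    "'a::euclidean_space set \<Rightarrow> ('a \<Rightarrow> 'a \<Rightarrow> real) \<Rightarrow> real \<Rightarrow> real \<Rightarrow> ('a \<Rightarrow> real) set" where
  "E_family \<Omega> H h \<gamma> =
     {w. continuous_on (closure \<Omega>) w \<and>
         viscosity_subsolution \<Omega> H (additive_eigenvalue \<Omega> H) w \<and>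
         (\<forall>\<mu>\<in>mather_measures \<Omega> H h.
            \<gamma> * pairing \<mu> (scaling_density H) + pairing \<mu> (\<lambda>x v. w x) \<le> 0)}"

definition u_limit ::
    "'a::euclidean_space set \<Rightarrow> ('a \<Rightarrow> 'a \<Rightarrow> real) \<Rightarrow> real \<Rightarrow> real \<Rightarrow> 'a \<Rightarrow> real" where
  "u_limit \<Omega> H h \<gamma> x = (SUP w\<in>E_family \<Omega> H h \<gamma>. w x)"

definition is_minimum :: "real \<Rightarrow> real set \<Rightarrow> bool" where
  "is_minimum m S \<longleftrightarrow> m \<in> S \<and> (\<forall>s\<in>S. m \<le> s)"

end

theory Submission
  imports Defs "HOL-Complex_Analysis.Great_Picard"
begin

text \<open>
  For a discount rate \<open>\<rho> > 0\<close> let \<open>u\<^sub>\<rho>\<close> be the infimum of the discounted action over polygonal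
  paths in \<open>\<Omega>\<close> ending at a point. Along a sequence \<open>\<rho> \<rightarrow> 0\<close> the functions \<open>u\<^sub>\<rho> + c(0)/\<rho>\<close>
  converge to a subsolution \<open>w\<close> in the family for \<open>\<gamma> = 0\<close>, and the discounted occupation measures
  of almost optimal paths ending at \<open>z\<close> converge weakly to a Mather measure \<open>\<nu>\<close> with
  \<open>v z \<le> w z + \<langle>\<nu>, v\<rangle>\<close> for every subsolution \<open>v\<close>. Hence \<open>u\<^sup>0 z = w z\<close> and
  \<open>u\<^sup>\<gamma> z \<le> u\<^sup>0 z - \<gamma> \<langle>\<nu>, s\<rangle>\<close>, where \<open>s = (-x) \<cdot> D\<^sub>xL\<close>, so that equality forces
  \<open>\<langle>\<nu>, s\<rangle> \<le> 0\<close>. Conversely \<open>\<langle>\<mu>, s\<rangle> \<ge> 0\<close> for every Mather measure \<open>\<mu>\<close>, because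
  \<open>w((1 - t)x)/(1 - t)\<close> is a subsolution on \<open>\<Omega>\<close> for the Lagrangian \<open>L((1 - t)x, v) + c(0)\<close>.

  The minimum is attained at \<open>\<nu>\<close> by this construction and not by compactness of the set of
  Mather measures: \<open>D\<^sub>xL\<close> need not be continuous in \<open>v\<close> under (H4).
\<close>

section \<open>Weak compactness of probability measures on a compact set\<close>

definition bump :: "real \<Rightarrow> real" where
  "bump t = min 1 (max 0 (1/2 - cos (pi * t)))"

lemma bump_bounds: "0 \<le> bump t" "bump t \<le> 1"
  by (auto simp: bump_def)

lemma continuous_on_bump [continuous_intros]:
  "continuous_on S f \<Longrightarrow> continuous_on S (\<lambda>x::real. bump (f x))"
  unfolding bump_def by (intro continuous_intros)

text \<open>The cosine makes \<open>bump\<close> continuous and 2-periodic at once, while the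
  clipping makes it constant on [0, 1/3] and on [2/3, 1], the two intervals that a leading ternary
  digit 0 or 2 singles out.\<close>

lemma bump_add_even: "bump (2 * real n + r) = bump r"
proof -
  have "cos (pi * (2 * real n + r)) = cos (pi * r + (2 * pi) * real n)"
    by (simp add: algebra_simps)
  also have "\<dots> = cos (pi * r)"
    by (simp add: cos_add mult.assoc mult.commute[of "2*pi"] cos_periodic sin_add)
       (metis (no_types, opaque_lifting) cos_2npi sin_2npi mult.commute mult.left_commute mult_1_right mult_zero_right diff_zero)
  finally show ?thesis by (simp add: bump_def)
qed

lemma bump_low: "0 \<le> r \<Longrightarrow> r \<le> 1/3 \<Longrightarrow> bump r = 0"
proof -
  assume r: "0 \<le> r" "r \<le> 1/3"
  have "cos (pi/3) \<le> cos (pi * r)"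
    by (rule cos_monotone_0_pi_le) (use r in auto)
  then show ?thesis by (simp add: bump_def cos_60)
qed

lemma bump_high: "2/3 \<le> r \<Longrightarrow> r \<le> 1 \<Longrightarrow> bump r = 1"
proof -
  assume r: "2/3 \<le> r" "r \<le> 1"
  have "cos (pi * r) \<le> cos (pi - pi/3)"
    by (rule cos_monotone_0_pi_le) (use r in \<open>auto simp: field_simps\<close>)
  also have "cos (pi - pi/3) = - 1/2"
    unfolding cos_diff by (simp add: cos_60)
  finally show ?thesis by (simp add: bump_def)
qed

text \<open>All ternary digits of \<open>t\<close> are 0 or 2, so \<open>3 ^ m * t\<close> has an
  even integer part, which periodicity removes. What remains is \<open>2 * b m / 3\<close> plus a
  tail of at most 1/3, and there \<open>bump\<close> is constant.\<close>

lemma bump_ternary_digit: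
  fixes b :: "nat \<Rightarrow> nat"
  assumes b: "\<And>k. b k \<in> {0, 1}"
  defines "t \<equiv> (\<Sum>k. 2 * real (b k) / 3 ^ Suc k)"
  shows "bump (3 ^ m * t) = real (b m)" "0 \<le> t" "t \<le> 1"
proof -
  define a where "a k = 2 * real (b k) / 3 ^ Suc k" for k
  have a_bound: "0 \<le> a k" "a k \<le> 2 / 3 ^ Suc k" for k
    using b[of k] by (auto simp: a_def divide_simps)
  have sg: "(\<lambda>k. 2 / 3 ^ Suc k :: real) sums 1"
  proof -
    have "(\<lambda>k. (2/3) * (1/3) ^ k :: real) sums ((2/3) * (1 / (1 - 1/3)))"
      by (intro sums_mult geometric_sums) auto
    then show ?thesis by (simp add: power_divide)
  qed
  have suma: "summable a"
    by (rule summable_comparison_test'[OF sums_summable[OF sg], of 0]) (use a_bound in auto)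
  have t: "t = suminf a" unfolding t_def a_def by simp
  show "0 \<le> t" unfolding t by (intro suminf_nonneg suma a_bound)
  show "t \<le> 1" unfolding t sums_unique[OF sg]
    by (intro suminf_le suma sums_summable[OF sg] a_bound)
  define r where "r = (\<Sum>k. a (k + Suc m))"
  have tsplit: "t = r + (\<Sum>k<Suc m. a k)"
    unfolding t r_def by (rule suminf_split_initial_segment[OF suma])
  have r0: "0 \<le> r"
    unfolding r_def by (intro suminf_nonneg summable_ignore_initial_segment suma a_bound)
  have r1: "3 ^ m * r \<le> 1/3"
  proof -
    have s2: "(\<lambda>k. (1 / 3 ^ Suc m) * (2 / 3 ^ Suc k) :: real) sums ((1 / 3 ^ Suc m) * 1)"
      by (intro sums_mult sg)
    have "r \<le> (1 / 3 ^ Suc m) * 1"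
      unfolding r_def sums_unique[OF s2]
      by (intro suminf_le summable_ignore_initial_segment suma sums_summable[OF s2])
        (use a_bound(2)[of "_ + Suc m"] in \<open>auto simp: power_add mult.commute mult.left_commute\<close>)
    then show ?thesis by (simp add: field_simps)
  qed
  define N where "N = (\<Sum>k<m. b k * 3 ^ (m - Suc k))"
  have "3 ^ m * (\<Sum>k<m. a k) = (\<Sum>k<m. 2 * (real (b k) * 3 ^ (m - Suc k)))"
    unfolding sum_distrib_left
  proof (rule sum.cong)
    fix k assume "k \<in> {..<m}"
    then have "(3::real) ^ m = 3 ^ Suc k * 3 ^ (m - Suc k)"
      by (simp only: power_add[symmetric]) simp
    then show "3 ^ m * a k = 2 * (real (b k) * 3 ^ (m - Suc k))"
      by (simp add: a_def)
  qed simp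
  also have "\<dots> = 2 * real N"
    by (simp add: N_def sum_distrib_left)
  finally have "3 ^ m * t = 2 * real N + (2 * real (b m) / 3 + 3 ^ m * r)"
    unfolding tsplit by (simp add: distrib_left a_def)
  then have "bump (3 ^ m * t) = bump (2 * real (b m) / 3 + 3 ^ m * r)"
    by (simp only: bump_add_even)
  also have "\<dots> = real (b m)"
    using b[of m] r0 r1 by (auto intro!: bump_low bump_high)
  finally show "bump (3 ^ m * t) = real (b m)" .
qed

text \<open>Greedy doubling: \<open>r k\<close> is the remainder after \<open>k\<close> digits. It
  never leaves the closed unit interval, so y = 1 is covered too, with all digits equal to
  1.\<close>

lemma binary_expansion:
  fixes y :: real
  assumes "0 \<le> y" "y \<le> 1"
  obtains b :: "nat \<Rightarrow> nat" where "\<And>k. b k \<in> {0, 1}" "(\<lambda>k. real (b k) / 2 ^ Suc k) sums y"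
proof -
  define r where "r = rec_nat y (\<lambda>_ s. if 2 * s \<ge> 1 then 2 * s - 1 else 2 * s)"
  define b where "b k = (if 2 * r k \<ge> 1 then 1 else 0 :: nat)" for k
  have r0: "r 0 = y" and rS: "r (Suc k) = 2 * r k - real (b k)" for k
    by (auto simp: r_def b_def)
  have rb: "0 \<le> r k \<and> r k \<le> 1" for k
    by (induction k) (use assms in \<open>auto simp: r0 rS b_def\<close>)
  have part: "y = (\<Sum>k<n. real (b k) / 2 ^ Suc k) + r n / 2 ^ n" for n
  proof (induction n)
    case (Suc n)
    have "real (b n) / 2 ^ Suc n + r (Suc n) / 2 ^ Suc n = r n / 2 ^ n"
      by (simp add: rS add_divide_distrib[symmetric])
    with Suc show ?case by simp
  qed (simp add: r0)
  have "(\<lambda>n. r n / 2 ^ n) \<longlonglongrightarrow> 0"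
  proof (rule tendsto_sandwich[of "\<lambda>_. 0" _ _ "\<lambda>n. (1/2) ^ n"])
    show "\<forall>\<^sub>F n in sequentially. r n / 2 ^ n \<le> (1/2) ^ n"
      using rb by (auto simp: power_divide divide_right_mono)
    show "(\<lambda>n. (1/2) ^ n :: real) \<longlonglongrightarrow> 0"
      by (rule LIMSEQ_power_zero) simp
  qed (use rb in auto)
  then have "(\<lambda>n. y - r n / 2 ^ n) \<longlonglongrightarrow> y - 0"
    by (intro tendsto_intros)
  moreover have "y - r n / 2 ^ n = (\<Sum>k<n. real (b k) / 2 ^ Suc k)" for n
    using part[of n] by linarith
  ultimately have "(\<lambda>k. real (b k) / 2 ^ Suc k) sums y"
    unfolding sums_def by simp
  then show thesis by (intro that[of b]) (auto simp: b_def)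
qed

text \<open>Schoenberg's space-filling curve: the coordinate with index \<open>j\<close> of \<open>N\<close> reads the ternary
  digits of \<open>t\<close> at the places congruent to \<open>j\<close> modulo \<open>N\<close>.\<close>

lemma space_filling_curve_unit_cube:
  obtains d :: "real \<Rightarrow> 'b::euclidean_space"
  where "continuous_on UNIV d" "\<And>y. (\<And>i. i \<in> Basis \<Longrightarrow> 0 \<le> y \<bullet> i \<and> y \<bullet> i \<le> 1) \<Longrightarrow> y \<in> d ` {0..1}"
proof -
  define N where "N = card (Basis :: 'b set)"
  obtain idx where idx: "bij_betw idx (Basis :: 'b set) {..<N}"
    using ex_bij_betw_finite_nat[OF finite_Basis] unfolding N_def atLeast0LessThan by blast
  define c where "c j t = (\<Sum>k. bump (3 ^ (N * k + j) * t) / 2 ^ Suc k)" for j t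
  define d where "d t = (\<Sum>i\<in>Basis. c (idx i) t *\<^sub>R i)" for t :: real
  have cont_c: "continuous_on UNIV (c j)" for j
  proof -
    have "summable (\<lambda>k. (1/2) * (1/2) ^ k :: real)"
      by (intro summable_mult summable_geometric) auto
    then have "uniform_limit UNIV (\<lambda>n t. \<Sum>k<n. bump (3 ^ (N * k + j) * t) / 2 ^ Suc k)
        (\<lambda>t. \<Sum>k. bump (3 ^ (N * k + j) * t) / 2 ^ Suc k) sequentially"
      by (intro Weierstrass_m_test[where M = "\<lambda>k. (1/2) * (1/2) ^ k"])
        (auto simp: bump_bounds power_divide divide_simps abs_of_nonneg)
    then show ?thesis
      unfolding c_def [abs_def]
      by (rule uniform_limit_theorem[rotated]) (auto intro!: always_eventually continuous_intros)
  qed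
  show thesis
  proof (rule that[of d])
    show "continuous_on UNIV d"
      unfolding d_def by (intro continuous_intros cont_c)
    fix y :: 'b assume y: "\<And>i. i \<in> Basis \<Longrightarrow> 0 \<le> y \<bullet> i \<and> y \<bullet> i \<le> 1"
    have "\<forall>i\<in>Basis. \<exists>b. (\<forall>k. b k \<in> {0, 1::nat}) \<and> (\<lambda>k. real (b k) / 2 ^ Suc k) sums (y \<bullet> i)"
      using y binary_expansion by metis
    then obtain B where B: "\<And>i k. i \<in> Basis \<Longrightarrow> B i k \<in> {0, 1::nat}"
        "\<And>i. i \<in> Basis \<Longrightarrow> (\<lambda>k. real (B i k) / 2 ^ Suc k) sums (y \<bullet> i)"
      by metis
    define g where "g = inv_into Basis idx"
    have g: "g j \<in> Basis" "idx (g j) = j" if "j < N" for j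
      using bij_betw_inv_into_right[OF idx] bij_betwE[OF bij_betw_inv_into[OF idx]] that
      by (auto simp: g_def)
    have gi: "g (idx i) = i" "idx i < N" if "i \<in> Basis" for i
      using bij_betw_inv_into_left[OF idx that] bij_betwE[OF idx] that by (auto simp: g_def)
    have Npos: "N > 0" by (simp add: N_def card_gt_0_iff)
    define b where "b m = B (g (m mod N)) (m div N)" for m
    have b01: "b m \<in> {0, 1}" for m
      unfolding b_def using B(1) g(1) Npos by auto
    define t where "t = (\<Sum>k. 2 * real (b k) / 3 ^ Suc k)"
    note dig = bump_ternary_digit[of b, OF b01, folded t_def]
    have "c (idx i) t = y \<bullet> i" if i: "i \<in> Basis" for i
    proof -
      have "bump (3 ^ (N * k + idx i) * t) = real (B i k)" for k
        using dig(1)[of "N * k + idx i"] gi[OF i] by (simp add: b_def)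
      then show ?thesis
        unfolding c_def using sums_unique[OF B(2)[OF i]] by simp
    qed
    then have "d t = y"
      unfolding d_def by (simp add: euclidean_representation)
    then show "y \<in> d ` {0..1}" using dig(2,3) by (metis atLeastAtMost_iff imageI)
  qed
qed

lemma space_filling_curve:
  fixes K :: "'b::euclidean_space set"
  assumes "bounded K"
  obtains d :: "real \<Rightarrow> 'b" where "continuous_on UNIV d" "K \<subseteq> d ` {0..1}"
proof -
  obtain d0 :: "real \<Rightarrow> 'b" where d0: "continuous_on UNIV d0"
      "\<And>y. (\<And>i. i \<in> Basis \<Longrightarrow> 0 \<le> y \<bullet> i \<and> y \<bullet> i \<le> 1) \<Longrightarrow> y \<in> d0 ` {0..1}"
    using space_filling_curve_unit_cube by blast
  obtain R where R: "R > 0" "\<And>y. y \<in> K \<Longrightarrow> norm y \<le> R"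
    using assms by (auto simp: bounded_pos)
  define one :: 'b where "one = (\<Sum>i\<in>Basis. i)"
  have one: "one \<bullet> i = 1" if "i \<in> Basis" for i
    using that by (simp add: one_def inner_sum_left inner_Basis if_distrib cong: if_cong)
  define d where "d t = (2 * R) *\<^sub>R d0 t - R *\<^sub>R one" for t
  show thesis
  proof (rule that[of d])
    show "continuous_on UNIV d" unfolding d_def by (intro continuous_intros d0(1))
    show "K \<subseteq> d ` {0..1}"
    proof
      fix y assume y: "y \<in> K"
      define y' where "y' = (1 / (2 * R)) *\<^sub>R (y + R *\<^sub>R one)"
      have "0 \<le> y' \<bullet> i \<and> y' \<bullet> i \<le> 1" if i: "i \<in> Basis" for i
      proof -
        have "\<bar>y \<bullet> i\<bar> \<le> R" using Basis_le_norm[OF i, of y] R(2)[OF y] by linarith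
        then show ?thesis using R(1) by (auto simp: y'_def inner_add_left one[OF i] field_simps)
      qed
      then obtain t where "t \<in> {0..1}" "y' = d0 t" using d0(2) by blast
      moreover have "d t = y" if "y' = d0 t" for t
        using R(1) by (simp add: d_def that[symmetric] y'_def)
      ultimately show "y \<in> d ` {0..1}" by blast
    qed
  qed
qed

text \<open>Taking the least parameter over each point gives a Borel right inverse: on the image of
  the unit interval its sublevel sets are images of compact intervals, hence compact. It carries
  measures from the compact set to the line, and \<open>d\<close> carries them back.\<close>

lemma compact_borel_section:
  fixes d :: "real \<Rightarrow> 'b::euclidean_space"
  assumes d: "continuous_on UNIV d"
  obtains e where "e \<in> borel_measurable borel"
    "\<And>y. y \<in> d ` {0..1} \<Longrightarrow> d (e y) = y" "\<And>y. e y \<in> {0..1}"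
proof -
  define Q where "Q y = {t \<in> {0..1}. d t = y}" for y
  define e where "e y = (if y \<in> d ` {0..1} then Inf (Q y) else 0)" for y
  have cpt: "compact (d ` {a..b})" for a b
    by (intro compact_continuous_image continuous_on_subset[OF d]) auto
  have Q: "Inf (Q y) \<in> Q y" if "y \<in> d ` {0..1}" for y
  proof (rule closed_contains_Inf)
    have "Q y = {0..1} \<inter> d -` {y}" by (auto simp: Q_def)
    then show "closed (Q y)"
      using d by (auto intro!: continuous_closed_preimage continuous_on_subset[OF d])
    show "bdd_below (Q y)" by (rule bdd_belowI[of _ 0]) (auto simp: Q_def)
    show "Q y \<noteq> {}" using that by (auto simp: Q_def)
  qed
  have "{y. e y \<le> a} \<in> sets borel" for a
  proof -
    have "{y. e y \<le> a} = (d ` {0..min 1 a}) \<union> (if 0 \<le> a then - (d ` {0..1}) else {})" (is "?A = ?B")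
    proof (intro set_eqI iffI)
      fix y assume "y \<in> ?A"
      show "y \<in> ?B"
      proof (cases "y \<in> d ` {0..1}")
        case True
        then have "e y \<in> {0..min 1 a}" "d (e y) = y"
          using \<open>y \<in> ?A\<close> Q[OF True] by (auto simp: e_def Q_def)
        then show ?thesis by (metis UnI1 imageI)
      qed (use \<open>y \<in> ?A\<close> in \<open>auto simp: e_def\<close>)
    next
      fix y assume "y \<in> ?B"
      then consider (1) t where "0 \<le> t" "t \<le> 1" "t \<le> a" "y = d t"
        | (2) "0 \<le> a" "y \<notin> d ` {0..1}"
        by (auto split: if_splits)
      then show "y \<in> ?A"
      proof cases
        case 1
        then have "Inf (Q y) \<le> t"
          by (intro cInf_lower bdd_belowI[of _ 0]) (auto simp: Q_def)
        with 1 show ?thesis by (auto simp: e_def)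
      qed (auto simp: e_def)
    qed
    also have "\<dots> \<in> sets borel"
      using borel_compact[OF cpt] by (intro sets.Un) (auto intro!: borel_comp)
    finally show ?thesis .
  qed
  then have "e \<in> borel_measurable borel"
    by (intro borel_measurableI_le) auto
  moreover have "d (e y) = y" if "y \<in> d ` {0..1}" for y
    using Q[OF that] that by (auto simp: e_def Q_def)
  moreover have "e y \<in> {0..1}" for y
    using Q[of y] by (auto simp: e_def Q_def)
  ultimately show thesis using that by blast
qed

text \<open>A continuous parametrisation of the compact set by an interval transports Helly's selection
  theorem from the line.\<close>

lemma compact_prob_measures_weak_limit:
  fixes \<mu> :: "nat \<Rightarrow> 'b::euclidean_space measure" and K :: "'b set"
  assumes K: "compact K"
    and prob: "\<And>n. prob_space (\<mu> n)" and sets: "\<And>n. sets (\<mu> n) = sets borel"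
    and supp: "\<And>n. AE y in \<mu> n. y \<in> K"
  obtains r :: "nat \<Rightarrow> nat" and \<nu> where "strict_mono r" "prob_space \<nu>"
    "sets \<nu> = sets (restrict_space borel K)"
    "\<And>f. continuous_on K (f :: 'b \<Rightarrow> real) \<Longrightarrow>
       (\<lambda>n. \<integral>y. (if y \<in> K then f y else 0) \<partial>\<mu> (r n)) \<longlonglongrightarrow> (\<integral>y. f y \<partial>\<nu>)"
proof -
  obtain d :: "real \<Rightarrow> 'b" where d: "continuous_on UNIV d" "K \<subseteq> d ` {0..1}"
    using space_filling_curve[OF compact_imp_bounded[OF K]] by blast
  obtain e where e: "e \<in> borel_measurable borel" "\<And>y. y \<in> d ` {0..1} \<Longrightarrow> d (e y) = y"
      "\<And>y. e y \<in> {0..1}"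
    using compact_borel_section[OF d(1)] by blast
  have [measurable]: "e \<in> borel_measurable borel" "d \<in> borel_measurable borel"
    using e(1) d(1) by (auto intro: borel_measurable_continuous_onI)
  have Kb [measurable]: "K \<in> sets borel" using K by (rule borel_compact)
  have em [measurable]: "e \<in> borel_measurable (\<mu> n)" for n
    using e(1) measurable_cong_sets[OF sets refl] by blast
  define m where "m n = distr (\<mu> n) borel e" for n
  have prob_m: "prob_space (m n)" for n
    unfolding m_def by (rule prob_space.prob_space_distr[OF prob em])
  have rd: "real_distribution (m n)" for n
    using prob_m[of n] by (auto simp: real_distribution_def real_distribution_axioms_def m_def)
  \<comment> \<open>All image measures live on the unit interval, so one interval serves every
    \<epsilon>; its left end is -1 because the half-open interval has to contain 0.\<close>
  have "tight m"
    unfolding tight_def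
  proof (intro conjI allI impI rd)
    fix \<epsilon> :: real assume "\<epsilon> > 0"
    have "measure (m n) {-1<..1} = 1" for n
    proof -
      have "e -` {-1<..1} \<inter> space (\<mu> n) = space (\<mu> n)"
      proof -
        have "- 1 < e y" "e y \<le> 1" for y using e(3)[of y] by auto
        then show ?thesis by auto
      qed
      then show ?thesis
        unfolding m_def using prob_space.prob_space[OF prob[of n]] by (simp add: measure_distr)
    qed
    then show "\<exists>a b. a < b \<and> (\<forall>n. 1 - \<epsilon> < measure (m n) {a<..b})"
      using \<open>\<epsilon> > 0\<close> by (intro exI[of _ "-1"] exI[of _ 1]) auto
  qed
  then obtain r M where r: "strict_mono (r :: nat \<Rightarrow> nat)" and M: "real_distribution M"
      and wc: "weak_conv_m (m \<circ> id \<circ> r) M"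
    using tight_imp_convergent_subsubsequence[OF _ strict_mono_id] by blast
  interpret M: real_distribution M by (rule M)
  define \<nu>0 where "\<nu>0 = distr M borel d"
  have dM [measurable]: "d \<in> measurable M borel"
    using measurable_cong_sets[OF M.events_eq_borel refl] \<open>d \<in> borel_measurable borel\<close> by blast
  have \<nu>0: "prob_space \<nu>0" unfolding \<nu>0_def by (rule M.prob_space_distr[OF dM])
  \<comment> \<open>Weak convergence on the line is tested with \<open>F\<close> composed with the
    continuous \<open>d\<close>; since \<open>d (e y) = y\<close> on \<open>K\<close>, this is the
    integral of \<open>F\<close> itself. The discontinuity of \<open>e\<close> does no harm.\<close>
  have lim: "(\<lambda>n. \<integral>y. (if y \<in> K then F y else 0) \<partial>\<mu> (r n)) \<longlonglongrightarrow> (\<integral>y. F y \<partial>\<nu>0)"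
    if F: "continuous_on UNIV F" "\<And>y. \<bar>F y\<bar> \<le> B" for F :: "'b \<Rightarrow> real" and B
  proof -
    have [measurable]: "F \<in> borel_measurable borel"
      using F(1) by (rule borel_measurable_continuous_onI)
    have Fm [measurable]: "F \<in> borel_measurable (\<mu> n)" for n
      using measurable_cong_sets[OF sets refl] \<open>F \<in> borel_measurable borel\<close> by blast
    have Kmu [measurable]: "K \<in> sets (\<mu> n)" for n using Kb sets by simp
    have "(\<lambda>n. integral\<^sup>L ((m \<circ> id \<circ> r) n) (\<lambda>t. F (d t))) \<longlonglongrightarrow> integral\<^sup>L M (\<lambda>t. F (d t))"
    proof (rule weak_conv_imp_integral_bdd_continuous_conv[OF _ M wc])
      show "isCont (\<lambda>t. F (d t)) x" for x
        using F(1) d(1) by (auto simp: continuous_on_eq_continuous_at intro!: isCont_o2[of _ d F])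
      show "norm (F (d x)) \<le> B" for x using F(2) by simp
    qed (use rd in auto)
    moreover have "integral\<^sup>L M (\<lambda>t. F (d t)) = (\<integral>y. F y \<partial>\<nu>0)"
      unfolding \<nu>0_def by (simp add: integral_distr)
    moreover have "integral\<^sup>L (m n) (\<lambda>t. F (d t)) = (\<integral>y. (if y \<in> K then F y else 0) \<partial>\<mu> n)" for n
    proof -
      have "integral\<^sup>L (m n) (\<lambda>t. F (d t)) = (\<integral>y. F (d (e y)) \<partial>\<mu> n)"
        unfolding m_def by (rule integral_distr) measurable
      also have "\<dots> = (\<integral>y. (if y \<in> K then F y else 0) \<partial>\<mu> n)"
      proof (rule integral_cong_AE)
        show "(\<lambda>y. F (d (e y))) \<in> borel_measurable (\<mu> n)" by measurable
        show "(\<lambda>y. if y \<in> K then F y else 0) \<in> borel_measurable (\<mu> n)" by measurable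
        show "AE y in \<mu> n. F (d (e y)) = (if y \<in> K then F y else 0)"
          using supp[of n] by eventually_elim (use e(2) d(2) in auto)
      qed
      finally show ?thesis .
    qed
    ultimately show ?thesis by simp
  qed
  \<comment> \<open>The truncated distance to \<open>K\<close> is bounded and continuous and has
    integral 0 against every \<open>\<mu> n\<close>, hence also against the limit; closedness of
    \<open>K\<close> does the rest.\<close>
  have AEK: "AE y in \<nu>0. y \<in> K"
  proof (cases "K = {}")
    case True
    then have "AE y in \<mu> 0. False" using supp[of 0] by auto
    then show ?thesis using prob_space.AE_False[OF prob] by blast
  next
    case False
    define F where "F y = min 1 (infdist y K)" for y
    have Fc: "continuous_on UNIV F" unfolding F_def by (intro continuous_intros)
    have Fb: "\<bar>F y\<bar> \<le> 1" for y by (auto simp: F_def infdist_nonneg)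
    have "(\<lambda>n. \<integral>y. (if y \<in> K then F y else 0) \<partial>\<mu> (r n)) \<longlonglongrightarrow> (\<integral>y. F y \<partial>\<nu>0)"
      by (rule lim[OF Fc Fb])
    moreover have "(if y \<in> K then F y else 0) = 0" for y by (simp add: F_def)
    ultimately have "(\<lambda>n::nat. 0) \<longlonglongrightarrow> (\<integral>y. F y \<partial>\<nu>0)" by simp
    then have int0: "(\<integral>y. F y \<partial>\<nu>0) = 0" by (simp add: LIMSEQ_const_iff)
    have F0: "0 \<le> F y" for y by (simp add: F_def infdist_nonneg)
    have [measurable]: "F \<in> borel_measurable \<nu>0"
      unfolding \<nu>0_def using borel_measurable_continuous_onI[OF Fc] by simp
    have "integrable \<nu>0 F"
      by (rule finite_measure.integrable_const_bound[where B = 1])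
         (use \<nu>0 Fb in \<open>auto simp: prob_space_def\<close>)
    then have "AE y in \<nu>0. F y = 0"
      using int0 integral_nonneg_eq_0_iff_AE[of \<nu>0 F] F0 by simp
    then show ?thesis
    proof eventually_elim
      case (elim y)
      then have "infdist y K = 0" by (auto simp: F_def min_def split: if_splits)
      then show ?case using in_closed_iff_infdist_zero[of K y] compact_imp_closed[OF K] False by blast
    qed
  qed
  have K\<nu>: "K \<in> sets \<nu>0" by (simp add: \<nu>0_def Kb)
  define \<nu> where "\<nu> = restrict_space \<nu>0 K"
  have "prob_space \<nu>"
  proof
    have "emeasure \<nu> (space \<nu>) = emeasure \<nu>0 K"
      using K\<nu> sets.sets_into_space[OF K\<nu>]
      by (simp add: \<nu>_def space_restrict_space emeasure_restrict_space Int_absorb2)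
    also have "\<dots> = 1"
      by (rule prob_space.emeasure_eq_1_AE[OF \<nu>0 K\<nu> AEK])
    finally show "emeasure \<nu> (space \<nu>) = 1" .
  qed
  moreover have "sets \<nu> = sets (restrict_space borel K)"
    unfolding \<nu>_def by (rule sets_restrict_space_cong) (simp add: \<nu>0_def)
  moreover have "(\<lambda>n. \<integral>y. (if y \<in> K then f y else 0) \<partial>\<mu> (r n)) \<longlonglongrightarrow> (\<integral>y. f y \<partial>\<nu>)"
    if f: "continuous_on K f" for f :: "'b \<Rightarrow> real"
  proof -
    \<comment> \<open>Tietze extension reduces a test function on \<open>K\<close> to the bounded
      continuous functions on the whole space treated in \<open>lim\<close>.\<close>
    obtain B where B: "B > 0" "\<And>y. y \<in> K \<Longrightarrow> norm (f y) \<le> B"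
      using compact_imp_bounded[OF compact_continuous_image[OF f K]] by (auto simp: bounded_pos)
    obtain F where F: "continuous_on UNIV F" "\<And>y. y \<in> K \<Longrightarrow> F y = f y" "\<And>y. norm (F y) \<le> B"
      using Tietze[OF f, of UNIV B] B compact_imp_closed[OF K] by auto
    have [measurable]: "F \<in> borel_measurable \<nu>0"
      unfolding \<nu>0_def using borel_measurable_continuous_onI[OF F(1)] by simp
    have "(\<lambda>n. \<integral>y. (if y \<in> K then F y else 0) \<partial>\<mu> (r n)) \<longlonglongrightarrow> (\<integral>y. F y \<partial>\<nu>0)"
      by (rule lim[OF F(1), of B]) (use F(3) in auto)
    moreover have "(\<lambda>y. if y \<in> K then F y else 0) = (\<lambda>y. if y \<in> K then f y else 0)"
      using F(2) by auto
    moreover have "(\<integral>y. f y \<partial>\<nu>) = (\<integral>y. F y \<partial>\<nu>0)"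
    proof -
      have "(\<integral>y. f y \<partial>\<nu>) = (\<integral>y. F y \<partial>\<nu>)"
        by (rule Bochner_Integration.integral_cong) (use F(2) in \<open>auto simp: \<nu>_def space_restrict_space\<close>)
      also have "\<dots> = (\<integral>y. indicator K y *\<^sub>R F y \<partial>\<nu>0)"
        unfolding \<nu>_def by (rule integral_restrict_space) (use K\<nu> in auto)
      also have "\<dots> = (\<integral>y. F y \<partial>\<nu>0)"
      proof (rule integral_cong_AE)
        show "(\<lambda>y. indicator K y *\<^sub>R F y) \<in> borel_measurable \<nu>0" using K\<nu> by measurable
        show "AE y in \<nu>0. indicator K y *\<^sub>R F y = F y" using AEK by eventually_elim auto
      qed measurable
      finally show ?thesis .
    qed
    ultimately show ?thesis by simp
  qed
  ultimately show thesis using that[of r \<nu>] r by blast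
qed

section \<open>Viscosity subsolutions along segments\<close>

text \<open>A constant bound \<open>m\<close> on each segment replaces the integral of
  \<open>f\<close> along it, so that no integrability enters and limits and dilations are immediate;
  \<open>integral_le_of_local_bound\<close> recovers the integral form. Velocities point towards
  \<open>x\<close>, the end of the path.\<close>

definition segment_subsolution ::
    "'a::euclidean_space set \<Rightarrow> real \<Rightarrow> ('a \<Rightarrow> 'a \<Rightarrow> real) \<Rightarrow> ('a \<Rightarrow> real) \<Rightarrow> bool" where
  "segment_subsolution \<Omega> h f u \<longleftrightarrow>
     (\<forall>x v t m. norm v \<le> h \<longrightarrow> 0 \<le> t \<longrightarrow> closed_segment (x - t *\<^sub>R v) x \<subseteq> \<Omega> \<longrightarrow>
        (\<forall>y\<in>closed_segment (x - t *\<^sub>R v) x. f y v \<le> m) \<longrightarrow> u x - u (x - t *\<^sub>R v) \<le> t * m)"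

lemma segment_subsolutionD:
  assumes "segment_subsolution \<Omega> h f u" "norm v \<le> h" "0 \<le> t"
    "closed_segment (x - t *\<^sub>R v) x \<subseteq> \<Omega>" "\<And>y. y \<in> closed_segment (x - t *\<^sub>R v) x \<Longrightarrow> f y v \<le> m"
  shows "u x - u (x - t *\<^sub>R v) \<le> t * m"
  using assms unfolding segment_subsolution_def by blast

lemma backward_segment_subset_ball:
  fixes x v :: "'a::euclidean_space"
  assumes "0 \<le> t" "t * norm v < r"
  shows "closed_segment (x - t *\<^sub>R v) x \<subseteq> ball x r"
proof -
  have "0 < r" using assms by (smt (verit) mult_nonneg_nonneg norm_ge_zero)
  then have "x - t *\<^sub>R v \<in> ball x r" "x \<in> ball x r"
    using assms by (auto simp: dist_norm)
  then show ?thesis by (intro closed_segment_subset convex_ball)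
qed

lemma eventually_backward_segment_subset:
  fixes x v :: "'a::euclidean_space"
  assumes "open S" "x \<in> S"
  shows "\<forall>\<^sub>F t in at_right 0. closed_segment (x - t *\<^sub>R v) x \<subseteq> S"
proof -
  obtain r where r: "r > 0" "ball x r \<subseteq> S" using assms by (meson openE)
  have "((\<lambda>t. t * norm v) \<longlongrightarrow> 0 * norm v) (at_right 0)" by (intro tendsto_intros)
  then have "\<forall>\<^sub>F t in at_right 0. t * norm v < r"
    by (rule order_tendstoD(2)) (use r in auto)
  with eventually_at_right_less[of 0] show ?thesis
  proof eventually_elim
    case (elim t)
    then show ?case using backward_segment_subset_ball[of t v r x] r by auto
  qed
qed

text \<open>At a local maximum of \<open>u - \<phi>\<close> the backward increments of
  \<open>\<phi>\<close> are dominated by those of \<open>u\<close>; dividing by \<open>t\<close>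
  leaves the directional derivative of \<open>\<phi>\<close>.\<close>

lemma difference_bound_imp_test_bound:
  fixes u \<phi> :: "'a::euclidean_space \<Rightarrow> real"
  assumes "GDERIV \<phi> x :> D"
    and "\<forall>\<^sub>F y in nhds x. u y - \<phi> y \<le> u x - \<phi> x"
    and "\<And>\<epsilon>. \<epsilon> > 0 \<Longrightarrow> \<forall>\<^sub>F t in at_right 0. u x - u (x - t *\<^sub>R v) \<le> t * (a + \<epsilon>)"
  shows "D \<bullet> v \<le> a"
proof (rule field_le_epsilon)
  fix \<epsilon> :: real assume \<epsilon>: "\<epsilon> > 0"
  have g: "((\<lambda>t. x - t *\<^sub>R v) has_derivative (\<lambda>t. - t *\<^sub>R v)) (at 0)"
    by (auto intro!: derivative_eq_intros)
  have "((\<lambda>t. \<phi> (x - t *\<^sub>R v)) has_derivative (\<lambda>t. (- t *\<^sub>R v) \<bullet> D)) (at 0)"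
    using has_derivative_compose[OF g, of \<phi> "\<lambda>h. h \<bullet> D"] assms(1) by (simp add: gderiv_def)
  then have "((\<lambda>t. \<phi> (x - t *\<^sub>R v)) has_field_derivative - (v \<bullet> D)) (at 0)"
    unfolding has_field_derivative_def by (rule has_derivative_eq_rhs) (auto simp: fun_eq_iff)
  then have "((\<lambda>t. (\<phi> (x - t *\<^sub>R v) - \<phi> x) / t) \<longlongrightarrow> - (v \<bullet> D)) (at_right 0)"
    unfolding has_field_derivative_iff by (auto intro: tendsto_mono[OF at_le])
  then have "((\<lambda>t. - ((\<phi> (x - t *\<^sub>R v) - \<phi> x) / t)) \<longlongrightarrow> - (- (v \<bullet> D))) (at_right 0)"
    by (intro tendsto_intros)
  then have lim: "((\<lambda>t. (\<phi> x - \<phi> (x - t *\<^sub>R v)) / t) \<longlongrightarrow> D \<bullet> v) (at_right 0)"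
    by (simp add: minus_divide_left inner_commute)
  have "filterlim (\<lambda>t. x - t *\<^sub>R v) (nhds (x - 0 *\<^sub>R v)) (at_right 0)"
    by (intro tendsto_intros)
  then have "\<forall>\<^sub>F t in at_right 0. u (x - t *\<^sub>R v) - \<phi> (x - t *\<^sub>R v) \<le> u x - \<phi> x"
    using assms(2) by (auto simp: filterlim_iff)
  with assms(3)[OF \<epsilon>] eventually_at_right_less[of 0]
  have "\<forall>\<^sub>F t in at_right 0. (\<phi> x - \<phi> (x - t *\<^sub>R v)) / t \<le> a + \<epsilon>"
  proof eventually_elim
    case (elim t)
    then have "\<phi> x - \<phi> (x - t *\<^sub>R v) \<le> t * (a + \<epsilon>)" by linarith
    then show ?case using elim by (simp add: divide_le_eq mult.commute)
  qed
  then show "D \<bullet> v \<le> a + \<epsilon>"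
    by (intro tendsto_upperbound[OF lim]) auto
qed

lemma continuous_on_section:
  fixes f :: "'a::euclidean_space \<Rightarrow> 'a \<Rightarrow> real"
  assumes "continuous_on (S \<times> cball 0 h) (\<lambda>(x, v). f x v)" "norm v \<le> h" "T \<subseteq> S"
  shows "continuous_on T (\<lambda>x. f x v)"
proof -
  have "continuous_on T (\<lambda>x. (\<lambda>(x, v). f x v) (x, v))"
    by (rule continuous_on_compose2[OF assms(1)]) (use assms(2,3) in \<open>auto intro!: continuous_intros\<close>)
  then show ?thesis by simp
qed

lemma segment_subsolution_difference_bound:
  assumes "open \<Omega>" "x \<in> \<Omega>" "norm v \<le> h" "segment_subsolution \<Omega> h f u"
    and "continuous_on \<Omega> (\<lambda>y. f y v)" "\<epsilon> > 0"
  shows "\<forall>\<^sub>F t in at_right 0. u x - u (x - t *\<^sub>R v) \<le> t * (f x v + \<epsilon>)"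
proof -
  have "open {y \<in> \<Omega>. f y v < f x v + \<epsilon>}"
    using continuous_open_preimage[OF assms(5,1), of "{..<f x v + \<epsilon>}"]
    by (simp add: vimage_def Int_def)
  then have "\<forall>\<^sub>F t in at_right 0. closed_segment (x - t *\<^sub>R v) x \<subseteq> {y \<in> \<Omega>. f y v < f x v + \<epsilon>}"
    by (rule eventually_backward_segment_subset) (use assms in auto)
  with eventually_at_right_less[of 0] show ?thesis
  proof eventually_elim
    case (elim t)
    show ?case
      by (rule segment_subsolutionD[OF assms(4,3)]) (use elim in \<open>auto intro: less_imp_le\<close>)
  qed
qed

lemma hamiltonian_of_leI:
  assumes "0 \<le> h" "\<And>v. norm v \<le> h \<Longrightarrow> p \<bullet> v - f x v \<le> c"
  shows "hamiltonian_of h f x p \<le> c"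
  unfolding hamiltonian_of_def using assms by (intro cSUP_least) auto

lemma hamiltonian_of_leD:
  assumes "hamiltonian_of h f x p \<le> c" "continuous_on (cball 0 h) (f x)" "norm v \<le> h"
  shows "p \<bullet> v - f x v \<le> c"
proof -
  have "compact ((\<lambda>v. p \<bullet> v - f x v) ` cball 0 h)"
    by (intro compact_continuous_image continuous_intros assms compact_cball)
  then have "bdd_above ((\<lambda>v. p \<bullet> v - f x v) ` cball 0 h)"
    by (intro bounded_imp_bdd_above compact_imp_bounded)
  then have "p \<bullet> v - f x v \<le> hamiltonian_of h f x p"
    unfolding hamiltonian_of_def using assms(3) by (intro cSUP_upper) auto
  then show ?thesis using assms(1) by linarith
qed

text \<open>The infinitesimal hypothesis with error \<epsilon> also fits value functions, whose
  running cost varies with the base point. The abstract \<open>G\<close> and \<open>c\<close> allow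
  both \<open>H\<close> at a level and \<open>hamiltonian_of h f\<close> at 0.\<close>

lemma difference_bound_imp_viscosity:
  assumes "open \<Omega>" "0 \<le> h" "continuous_on \<Omega> u"
    and "\<And>x v \<epsilon>. x \<in> \<Omega> \<Longrightarrow> norm v \<le> h \<Longrightarrow> \<epsilon> > 0 \<Longrightarrow>
      \<forall>\<^sub>F t in at_right 0. u x - u (x - t *\<^sub>R v) \<le> t * (f x v + \<epsilon>)"
    and "\<And>x p. x \<in> \<Omega> \<Longrightarrow> (\<And>v. norm v \<le> h \<Longrightarrow> p \<bullet> v \<le> f x v) \<Longrightarrow> G x p \<le> c"
  shows "viscosity_subsolution \<Omega> G c u"
  unfolding viscosity_subsolution_def
proof (intro conjI allI ballI impI assms(3))
  fix \<phi> D x assume x: "x \<in> \<Omega>" and "(\<forall>x\<in>\<Omega>. GDERIV \<phi> x :> D x) \<and> continuous_on \<Omega> D \<and>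
    (\<forall>\<^sub>F y in nhds x. u y - \<phi> y \<le> u x - \<phi> x)"
  then show "G x (D x) \<le> c"
    by (intro assms(5) difference_bound_imp_test_bound[of \<phi> x "D x" u] assms(4)) auto
qed

text \<open>Maximising \<open>u - \<phi>\<close> over a thin tube around the segment, where \<open>\<phi>\<close> grows with slope
  slightly larger than \<open>m\<close> in the direction \<open>v\<close>, is heavily penalised across, and blows up
  just behind the end point.\<close>

lemma viscosity_segment_bound_nonzero:
  fixes u :: "'a::euclidean_space \<Rightarrow> real"
  assumes \<Omega>: "open \<Omega>" and visc: "viscosity_subsolution \<Omega> G c u"
    and G: "\<And>x p. x \<in> \<Omega> \<Longrightarrow> G x p \<le> c \<Longrightarrow> p \<bullet> v \<le> g x"
    and g: "continuous_on \<Omega> g"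
    and v: "v \<noteq> 0" and t: "0 \<le> t"
    and seg: "closed_segment x0 (x0 + t *\<^sub>R v) \<subseteq> \<Omega>"
    and m: "\<And>y. y \<in> closed_segment x0 (x0 + t *\<^sub>R v) \<Longrightarrow> g y \<le> m"
  shows "u (x0 + t *\<^sub>R v) - u x0 \<le> t * m"
proof (rule ccontr)
  define x1 where "x1 = x0 + t *\<^sub>R v"
  define I where "I = closed_segment x0 x1"
  assume "\<not> ?thesis"
  then have neg: "u x1 - u x0 > t * m" by (simp add: x1_def)
  have contu: "continuous_on \<Omega> u" using visc by (simp add: viscosity_subsolution_def)
  \<comment> \<open>A quarter of the assumed excess: one share pays for raising the slope from
    \<open>m\<close> to \<open>m + \<epsilon>\<close>, one for the exponential term at
    \<open>x1\<close>, one for the oscillation of \<open>u\<close> near \<open>x0\<close>, and one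
    is left over.\<close>
  define \<delta> where "\<delta> = (u x1 - u x0 - t * m) / 4"
  define \<epsilon> where "\<epsilon> = \<delta> / (t + 1)"
  have \<delta>: "\<delta> > 0" using neg by (simp add: \<delta>_def)
  have \<epsilon>: "\<epsilon> > 0" using \<delta> t by (simp add: \<epsilon>_def)
  have "t * \<epsilon> \<le> \<delta>" using t \<delta> by (simp add: \<epsilon>_def field_simps)
  then have gap: "u x1 - t * (m + \<epsilon>) - \<delta> > u x0 + \<delta>"
    using \<delta> unfolding \<delta>_def by (simp add: algebra_simps)
  define W where "W = {y \<in> \<Omega>. g y < m + \<epsilon>}"
  have openW: "open W"
    using continuous_open_preimage[OF g \<Omega>, of "{..<m + \<epsilon>}"] by (simp add: W_def vimage_def Int_def)
  have IW: "I \<subseteq> W" using seg m \<epsilon> by (force simp: I_def x1_def W_def)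
  have "compact I" "I \<noteq> {}" by (auto simp: I_def)
  then obtain \<rho>0 where \<rho>0: "\<rho>0 > 0" "{y. infdist y I \<le> \<rho>0} \<subseteq> W"
    using compact_in_open_separated[OF _ _ openW IW] by metis
  have x0\<Omega>: "x0 \<in> \<Omega>" using seg by auto
  obtain \<rho>1 where \<rho>1: "\<rho>1 > 0" "\<And>y. y \<in> \<Omega> \<Longrightarrow> dist y x0 < \<rho>1 \<Longrightarrow> dist (u y) (u x0) < \<delta>"
    using contu x0\<Omega> \<delta> unfolding continuous_on_iff by metis
  define \<rho> where "\<rho> = min (\<rho>0 / 2) (\<rho>1 / 2)"
  have \<rho>: "\<rho> > 0" "2 * \<rho> \<le> \<rho>0" "\<rho> < \<rho>1" using \<rho>0 \<rho>1 by (auto simp: \<rho>_def)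
  define b where "b = t + \<rho> / norm v"
  have bt: "b > t" using \<rho> v by (simp add: b_def)
  define s where "s y = ((y - x0) \<bullet> v) / (v \<bullet> v)" for y
  define q where "q y = (y - x0) \<bullet> (y - x0) - (v \<bullet> v) * (s y)\<^sup>2" for y
  have vv: "v \<bullet> v > 0" using v by simp
  have q_eq: "q y = (norm (y - (x0 + s y *\<^sub>R v)))\<^sup>2" for y
  proof -
    have "(norm (y - (x0 + s y *\<^sub>R v)))\<^sup>2
        = (y - x0) \<bullet> (y - x0) - 2 * s y * ((y - x0) \<bullet> v) + (s y)\<^sup>2 * (v \<bullet> v)"
      unfolding power2_norm_eq_inner
      by (simp add: algebra_simps inner_commute power2_eq_square)
    moreover have "(y - x0) \<bullet> v = s y * (v \<bullet> v)" using vv by (simp add: s_def)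
    ultimately show ?thesis by (simp add: q_def power2_eq_square algebra_simps)
  qed
  define T where "T = {y. 0 \<le> s y \<and> s y \<le> b \<and> q y \<le> \<rho>\<^sup>2}"
  have conts: "continuous_on UNIV s" unfolding s_def by (intro continuous_intros) (use vv in auto)
  have contq: "continuous_on UNIV q" unfolding q_def by (intro continuous_intros conts)
  have near: "norm (y - (x0 + s y *\<^sub>R v)) \<le> \<rho>" if "y \<in> T" for y
    using that \<rho> by (auto simp: T_def q_eq intro: power2_le_imp_le)
  have TW: "y \<in> W" if y: "y \<in> T" for y
  proof -
    define s' where "s' = min (s y) t"
    have s': "0 \<le> s'" "s' \<le> t" "\<bar>s y - s'\<bar> \<le> b - t"
      using y t bt by (auto simp: s'_def T_def)
    have "x0 + s' *\<^sub>R v \<in> I"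
    proof (cases "t = 0")
      case True then show ?thesis using s' by (simp add: I_def)
    next
      case False
      then have "x0 + s' *\<^sub>R v = (1 - s'/t) *\<^sub>R x0 + (s'/t) *\<^sub>R x1"
        by (simp add: x1_def algebra_simps)
      then show ?thesis unfolding I_def in_segment
        using s' t False by (intro exI[of _ "s'/t"]) auto
    qed
    then have "infdist y I \<le> dist y (x0 + s' *\<^sub>R v)" by (rule infdist_le)
    also have "\<dots> \<le> norm (y - (x0 + s y *\<^sub>R v)) + norm ((s y - s') *\<^sub>R v)"
      unfolding dist_norm by (rule order_trans[OF _ norm_triangle_ineq]) (simp add: algebra_simps)
    also have "\<dots> \<le> \<rho> + (b - t) * norm v"
      using near[OF y] s'(3) by (auto intro!: add_mono mult_right_mono)
    also have "\<dots> \<le> \<rho>0" using \<rho> v by (simp add: b_def)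
    finally show ?thesis using \<rho>0 by blast
  qed
  have T\<Omega>: "T \<subseteq> \<Omega>" using TW by (auto simp: W_def)
  have compT: "compact T"
    unfolding compact_eq_bounded_closed
  proof
    have "norm y \<le> \<rho> + norm x0 + b * norm v" if y: "y \<in> T" for y
    proof -
      have "norm y \<le> norm (y - (x0 + s y *\<^sub>R v)) + norm (x0 + s y *\<^sub>R v)"
        by (metis diff_add_cancel norm_triangle_ineq)
      also have "norm (x0 + s y *\<^sub>R v) \<le> norm x0 + \<bar>s y\<bar> * norm v"
        by (metis norm_scaleR norm_triangle_ineq)
      also have "\<bar>s y\<bar> * norm v \<le> b * norm v"
        using y by (intro mult_right_mono) (auto simp: T_def)
      finally show ?thesis using near[OF y] by linarith
    qed
    then show "bounded T" by (auto simp: bounded_iff)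
    have "T = s -` {0..b} \<inter> q -` {..\<rho>\<^sup>2}" by (auto simp: T_def)
    moreover have "closed (s -` {0..b})" "closed (q -` {..\<rho>\<^sup>2})"
      using conts contq by (auto intro!: continuous_closed_vimage simp: continuous_on_eq_continuous_at)
    ultimately show "closed T" by auto
  qed
  obtain B where B: "B > 0" "\<And>y. y \<in> T \<Longrightarrow> \<bar>u y\<bar> \<le> B"
    using compact_imp_bounded[OF compact_continuous_image[OF continuous_on_subset[OF contu T\<Omega>] compT]]
    by (auto simp: bounded_pos)
  define k where "k = m + \<epsilon>"
  \<comment> \<open>Comparison with \<open>x1\<close> keeps the total penalty at the maximum below
    \<open>E\<close>. \<open>A\<close> and \<open>Q\<close> are chosen so that the exponential term
    reaches \<open>E\<close> on the front face and the transverse term reaches \<open>E\<close> on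
    the lateral face, which excludes both.\<close>
  define E where "E = 2 * B + \<bar>k\<bar> * (b + t) + 2 * \<delta> + 1"
  define A where "A = E / (\<delta> * (b - t))"
  define Q where "Q = E / \<rho>\<^sup>2"
  have b0: "b > 0" using bt t by simp
  have E: "E > 0" using B \<delta> b0 t by (auto simp: E_def intro!: add_nonneg_pos)
  have A: "A > 0" using E \<delta> bt by (simp add: A_def)
  have Q: "Q > 0" using E \<rho> by (simp add: Q_def)
  define \<phi> where "\<phi> y = k * s y + \<delta> * exp (A * (s y - t)) + Q * q y" for y
  define D where "D y = ((k + \<delta> * A * exp (A * (s y - t)) - 2 * Q * (v \<bullet> v) * s y) / (v \<bullet> v)) *\<^sub>R v
      + (2 * Q) *\<^sub>R (y - x0)" for y
  have deriv: "GDERIV \<phi> y :> D y" for y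
  proof -
    have ds: "(s has_derivative (\<lambda>h. (h \<bullet> v) / (v \<bullet> v))) (at y)"
      unfolding s_def by (rule derivative_eq_intros refl | use v in force)+
    have "(\<phi> has_derivative (\<lambda>h. k * ((h \<bullet> v) / (v \<bullet> v))
        + \<delta> * (exp (A * (s y - t)) * (A * ((h \<bullet> v) / (v \<bullet> v))))
        + Q * ((h \<bullet> (y - x0) + (y - x0) \<bullet> h) - (v \<bullet> v) * (2 * s y * ((h \<bullet> v) / (v \<bullet> v)))))) (at y)"
      unfolding \<phi>_def q_def
      by (auto intro!: derivative_eq_intros ds simp: algebra_simps)
    then show ?thesis
      unfolding gderiv_def
    proof (rule has_derivative_eq_rhs, intro ext)
      fix h
      define w where "w = v \<bullet> v"
      have "h \<bullet> D y = (k + \<delta> * A * exp (A * (s y - t)) - 2 * Q * w * s y) / w * (h \<bullet> v)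
          + 2 * Q * (h \<bullet> (y - x0))"
        by (simp add: D_def w_def inner_add_right)
      moreover have "w \<noteq> 0" using v by (simp add: w_def)
      ultimately show "k * (h \<bullet> v / (v \<bullet> v)) + \<delta> * (exp (A * (s y - t)) * (A * (h \<bullet> v / (v \<bullet> v)))) +
          Q * (h \<bullet> (y - x0) + (y - x0) \<bullet> h - v \<bullet> v * (2 * s y * (h \<bullet> v / (v \<bullet> v)))) = h \<bullet> D y"
        unfolding w_def[symmetric] inner_commute[of "y - x0"]
        by (simp add: add_divide_distrib diff_divide_distrib algebra_simps)
    qed
  qed
  have contD: "continuous_on \<Omega> D"
    unfolding D_def by (intro continuous_intros continuous_on_subset[OF conts]) (use v in auto)
  have x1T: "x1 \<in> T" and sx1: "s x1 = t" and qx1: "q x1 = 0"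
  proof -
    show "s x1 = t" using vv by (simp add: s_def x1_def)
    then show "q x1 = 0" by (simp add: q_eq) (simp add: x1_def)
    then show "x1 \<in> T" using \<open>s x1 = t\<close> t bt by (simp add: T_def)
  qed
  have cont\<phi>: "continuous_on UNIV \<phi>"
    unfolding \<phi>_def by (intro continuous_intros conts contq)
  have "continuous_on T (\<lambda>y. u y - \<phi> y)"
    by (intro continuous_intros continuous_on_subset[OF contu T\<Omega>] continuous_on_subset[OF cont\<phi>]) auto
  then obtain y where y: "y \<in> T" and ymax: "\<And>y'. y' \<in> T \<Longrightarrow> u y' - \<phi> y' \<le> u y - \<phi> y"
    using continuous_attains_sup[OF compT] x1T by blast
  have \<phi>x1: "\<phi> x1 = k * t + \<delta>" by (simp add: \<phi>_def sx1 qx1)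
  have yx1: "u x1 - k * t - \<delta> \<le> u y - \<phi> y" using ymax[OF x1T] by (simp add: \<phi>x1)
  have ks: "\<bar>k * s y\<bar> \<le> \<bar>k\<bar> * b"
    unfolding abs_mult using y by (intro mult_left_mono) (auto simp: T_def)
  have kt: "\<bar>k * t\<bar> = \<bar>k\<bar> * t" using t by (simp add: abs_mult)
  have uy: "\<bar>u y\<bar> \<le> B" "\<bar>u x1\<bar> \<le> B" using B y x1T by auto
  have pen_upper: "\<delta> * exp (A * (s y - t)) + Q * q y \<le> E - 1 - \<delta>"
    using yx1 ks kt uy unfolding \<phi>_def E_def distrib_left by linarith
  have q0: "q y \<ge> 0" by (simp add: q_eq)
  have "q y < \<rho>\<^sup>2"
  proof (rule ccontr)
    assume "\<not> q y < \<rho>\<^sup>2"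
    then have "Q * q y \<ge> E" using Q \<rho> by (simp add: Q_def field_simps)
    moreover have "\<delta> * exp (A * (s y - t)) > 0" using \<delta> by simp
    ultimately show False using pen_upper \<delta> by linarith
  qed
  moreover have "s y < b"
  proof (rule ccontr)
    assume "\<not> s y < b"
    then have "A * (b - t) \<le> A * (s y - t)" using A by simp
    moreover have "\<delta> * (1 + A * (s y - t)) \<le> \<delta> * exp (A * (s y - t))"
      using \<delta> by (intro mult_left_mono exp_ge_add_one_self) auto
    moreover have "\<delta> * (A * (b - t)) = E" using \<delta> bt by (simp add: A_def)
    moreover have "\<delta> * (A * (b - t)) \<le> \<delta> * (A * (s y - t))"
      using calculation(1) \<delta> by (metis mult_left_mono less_imp_le)
    ultimately have "E \<le> \<delta> * exp (A * (s y - t))" using \<delta> by (simp add: distrib_left)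
    moreover have "Q * q y \<ge> 0" using Q q0 by simp
    ultimately show False using pen_upper \<delta> by linarith
  qed
  \<comment> \<open>The back face is excluded without a penalty: there \<open>u\<close> is within
    \<delta> of \<open>u x0\<close>, below the value that \<open>gap\<close> guarantees at
    \<open>x1\<close>.\<close>
  moreover have "0 < s y"
  proof (rule ccontr)
    assume "\<not> 0 < s y"
    then have s0: "s y = 0" using y by (auto simp: T_def)
    then have "dist y x0 < \<rho>1" using near[OF y] \<rho> by (simp add: dist_norm)
    then have "u y < u x0 + \<delta>" using \<rho>1(2)[of y] y T\<Omega> by (force simp: dist_real_def)
    moreover have "\<phi> y \<ge> 0" using \<delta> Q q0 by (simp add: \<phi>_def s0)
    ultimately show False using yx1 gap by (simp add: k_def mult.commute)
  qed
  moreover have "open (s -` {0<..<b} \<inter> q -` {..<\<rho>\<^sup>2})"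
    using conts contq by (auto intro!: open_Int open_vimage)
  ultimately have "\<forall>\<^sub>F y' in nhds y. y' \<in> s -` {0<..<b} \<inter> q -` {..<\<rho>\<^sup>2}"
    by (intro eventually_nhds_in_open) auto
  then have "\<forall>\<^sub>F y' in nhds y. u y' - \<phi> y' \<le> u y - \<phi> y"
    by eventually_elim (rule ymax, auto simp: T_def)
  then have "G y (D y) \<le> c"
    using visc y T\<Omega> deriv contD unfolding viscosity_subsolution_def by blast
  then have "D y \<bullet> v \<le> g y" using G y T\<Omega> by blast
  \<comment> \<open>The transverse penalty has gradient orthogonal to \<open>v\<close>, so its huge
    constant drops out and the slope along \<open>v\<close> still exceeds
    \<open>k > g y\<close>.\<close>
  moreover have "D y \<bullet> v = k + \<delta> * A * exp (A * (s y - t))"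
  proof -
    have "(y - x0) \<bullet> v = s y * (v \<bullet> v)" using vv by (simp add: s_def)
    moreover have "D y \<bullet> v = (k + \<delta> * A * exp (A * (s y - t)) - 2 * Q * (v \<bullet> v) * s y)
        + 2 * Q * ((y - x0) \<bullet> v)"
      using v by (simp add: D_def inner_add_left)
    ultimately show ?thesis by simp
  qed
  moreover have "g y < k" using TW[OF y] by (simp add: W_def k_def)
  moreover have "\<delta> * A * exp (A * (s y - t)) > 0" using \<delta> A by simp
  ultimately show False by linarith
qed

text \<open>The tube argument gives no information for \<open>v = 0\<close>, where the claim amounts
  to \<open>0 \<le> f x 0\<close>. If this failed, \<open>f\<close> would be below a fixed negative
  number for all small velocities near \<open>x\<close>, and \<open>u\<close> would drop by a fixed
  amount over arbitrarily short segments.\<close>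

lemma viscosity_imp_segment_subsolution:
  fixes u :: "'a::euclidean_space \<Rightarrow> real"
  assumes \<Omega>: "open \<Omega>" and h: "0 < h" and visc: "viscosity_subsolution \<Omega> G c u"
    and G: "\<And>x p v. x \<in> \<Omega> \<Longrightarrow> G x p \<le> c \<Longrightarrow> norm v \<le> h \<Longrightarrow> p \<bullet> v \<le> f x v"
    and f: "continuous_on (\<Omega> \<times> cball 0 h) (\<lambda>(x, v). f x v)"
  shows "segment_subsolution \<Omega> h f u"
  unfolding segment_subsolution_def
proof (intro allI impI)
  have contu: "continuous_on \<Omega> u" using visc by (simp add: viscosity_subsolution_def)
  have fv: "continuous_on \<Omega> (\<lambda>x. f x v)" if "norm v \<le> h" for v
    by (rule continuous_on_section[OF f that order_refl])
  have nonzero: "u x - u (x - t *\<^sub>R v) \<le> t * m"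
    if "norm v \<le> h" "0 \<le> t" "closed_segment (x - t *\<^sub>R v) x \<subseteq> \<Omega>"
      "\<forall>y\<in>closed_segment (x - t *\<^sub>R v) x. f y v \<le> m" "v \<noteq> 0" for x v t m
    using viscosity_segment_bound_nonzero[OF \<Omega> visc, of v "\<lambda>x. f x v" t "x - t *\<^sub>R v" m] that
      G fv by simp
  fix x v t m assume v: "norm v \<le> h" and t: "0 \<le> t" and seg: "closed_segment (x - t *\<^sub>R v) x \<subseteq> \<Omega>"
    and m: "\<forall>y\<in>closed_segment (x - t *\<^sub>R v) x. f y v \<le> m"
  show "u x - u (x - t *\<^sub>R v) \<le> t * m"
  proof (cases "v = 0")
    case False then show ?thesis using nonzero v t seg m by blast
  next
    case True
    have x: "x \<in> \<Omega>" using seg by auto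
    have "0 \<le> f x 0"
    proof (rule ccontr)
      assume "\<not> 0 \<le> f x 0"
      define \<delta> where "\<delta> = - f x 0 / 2"
      have \<delta>: "\<delta> > 0" using \<open>\<not> 0 \<le> f x 0\<close> by (simp add: \<delta>_def)
      have "\<exists>r>0. \<forall>z\<in>\<Omega> \<times> cball 0 h. dist z (x, 0) < r \<longrightarrow> dist (case z of (x, v) \<Rightarrow> f x v) (f x 0) < \<delta>"
        using f[unfolded continuous_on_iff, rule_format, of "(x, 0)" \<delta>] x h \<delta> by auto
      then obtain r where r: "r > 0"
        "\<And>y v. y \<in> \<Omega> \<Longrightarrow> norm v \<le> h \<Longrightarrow> dist (y, v) (x, 0) < r \<Longrightarrow> dist (f y v) (f x 0) < \<delta>"
        by fastforce
      obtain r2 where r2: "r2 > 0" "ball x r2 \<subseteq> \<Omega>" using \<Omega> x by (meson openE)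
      obtain r3 where r3: "r3 > 0" "\<And>y. y \<in> \<Omega> \<Longrightarrow> dist y x < r3 \<Longrightarrow> dist (u y) (u x) < \<delta>"
        using contu x \<delta> unfolding continuous_on_iff by metis
      define \<eta> where "\<eta> = min (min h (r/3)) (min (r2/2) (r3/2))"
      have \<eta>: "\<eta> > 0" "\<eta> \<le> h" "2 * \<eta> < r" "\<eta> < r2" "\<eta> < r3"
        using h r r2 r3 by (auto simp: \<eta>_def)
      obtain e :: 'a where e: "norm e = 1" using vector_choose_size[of 1] by auto
      define w where "w = \<eta> *\<^sub>R e"
      have w: "norm w = \<eta>" using e \<eta> by (simp add: w_def)
      have nb: "dist y x \<le> \<eta>" if "y \<in> closed_segment (x - 1 *\<^sub>R w) x" for y
        using segment_bound(2)[OF that] w by (simp add: dist_norm)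
      have "u x - u (x - 1 *\<^sub>R w) \<le> 1 * (- \<delta>)"
      proof (rule nonzero)
        show "closed_segment (x - 1 *\<^sub>R w) x \<subseteq> \<Omega>"
          using backward_segment_subset_ball[of 1 w r2 x] w \<eta> r2 by auto
        then show "\<forall>y\<in>closed_segment (x - 1 *\<^sub>R w) x. f y w \<le> - \<delta>"
        proof (intro ballI)
          fix y assume sub: "closed_segment (x - 1 *\<^sub>R w) x \<subseteq> \<Omega>" and y: "y \<in> closed_segment (x - 1 *\<^sub>R w) x"
          have "dist (y, w) (x, 0) \<le> dist y x + norm w"
            unfolding dist_Pair_Pair by (rule order_trans[OF sqrt_sum_squares_le_sum]) auto
          then have "dist (f y w) (f x 0) < \<delta>"
            using r(2)[of y w] nb[OF y] w \<eta> sub y by auto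
          then show "f y w \<le> - \<delta>" using \<open>\<not> 0 \<le> f x 0\<close> by (simp add: dist_real_def \<delta>_def)
        qed
      qed (use w \<eta> in auto)
      moreover have "dist (u (x - w)) (u x) < \<delta>"
      proof (rule r3(2))
        show "x - w \<in> \<Omega>" using r2 w \<eta> by (auto simp: subset_eq dist_norm)
        show "dist (x - w) x < r3" using w \<eta> by (simp add: dist_norm)
      qed
      ultimately show False by (simp add: dist_real_def)
    qed
    then show ?thesis using m True t by simp
  qed
qed

section \<open>Discounted occupation measures of polygonal paths\<close>

text \<open>Time runs backwards from the end point \<open>x\<close>, in pieces of given duration and
  velocity. When the list is exhausted the path rests for ever with velocity 0, so it is defined for
  all times and \<open>[]\<close> is a competitor at every point of \<Omega>.\<close>

fun polygon :: "'a::euclidean_space \<Rightarrow> (real \<times> 'a) list \<Rightarrow> real \<Rightarrow> 'a \<times> 'a" where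
  "polygon x [] s = (x, 0)"
| "polygon x ((t, v) # ps) s = (if s < t then (x - s *\<^sub>R v, v) else polygon (x - t *\<^sub>R v) ps (s - t))"

fun admissible :: "'a::euclidean_space set \<Rightarrow> real \<Rightarrow> 'a \<Rightarrow> (real \<times> 'a) list \<Rightarrow> bool" where
  "admissible \<Omega> h x [] \<longleftrightarrow> x \<in> \<Omega>"
| "admissible \<Omega> h x ((t, v) # ps) \<longleftrightarrow> 0 \<le> t \<and> norm v \<le> h \<and> closed_segment (x - t *\<^sub>R v) x \<subseteq> \<Omega> \<and>
     admissible \<Omega> h (x - t *\<^sub>R v) ps"

text \<open>The law of position and velocity at an exponentially distributed time. It has mass 1, so
  integrating a cost against it gives \<rho> times the usual discounted action.\<close>

definition occupation :: "real \<Rightarrow> 'a::euclidean_space \<Rightarrow> (real \<times> 'a) list \<Rightarrow> ('a \<times> 'a) measure" where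
  "occupation \<rho> x ps = distr (density lborel (exponential_density \<rho>)) borel (polygon x ps)"

definition discounted :: "'a::euclidean_space set \<Rightarrow> real \<Rightarrow> real \<Rightarrow> 'a \<Rightarrow> (real \<times> 'a) list \<Rightarrow>
    ('a \<Rightarrow> 'a \<Rightarrow> real) \<Rightarrow> real" where
  "discounted \<Omega> h \<rho> x ps f =
     (\<integral>z. (if z \<in> \<Omega> \<times> cball 0 h then f (fst z) (snd z) else 0) \<partial>occupation \<rho> x ps)"

lemma in_backward_segment:
  fixes x v :: "'a::euclidean_space"
  assumes "0 \<le> s" "s \<le> t" shows "x - s *\<^sub>R v \<in> closed_segment (x - t *\<^sub>R v) x"
proof (cases "t = 0")
  case False
  then have "x - s *\<^sub>R v = (1 - (1 - s/t)) *\<^sub>R (x - t *\<^sub>R v) + (1 - s/t) *\<^sub>R x"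
    by (simp add: algebra_simps)
  then show ?thesis unfolding in_segment using assms False by (intro exI[of _ "1 - s/t"]) auto
qed (use assms in auto)

lemma backward_segment_cases:
  fixes x v :: "'a::euclidean_space"
  assumes "0 \<le> t" "y \<in> closed_segment (x - t *\<^sub>R v) x"
  obtains s where "0 \<le> s" "s \<le> t" "y = x - s *\<^sub>R v"
proof -
  obtain \<theta> where \<theta>: "0 \<le> \<theta>" "\<theta> \<le> 1" "y = (1 - \<theta>) *\<^sub>R (x - t *\<^sub>R v) + \<theta> *\<^sub>R x"
    using assms(2) unfolding in_segment by blast
  show thesis
    by (rule that[of "(1 - \<theta>) * t"]) (use assms \<theta> in \<open>auto simp: mult_left_le_one_le algebra_simps\<close>)
qed

lemma continuous_on_backward_segment:
  fixes f :: "'a::euclidean_space \<Rightarrow> 'a \<Rightarrow> real"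
  assumes f: "continuous_on (\<Omega> \<times> cball 0 h) (\<lambda>(x, v). f x v)" and "norm v \<le> h"
    "closed_segment (x - t *\<^sub>R v) x \<subseteq> \<Omega>"
  shows "continuous_on {0..t} (\<lambda>s. f (x - s *\<^sub>R v) v)"
proof -
  have "continuous_on {0..t} (\<lambda>s. (\<lambda>(x, v). f x v) (x - s *\<^sub>R v, v))"
    by (rule continuous_on_compose2[OF f])
      (use assms in_backward_segment[of _ t x v] in \<open>auto intro!: continuous_intros\<close>)
  then show ?thesis by simp
qed

lemma polygon_in:
  assumes "admissible \<Omega> h x ps" "0 \<le> s" "0 \<le> h"
  shows "polygon x ps s \<in> \<Omega> \<times> cball 0 h"
  using assms
proof (induction ps arbitrary: x s)
  case (Cons p ps)
  obtain t v where p: "p = (t, v)" by (cases p)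
  show ?case
  proof (cases "s < t")
    case True
    then have "x - s *\<^sub>R v \<in> closed_segment (x - t *\<^sub>R v) x"
      using Cons.prems by (intro in_backward_segment) auto
    then show ?thesis using True Cons.prems by (auto simp: p)
  next
    case False
    then show ?thesis using Cons.IH[of "x - t *\<^sub>R v" "s - t"] Cons.prems by (auto simp: p)
  qed
qed simp

lemma polygon_measurable [measurable]: "polygon x ps \<in> borel_measurable borel"
proof (induction ps arbitrary: x)
  case Nil
  have "polygon x [] = (\<lambda>_. (x, 0))" by (rule ext) simp
  then show ?case by simp
next
  case (Cons p ps)
  obtain t v where p: "p = (t, v)" by (cases p)
  have [measurable]: "polygon (x - t *\<^sub>R v) ps \<in> borel_measurable borel" by (rule Cons.IH)
  have "polygon x (p # ps) = (\<lambda>s. if s < t then (x - s *\<^sub>R v, v) else polygon (x - t *\<^sub>R v) ps (s - t))"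
    by (rule ext) (simp add: p)
  then show ?case by simp
qed

lemma sets_occupation [simp]: "sets (occupation \<rho> x ps) = sets borel"
  by (simp add: occupation_def)

lemma prob_space_occupation: "\<rho> > 0 \<Longrightarrow> prob_space (occupation \<rho> x ps)"
  unfolding occupation_def
  by (intro prob_space.prob_space_distr prob_space_exponential_density) auto

lemma integral_occupation:
  fixes F :: "'a::euclidean_space \<times> 'a \<Rightarrow> real"
  assumes "\<rho> > 0" "F \<in> borel_measurable borel"
  shows "(\<integral>z. F z \<partial>occupation \<rho> x ps) = (\<integral>s. exponential_density \<rho> s * F (polygon x ps s) \<partial>lborel)"
proof -
  have "(\<integral>z. F z \<partial>occupation \<rho> x ps) = (\<integral>s. F (polygon x ps s) \<partial>density lborel (exponential_density \<rho>))"
    unfolding occupation_def using assms(2) by (intro integral_distr) auto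
  also have "\<dots> = (\<integral>s. exponential_density \<rho> s *\<^sub>R F (polygon x ps s) \<partial>lborel)"
    using assms by (intro integral_density) (auto intro!: exponential_density_nonneg)
  finally show ?thesis by simp
qed

lemma AE_occupation:
  fixes \<Omega> :: "'a::euclidean_space set"
  assumes "\<rho> > 0" "admissible \<Omega> h x ps" "open \<Omega>" "0 \<le> h"
  shows "AE z in occupation \<rho> x ps. z \<in> \<Omega> \<times> cball 0 h"
proof -
  have S: "\<Omega> \<times> cball 0 h \<in> sets (borel :: ('a \<times> 'a) measure)"
    using assms(3) by (intro borel_Times) auto
  then have [measurable]: "Measurable.pred borel (\<lambda>z::'a \<times> 'a. z \<in> \<Omega> \<times> cball 0 h)"
    by (simp add: pred_def)
  have "AE s in density lborel (exponential_density \<rho>). polygon x ps s \<in> \<Omega> \<times> cball 0 h"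
  proof (subst AE_density)
    show "AE s in lborel. 0 < ennreal (exponential_density \<rho> s) \<longrightarrow> polygon x ps s \<in> \<Omega> \<times> cball 0 h"
      by (rule AE_I2) (use polygon_in[OF assms(2) _ assms(4)] in \<open>auto simp: exponential_density_def\<close>)
  qed simp
  then show ?thesis unfolding occupation_def by (subst AE_distr_iff) (use S in auto)
qed

text \<open>The increments of \<open>g\<close> telescope over a uniform partition so fine that
  \<open>F\<close> varies by less than \<epsilon> on each cell; bounding \<open>F\<close> above and
  below on a cell costs \<open>2 * \<epsilon>\<close> times its length.\<close>

lemma integral_le_of_local_bound:
  fixes F g :: "real \<Rightarrow> real"
  assumes t: "0 \<le> t" and F: "continuous_on {0..t} F"
    and loc: "\<And>a b m. 0 \<le> a \<Longrightarrow> a \<le> b \<Longrightarrow> b \<le> t \<Longrightarrow> (\<And>s. a \<le> s \<Longrightarrow> s \<le> b \<Longrightarrow> F s \<le> m) \<Longrightarrow> g a - g b \<le> (b - a) * m"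
  shows "g 0 - g t \<le> integral {0..t} F"
proof (rule field_le_epsilon)
  fix e :: real assume "e > 0"
  define \<epsilon> where "\<epsilon> = e / (2 * (t + 1))"
  have \<epsilon>: "\<epsilon> > 0" using \<open>e > 0\<close> t by (simp add: \<epsilon>_def)
  obtain \<delta> where \<delta>: "\<delta> > 0" "\<And>s r. s \<in> {0..t} \<Longrightarrow> r \<in> {0..t} \<Longrightarrow> dist r s < \<delta> \<Longrightarrow> dist (F r) (F s) < \<epsilon>"
    using compact_uniformly_continuous[OF F compact_Icc] \<epsilon> unfolding uniformly_continuous_on_def by metis
  obtain n :: nat where n: "t / \<delta> < real n" using reals_Archimedean2 by blast
  have n0: "n > 0" using n t \<delta>(1) by (metis divide_nonneg_pos gr0I less_le_not_le of_nat_0)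
  define d where "d = t / real n"
  have d: "0 \<le> d" "d < \<delta>" using n n0 t \<delta> by (auto simp: d_def field_simps)
  have "g 0 - g (real k * d) \<le> integral {0..real k * d} F + 2 * \<epsilon> * (real k * d)" if "k \<le> n" for k
    using that
  proof (induction k)
    case (Suc k)
    define a where "a = real k * d"
    define b where "b = real (Suc k) * d"
    have ab: "0 \<le> a" "a \<le> b" "b - a = d" using d by (auto simp: a_def b_def algebra_simps)
    have bt: "b \<le> t"
    proof -
      have "b \<le> real n * d" unfolding b_def using Suc.prems d by (intro mult_right_mono) auto
      then show ?thesis using n0 by (simp add: d_def)
    qed
    have close: "\<bar>F s - F a\<bar> < \<epsilon>" if "a \<le> s" "s \<le> b" for s
      using \<delta>(2)[of a s] that ab bt d by (auto simp: dist_real_def)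
    have Fint: "F integrable_on {p..q}" if "0 \<le> p" "q \<le> t" for p q
      by (rule integrable_continuous_interval, rule continuous_on_subset[OF F]) (use that in auto)
    have "g a - g b \<le> (b - a) * (F a + \<epsilon>)"
      by (rule loc) (use ab bt close in \<open>auto simp: abs_less_iff intro!: less_imp_le\<close>, smt (verit) close)
    also have "\<dots> = (b - a) * (F a - \<epsilon>) + 2 * \<epsilon> * d" using ab by (simp add: algebra_simps)
    also have "(b - a) * (F a - \<epsilon>) = integral {a..b} (\<lambda>_. F a - \<epsilon>)" using ab by simp
    also have "\<dots> \<le> integral {a..b} F"
      by (rule integral_le) (use Fint[of a b] ab bt close in \<open>auto simp: abs_less_iff\<close>, smt (verit) close)
    finally have "g a - g b \<le> integral {a..b} F + 2 * \<epsilon> * d" by simp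
    moreover have "integral {0..a} F + integral {a..b} F = integral {0..b} F"
      using ab bt by (intro Henstock_Kurzweil_Integration.integral_combine Fint) auto
    moreover have "g 0 - g a \<le> integral {0..a} F + 2 * \<epsilon> * a"
      using Suc by (simp add: a_def)
    moreover have "2 * \<epsilon> * a + 2 * \<epsilon> * d = 2 * \<epsilon> * b" using ab by (simp add: algebra_simps)
    ultimately show ?case unfolding b_def[symmetric] by linarith
  qed simp
  from this[of n] have "g 0 - g t \<le> integral {0..t} F + 2 * \<epsilon> * t"
    using n0 by (simp add: d_def)
  moreover have "2 * \<epsilon> * t \<le> e" using t \<open>e > 0\<close> by (simp add: \<epsilon>_def field_simps)
  ultimately show "g 0 - g t \<le> integral {0..t} F + e" by linarith
qed

lemma integral_exp_decay:
  fixes \<rho> t :: real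
  assumes "0 \<le> t"
  shows "integral {0..t} (\<lambda>s. \<rho> * exp (- \<rho> * s)) = 1 - exp (- \<rho> * t)"
proof -
  have "((\<lambda>s. \<rho> * exp (- \<rho> * s)) has_integral (- exp (- \<rho> * t)) - (- exp (- \<rho> * 0))) {0..t}"
  proof (rule fundamental_theorem_of_calculus[OF assms])
    fix s
    have "((\<lambda>s. - exp (- \<rho> * s)) has_real_derivative \<rho> * exp (- \<rho> * s)) (at s within {0..t})"
      by (auto intro!: derivative_eq_intros)
    then show "((\<lambda>s. - exp (- \<rho> * s)) has_vector_derivative \<rho> * exp (- \<rho> * s)) (at s within {0..t})"
      by (simp only: has_real_derivative_iff_has_vector_derivative)
  qed
  from integral_unique[OF this] show ?thesis by simp
qed

text \<open>Integration by parts with the derivative placed on the primitive \<open>P\<close> of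
  \<open>F\<close>, because \<open>g\<close> need not be differentiable; afterwards
  \<open>P s\<close> is bounded below by \<open>g 0 - g s\<close> inside the integral.\<close>

lemma discounted_integral_bound:
  fixes F g :: "real \<Rightarrow> real"
  assumes t: "0 \<le> t" and F: "continuous_on {0..t} F" and g: "continuous_on {0..t} g" and \<rho>: "\<rho> \<ge> 0"
    and A: "\<And>s. 0 \<le> s \<Longrightarrow> s \<le> t \<Longrightarrow> g 0 - g s \<le> integral {0..s} F"
  shows "g 0 - exp (- \<rho> * t) * g t - \<rho> * integral {0..t} (\<lambda>s. exp (- \<rho> * s) * g s)
    \<le> integral {0..t} (\<lambda>s. exp (- \<rho> * s) * F s)"
proof -
  define P where "P s = integral {0..s} F" for s
  have dP: "(P has_real_derivative F s) (at s within {0..t})" if "s \<in> {0..t}" for s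
    unfolding P_def using integral_has_real_derivative[OF F that] .
  then have contP: "continuous_on {0..t} P"
    by (meson DERIV_continuous_on)
  have "((\<lambda>s. exp (- \<rho> * s) * F s - \<rho> * (exp (- \<rho> * s) * P s)) has_integral
      exp (- \<rho> * t) * P t - exp (- \<rho> * 0) * P 0) {0..t}"
  proof (rule fundamental_theorem_of_calculus[OF t])
    fix s assume s: "s \<in> {0..t}"
    show "((\<lambda>s. exp (- \<rho> * s) * P s) has_vector_derivative
        exp (- \<rho> * s) * F s - \<rho> * (exp (- \<rho> * s) * P s)) (at s within {0..t})"
      unfolding has_real_derivative_iff_has_vector_derivative[symmetric]
      by (auto intro!: derivative_eq_intros dP[OF s])
  qed
  then have "integral {0..t} (\<lambda>s. exp (- \<rho> * s) * F s - \<rho> * (exp (- \<rho> * s) * P s)) = exp (- \<rho> * t) * P t"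
    by (simp add: integral_unique P_def)
  moreover have "integral {0..t} (\<lambda>s. exp (- \<rho> * s) * F s - \<rho> * (exp (- \<rho> * s) * P s))
      = integral {0..t} (\<lambda>s. exp (- \<rho> * s) * F s) - integral {0..t} (\<lambda>s. \<rho> * (exp (- \<rho> * s) * P s))"
    by (intro Henstock_Kurzweil_Integration.integral_diff integrable_continuous_interval continuous_intros F contP)
  ultimately have eq: "integral {0..t} (\<lambda>s. exp (- \<rho> * s) * F s)
      = exp (- \<rho> * t) * P t + integral {0..t} (\<lambda>s. \<rho> * (exp (- \<rho> * s) * P s))" by simp
  have "integral {0..t} (\<lambda>s. g 0 * (\<rho> * exp (- \<rho> * s)) - \<rho> * (exp (- \<rho> * s) * g s))
      \<le> integral {0..t} (\<lambda>s. \<rho> * (exp (- \<rho> * s) * P s))"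
  proof (intro integral_le integrable_continuous_interval continuous_intros g contP)
    fix s assume "s \<in> {0..t}"
    then have "g 0 - g s \<le> P s" using A by (simp add: P_def)
    then have "(\<rho> * exp (- \<rho> * s)) * (g 0 - g s) \<le> (\<rho> * exp (- \<rho> * s)) * P s"
      using \<rho> by (intro mult_left_mono) auto
    then show "g 0 * (\<rho> * exp (- \<rho> * s)) - \<rho> * (exp (- \<rho> * s) * g s) \<le> \<rho> * (exp (- \<rho> * s) * P s)"
      by (simp add: algebra_simps)
  qed
  moreover have "integral {0..t} (\<lambda>s. g 0 * (\<rho> * exp (- \<rho> * s)) - \<rho> * (exp (- \<rho> * s) * g s))
      = g 0 * (1 - exp (- \<rho> * t)) - \<rho> * integral {0..t} (\<lambda>s. exp (- \<rho> * s) * g s)"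
  proof -
    have "integral {0..t} (\<lambda>s. g 0 * (\<rho> * exp (- \<rho> * s)) - \<rho> * (exp (- \<rho> * s) * g s))
      = integral {0..t} (\<lambda>s. g 0 * (\<rho> * exp (- \<rho> * s))) - integral {0..t} (\<lambda>s. \<rho> * (exp (- \<rho> * s) * g s))"
      by (intro Henstock_Kurzweil_Integration.integral_diff integrable_continuous_interval continuous_intros g)
    then show ?thesis using integral_exp_decay[OF t, of \<rho>] by simp
  qed
  moreover have "exp (- \<rho> * t) * (g 0 - g t) \<le> exp (- \<rho> * t) * P t"
    using A[of t] t by (intro mult_left_mono) (auto simp: P_def)
  ultimately show ?thesis unfolding eq by (simp add: algebra_simps)
qed

section \<open>The discounted functional along admissible polygons at a fixed rate\<close>

context
  fixes \<Omega> :: "'a::euclidean_space set" and h \<rho> :: real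
  assumes open_\<Omega>: "open \<Omega>" and h: "0 \<le> h" and \<rho>: "0 < \<rho>"
begin

lemma extension_measurable:
  assumes "continuous_on (\<Omega> \<times> cball 0 h) (\<lambda>(x, v). f x v)"
  shows "(\<lambda>z. if z \<in> \<Omega> \<times> cball 0 h then f (fst z) (snd z) else (0::real)) \<in> borel_measurable borel"
  using assms open_\<Omega> by (intro borel_measurable_continuous_on_if borel_Times) (auto simp: case_prod_unfold)

lemma discounted_eq_lborel:
  assumes "continuous_on (\<Omega> \<times> cball 0 h) (\<lambda>(x, v). f x v)"
  shows "discounted \<Omega> h \<rho> x ps f = (\<integral>s. exponential_density \<rho> s *
      (if polygon x ps s \<in> \<Omega> \<times> cball 0 h then f (fst (polygon x ps s)) (snd (polygon x ps s)) else 0) \<partial>lborel)"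
  unfolding discounted_def by (rule integral_occupation[OF \<rho> extension_measurable[OF assms]])

lemma discounted_const_on:
  assumes "admissible \<Omega> h x ps" "\<And>s. 0 \<le> s \<Longrightarrow> f (fst (polygon x ps s)) (snd (polygon x ps s)) = c"
    and "continuous_on (\<Omega> \<times> cball 0 h) (\<lambda>(x, v). f x v)"
  shows "discounted \<Omega> h \<rho> x ps f = c"
proof -
  interpret prob_space "density lborel (exponential_density \<rho>)"
    by (rule prob_space_exponential_density[OF \<rho>])
  have "discounted \<Omega> h \<rho> x ps f = (\<integral>s. exponential_density \<rho> s *\<^sub>R c \<partial>lborel)"
    unfolding discounted_eq_lborel[OF assms(3)]
    by (rule Bochner_Integration.integral_cong)
      (use polygon_in[OF assms(1) _ h] assms(2) in \<open>auto simp: exponential_density_def\<close>)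
  also have "\<dots> = (\<integral>s. c \<partial>density lborel (exponential_density \<rho>))"
    by (rule integral_density[symmetric]) (use exponential_density_nonneg[OF \<rho>] in auto)
  also have "\<dots> = c" using prob_space by simp
  finally show ?thesis .
qed

lemma integrable_discounted:
  assumes "admissible \<Omega> h x ps" and f: "continuous_on (\<Omega> \<times> cball 0 h) (\<lambda>(x, v). f x v)"
    and B: "\<forall>x\<in>\<Omega>. \<forall>v\<in>cball 0 h. \<bar>f x v\<bar> \<le> (B::real)"
  shows "integrable (occupation \<rho> x ps) (\<lambda>z. if z \<in> \<Omega> \<times> cball 0 h then f (fst z) (snd z) else 0)"
    (is "integrable _ ?F")
proof (rule finite_measure.integrable_const_bound)
  show "finite_measure (occupation \<rho> x ps)"
    using prob_space_occupation[OF \<rho>, of x ps] unfolding prob_space_def by simp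
  show "AE z in occupation \<rho> x ps. norm (?F z) \<le> B"
    using AE_occupation[OF \<rho> assms(1) open_\<Omega> h] by eventually_elim (use B in auto)
  show "?F \<in> borel_measurable (occupation \<rho> x ps)"
    using extension_measurable[OF f] by (simp add: measurable_cong_sets[OF sets_occupation refl])
qed

text \<open>The exponential law has no memory: conditioned on exceeding \<open>t\<close>, the
  remaining time has the same law, and the event has probability \<open>exp (- \<rho> * t)\<close>.
  Dynamic programming and inductions over paths rest on this identity.\<close>

lemma discounted_Cons:
  assumes adm: "admissible \<Omega> h x ((t, v) # ps)" and f: "continuous_on (\<Omega> \<times> cball 0 h) (\<lambda>(x, v). f x v)"
    and B: "\<forall>x\<in>\<Omega>. \<forall>v\<in>cball 0 h. \<bar>f x v\<bar> \<le> (B::real)"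
  shows "discounted \<Omega> h \<rho> x ((t, v) # ps) f = \<rho> * integral {0..t} (\<lambda>s. exp (- \<rho> * s) * f (x - s *\<^sub>R v) v)
    + exp (- \<rho> * t) * discounted \<Omega> h \<rho> (x - t *\<^sub>R v) ps f"
proof -
  define F where "F z = (if z \<in> \<Omega> \<times> cball 0 h then f (fst z) (snd z) else 0)" for z
  have Fm [measurable]: "F \<in> borel_measurable borel"
    unfolding F_def by (rule extension_measurable[OF f])
  have t: "0 \<le> t" and v: "norm v \<le> h" and seg: "closed_segment (x - t *\<^sub>R v) x \<subseteq> \<Omega>"
    and adm': "admissible \<Omega> h (x - t *\<^sub>R v) ps" using adm by auto
  have on_seg: "x - s *\<^sub>R v \<in> \<Omega>" if "0 \<le> s" "s \<le> t" for s
    using in_backward_segment[OF that] seg by blast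
  define g where "g s = \<rho> * (exp (- \<rho> * s) * f (x - s *\<^sub>R v) v)" for s
  have contf: "continuous_on {0..t} (\<lambda>s. f (x - s *\<^sub>R v) v)"
    by (rule continuous_on_backward_segment[OF f v seg])
  have contg: "continuous_on {0..t} g" unfolding g_def by (intro continuous_intros contf)
  have gint: "set_integrable lborel {0..t} g"
    by (rule borel_integrable_atLeastAtMost'[OF contg])
  have g_eq: "(LINT s:{0..t}|lborel. g s) = \<rho> * integral {0..t} (\<lambda>s. exp (- \<rho> * s) * f (x - s *\<^sub>R v) v)"
    unfolding set_borel_integral_eq_integral(2)[OF gint] by (simp add: g_def[abs_def])
  define E where "E s = exponential_density \<rho> s * F (polygon (x - t *\<^sub>R v) ps s)" for s
  have Em [measurable]: "E \<in> borel_measurable borel" unfolding E_def by measurable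
  have Eint: "integrable lborel E"
  proof -
    have "integrable (occupation \<rho> (x - t *\<^sub>R v) ps) F"
      using integrable_discounted[OF adm' f B] unfolding F_def .
    then have "integrable (density lborel (exponential_density \<rho>)) (\<lambda>s. F (polygon (x - t *\<^sub>R v) ps s))"
      unfolding occupation_def by (subst (asm) integrable_distr_eq) auto
    then show ?thesis unfolding E_def
      by (subst (asm) integrable_density) (auto intro!: exponential_density_nonneg \<rho>)
  qed
  have Esh: "integrable lborel (\<lambda>s. E (s - t))"
    using lborel_integrable_real_affine[OF Eint, of 1 "- t"] by (simp add: add.commute)
  have Eeq: "(\<integral>s. E (s - t) \<partial>lborel) = (\<integral>s. E s \<partial>lborel)"
    using lborel_integral_real_affine[of 1 E "- t"] by (simp add: add.commute)
  have "discounted \<Omega> h \<rho> x ((t, v) # ps) f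
      = (\<integral>s. exponential_density \<rho> s * F (polygon x ((t, v) # ps) s) \<partial>lborel)"
    unfolding discounted_eq_lborel[OF f] F_def ..
  also have "\<dots> = (\<integral>s. indicator {0..t} s *\<^sub>R g s + exp (- \<rho> * t) * E (s - t) \<partial>lborel)"
  proof (rule integral_cong_AE)
    show "(\<lambda>s. exponential_density \<rho> s * F (polygon x ((t, v) # ps) s)) \<in> borel_measurable lborel"
      by measurable
    show "(\<lambda>s. indicator {0..t} s *\<^sub>R g s + exp (- \<rho> * t) * E (s - t)) \<in> borel_measurable lborel"
      using gint unfolding set_integrable_def by (intro borel_measurable_add) auto
    show "AE s in lborel. exponential_density \<rho> s * F (polygon x ((t, v) # ps) s)
        = indicator {0..t} s *\<^sub>R g s + exp (- \<rho> * t) * E (s - t)"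
      \<comment> \<open>At the single time \<open>t\<close> both pieces on the right can contribute,
        so the integrands agree only almost everywhere.\<close>
      using AE_lborel_singleton[of t]
    proof eventually_elim
      case (elim s)
      consider "s < 0" | "0 \<le> s" "s < t" | "t < s" using elim by linarith
      then show ?case
      proof cases
        case 1 then show ?thesis using t by (simp add: exponential_density_def E_def)
      next
        case 2
        then show ?thesis using on_seg[of s] v
          by (simp add: exponential_density_def E_def F_def g_def mult.commute)
      next
        case 3
        have "exp (- \<rho> * t) * exp (- (s - t) * \<rho>) = exp (- s * \<rho>)"
          by (simp add: exp_add[symmetric] algebra_simps)
        then show ?thesis using 3 t by (simp add: exponential_density_def E_def mult.left_commute)
      qed
    qed
  qed
  also have "\<dots> = (LINT s:{0..t}|lborel. g s) + (\<integral>s. exp (- \<rho> * t) * E (s - t) \<partial>lborel)"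
    unfolding set_lebesgue_integral_def
    by (rule Bochner_Integration.integral_add)
      (use gint Esh in \<open>auto simp: set_integrable_def\<close>)
  also have "(\<integral>s. exp (- \<rho> * t) * E (s - t) \<partial>lborel) = exp (- \<rho> * t) * (\<integral>s. E s \<partial>lborel)"
    by (simp add: Eeq)
  also have "(\<integral>s. E s \<partial>lborel) = discounted \<Omega> h \<rho> (x - t *\<^sub>R v) ps f"
    unfolding discounted_eq_lborel[OF f] E_def F_def ..
  finally show ?thesis unfolding g_eq .
qed

lemma abs_discounted_le:
  assumes "admissible \<Omega> h x ps" "continuous_on (\<Omega> \<times> cball 0 h) (\<lambda>(x, v). f x v)"
    and B: "\<forall>x\<in>\<Omega>. \<forall>v\<in>cball 0 h. \<bar>f x v\<bar> \<le> (B::real)"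
  shows "\<bar>discounted \<Omega> h \<rho> x ps f\<bar> \<le> B"
proof -
  interpret prob_space "occupation \<rho> x ps" by (rule prob_space_occupation[OF \<rho>])
  let ?F = "\<lambda>z. if z \<in> \<Omega> \<times> cball 0 h then f (fst z) (snd z) else 0"
  have int: "integrable (occupation \<rho> x ps) ?F" by (rule integrable_discounted[OF assms])
  have ae: "AE z in occupation \<rho> x ps. \<bar>?F z\<bar> \<le> B"
    using AE_occupation[OF \<rho> assms(1) open_\<Omega> h] by eventually_elim (use B in auto)
  have "discounted \<Omega> h \<rho> x ps f \<le> B" "- B \<le> discounted \<Omega> h \<rho> x ps f"
    unfolding discounted_def
    by (rule integral_le_const[OF int], use ae in eventually_elim, simp add: abs_le_iff)
       (rule integral_ge_const[OF int], use ae in eventually_elim, simp add: abs_le_iff)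
  then show ?thesis by linarith
qed

lemma discounted_add_const:
  assumes "admissible \<Omega> h x ps" "continuous_on (\<Omega> \<times> cball 0 h) (\<lambda>(x, v). f x v)"
    and B: "\<forall>x\<in>\<Omega>. \<forall>v\<in>cball 0 h. \<bar>f x v\<bar> \<le> (B::real)"
  shows "discounted \<Omega> h \<rho> x ps (\<lambda>x v. f x v + c) = discounted \<Omega> h \<rho> x ps f + c"
proof -
  interpret prob_space "occupation \<rho> x ps" by (rule prob_space_occupation[OF \<rho>])
  let ?F = "\<lambda>z. if z \<in> \<Omega> \<times> cball 0 h then f (fst z) (snd z) else 0"
  have int: "integrable (occupation \<rho> x ps) ?F" by (rule integrable_discounted[OF assms])
  have cont: "continuous_on (\<Omega> \<times> cball 0 h) (\<lambda>(x, v). f x v + c)"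
    using assms(2) by (auto simp: case_prod_unfold intro!: continuous_intros)
  have "discounted \<Omega> h \<rho> x ps (\<lambda>x v. f x v + c) = (\<integral>z. ?F z + c \<partial>occupation \<rho> x ps)"
    unfolding discounted_def
  proof (rule integral_cong_AE)
    show "(\<lambda>z. if z \<in> \<Omega> \<times> cball 0 h then f (fst z) (snd z) + c else 0) \<in> borel_measurable (occupation \<rho> x ps)"
      using extension_measurable[OF cont] by (simp add: measurable_cong_sets[OF sets_occupation refl])
    show "AE z in occupation \<rho> x ps. (if z \<in> \<Omega> \<times> cball 0 h then f (fst z) (snd z) + c else 0) = ?F z + c"
      using AE_occupation[OF \<rho> assms(1) open_\<Omega> h] by eventually_elim auto
  qed (use int in auto)
  also have "\<dots> = discounted \<Omega> h \<rho> x ps f + c"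
    unfolding discounted_def using int prob_space by simp
  finally show ?thesis .
qed

lemma discounted_le_segment:
  assumes adm: "admissible \<Omega> h x ((t, v) # ps)" and f: "continuous_on (\<Omega> \<times> cball 0 h) (\<lambda>(x, v). f x v)"
    and B: "\<forall>x\<in>\<Omega>. \<forall>v\<in>cball 0 h. \<bar>f x v\<bar> \<le> (B::real)"
    and m: "\<And>y. y \<in> closed_segment (x - t *\<^sub>R v) x \<Longrightarrow> f y v \<le> m"
  shows "discounted \<Omega> h \<rho> x ((t, v) # ps) f
    \<le> (1 - exp (- \<rho> * t)) * m + exp (- \<rho> * t) * discounted \<Omega> h \<rho> (x - t *\<^sub>R v) ps f"
proof -
  have t: "0 \<le> t" and v: "norm v \<le> h" and seg: "closed_segment (x - t *\<^sub>R v) x \<subseteq> \<Omega>" using adm by auto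
  have contf: "continuous_on {0..t} (\<lambda>s. f (x - s *\<^sub>R v) v)"
    by (rule continuous_on_backward_segment[OF f v seg])
  have "\<rho> * integral {0..t} (\<lambda>s. exp (- \<rho> * s) * f (x - s *\<^sub>R v) v)
      = integral {0..t} (\<lambda>s. \<rho> * (exp (- \<rho> * s) * f (x - s *\<^sub>R v) v))" by simp
  also have "\<dots> \<le> integral {0..t} (\<lambda>s. (\<rho> * exp (- \<rho> * s)) * m)"
    using in_backward_segment[of _ t x v] m \<rho>
    by (intro integral_le integrable_continuous_interval continuous_intros contf)
      (auto intro!: mult_left_mono)
  also have "\<dots> = (1 - exp (- \<rho> * t)) * m"
    using integral_exp_decay[OF t, of \<rho>] by simp
  finally show ?thesis unfolding discounted_Cons[OF adm f B] by simp
qed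

text \<open>Along a path the increments of \<open>u\<close> are at most the integrated cost, and
  discounting turns this into an inequality whose left side carries a factor \<rho>. As \<rho> tends
  to 0 it forces limits of occupation measures into the dual cone of \<open>G0\<close>; with cost L
  + c(0), division by \<rho> compares \<open>u x\<close> with the value function.\<close>

lemma discounted_ge_potential:
  assumes "admissible \<Omega> h x ps" and f: "continuous_on (\<Omega> \<times> cball 0 h) (\<lambda>(x, v). f x v)"
    and B: "\<forall>x\<in>\<Omega>. \<forall>v\<in>cball 0 h. \<bar>f x v\<bar> \<le> (B::real)"
    and u: "continuous_on \<Omega> u" and C: "\<forall>x\<in>\<Omega>. \<bar>u x\<bar> \<le> C"
    and sub: "segment_subsolution \<Omega> h f u"
  shows "\<rho> * (u x - discounted \<Omega> h \<rho> x ps (\<lambda>x v. u x)) \<le> discounted \<Omega> h \<rho> x ps f"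
  using assms(1)
proof (induction ps arbitrary: x)
  have contu: "continuous_on (\<Omega> \<times> cball 0 h) (\<lambda>(x, v). u x)"
    using u by (auto simp: case_prod_unfold intro!: continuous_on_compose2[OF u] continuous_intros)
  {
    case Nil
    then have x: "x \<in> \<Omega>" by simp
    have "discounted \<Omega> h \<rho> x [] f = f x 0" "discounted \<Omega> h \<rho> x [] (\<lambda>x v. u x) = u x"
      by (rule discounted_const_on[OF Nil]; use f contu in simp)+
    moreover have "0 \<le> f x 0"
      using segment_subsolutionD[OF sub, of 0 1 x "f x 0"] x h by simp
    ultimately show ?case by simp
  next
    case (Cons p ps)
    obtain t v where p: "p = (t, v)" by (cases p)
    note adm = Cons.prems[unfolded p]
    have C': "\<forall>x\<in>\<Omega>. \<forall>v\<in>cball (0::'a) h. \<bar>u x\<bar> \<le> C" using C by blast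
    have t: "0 \<le> t" and v: "norm v \<le> h" and seg: "closed_segment (x - t *\<^sub>R v) x \<subseteq> \<Omega>"
      and adm': "admissible \<Omega> h (x - t *\<^sub>R v) ps" using adm by auto
    have on_seg: "x - s *\<^sub>R v \<in> \<Omega>" if "0 \<le> s" "s \<le> t" for s
      using in_backward_segment[OF that] seg by blast
    have contf: "continuous_on {0..t} (\<lambda>s. f (x - s *\<^sub>R v) v)"
      by (rule continuous_on_backward_segment[OF f v seg])
    have contg: "continuous_on {0..t} (\<lambda>s. u (x - s *\<^sub>R v))"
      by (rule continuous_on_compose2[OF u]) (auto intro!: continuous_intros on_seg)
    have local: "u (x - a *\<^sub>R v) - u (x - b *\<^sub>R v) \<le> (b - a) * m"
      if "0 \<le> a" "a \<le> b" "b \<le> t" "\<And>s. a \<le> s \<Longrightarrow> s \<le> b \<Longrightarrow> f (x - s *\<^sub>R v) v \<le> m" for a b m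
    proof -
      have eq: "x - a *\<^sub>R v - (b - a) *\<^sub>R v = x - b *\<^sub>R v" by (simp add: algebra_simps)
      have cases: "\<exists>s. a \<le> s \<and> s \<le> b \<and> y = x - s *\<^sub>R v"
        if "y \<in> closed_segment (x - a *\<^sub>R v - (b - a) *\<^sub>R v) (x - a *\<^sub>R v)" for y
      proof -
        from \<open>a \<le> b\<close> have "0 \<le> b - a" by simp
        from backward_segment_cases[OF this that] obtain s where
          "0 \<le> s" "s \<le> b - a" "y = x - a *\<^sub>R v - s *\<^sub>R v" .
        then show ?thesis by (intro exI[of _ "a + s"]) (auto simp: algebra_simps)
      qed
      have "u (x - a *\<^sub>R v) - u (x - a *\<^sub>R v - (b - a) *\<^sub>R v) \<le> (b - a) * m"
      proof (rule segment_subsolutionD[OF sub v])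
        show "closed_segment (x - a *\<^sub>R v - (b - a) *\<^sub>R v) (x - a *\<^sub>R v) \<subseteq> \<Omega>"
          using cases on_seg that by fastforce
      qed (use cases that in fastforce)+
      then show ?thesis unfolding eq .
    qed
    have "u (x - 0 *\<^sub>R v) - exp (- \<rho> * t) * u (x - t *\<^sub>R v)
          - \<rho> * integral {0..t} (\<lambda>s. exp (- \<rho> * s) * u (x - s *\<^sub>R v))
        \<le> integral {0..t} (\<lambda>s. exp (- \<rho> * s) * f (x - s *\<^sub>R v) v)"
    proof (rule discounted_integral_bound[OF t contf contg])
      fix s assume s: "0 \<le> s" "s \<le> t"
      show "u (x - 0 *\<^sub>R v) - u (x - s *\<^sub>R v) \<le> integral {0..s} (\<lambda>s. f (x - s *\<^sub>R v) v)"
        by (rule integral_le_of_local_bound[OF s(1)])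
          (use s local in \<open>auto intro: continuous_on_subset[OF contf]\<close>)
    qed (use \<rho> in simp)
    then have "\<rho> * (u x - exp (- \<rho> * t) * u (x - t *\<^sub>R v)
          - \<rho> * integral {0..t} (\<lambda>s. exp (- \<rho> * s) * u (x - s *\<^sub>R v)))
        \<le> \<rho> * integral {0..t} (\<lambda>s. exp (- \<rho> * s) * f (x - s *\<^sub>R v) v)"
      using \<rho> by (intro mult_left_mono) auto
    moreover have "exp (- \<rho> * t) * (\<rho> * (u (x - t *\<^sub>R v) - discounted \<Omega> h \<rho> (x - t *\<^sub>R v) ps (\<lambda>x v. u x)))
        \<le> exp (- \<rho> * t) * discounted \<Omega> h \<rho> (x - t *\<^sub>R v) ps f"
      using Cons.IH[OF adm'] by (intro mult_left_mono) auto
    ultimately show ?case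
      unfolding p discounted_Cons[OF adm f B] discounted_Cons[OF adm contu C']
      by (simp add: algebra_simps)
  }
qed

end

section \<open>The Lagrangian\<close>

locale star_shaped_hamiltonian =
  fixes \<Omega> :: "'a::euclidean_space set" and H :: "'a \<Rightarrow> 'a \<Rightarrow> real" and R0 h :: real
  assumes open_\<Omega>: "open \<Omega>" and bounded_\<Omega>: "bounded \<Omega>" and zero_in_\<Omega>: "0 \<in> \<Omega>"
    and double_\<Omega>: "(\<lambda>x. 2 *\<^sub>R x) ` \<Omega> \<subseteq> ball 0 R0"
    and continuous_H: "continuous_on (cball 0 R0 \<times> UNIV) (\<lambda>(x, p). H x p)"
    and H1: "assm_H1 R0 H" and H2: "assm_H2 R0 H" and H4: "assm_H4 R0 H"
    and A1: "assm_A1 \<Omega>"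
    and normalizing: "normalizing_bound \<Omega> H h"
begin

abbreviation "L \<equiv> lagrangian H"
abbreviation "c0 \<equiv> additive_eigenvalue \<Omega> H"

lemma h_pos: "h > 0" using normalizing by (simp add: normalizing_bound_def)

lemma norm_closure_\<Omega>: "x \<in> closure \<Omega> \<Longrightarrow> norm x \<le> R0 / 2"
proof -
  have "\<Omega> \<subseteq> cball 0 (R0 / 2)" using double_\<Omega> by (force simp: subset_eq)
  then have "closure \<Omega> \<subseteq> cball 0 (R0 / 2)" by (rule closure_minimal) simp
  then show "x \<in> closure \<Omega> \<Longrightarrow> norm x \<le> R0 / 2" by auto
qed

lemma R0_pos: "R0 > 0"
proof -
  have "2 *\<^sub>R (0::'a) \<in> ball 0 R0" using double_\<Omega> zero_in_\<Omega> by blast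
  then show ?thesis by simp
qed

lemma closure_\<Omega>_cball: "x \<in> closure \<Omega> \<Longrightarrow> x \<in> cball 0 R0"
  using norm_closure_\<Omega>[of x] R0_pos by auto

lemma \<Omega>_closure: "x \<in> \<Omega> \<Longrightarrow> x \<in> closure \<Omega>" using closure_subset by blast

lemma \<Omega>_cball: "x \<in> \<Omega> \<Longrightarrow> x \<in> cball 0 R0" using \<Omega>_closure closure_\<Omega>_cball by blast

lemma compact_closure_\<Omega>: "compact (closure \<Omega>)" using bounded_\<Omega> by simp

lemma continuous_H_p: "x \<in> cball 0 R0 \<Longrightarrow> continuous_on S (H x)"
  using continuous_on_compose2[OF continuous_H continuous_on_Pair[OF continuous_on_const[of _ x] continuous_on_id]]
  by (auto simp: image_subset_iff)

lemma continuous_H_x: "continuous_on (cball 0 R0) (\<lambda>x. H x p)"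
  using continuous_on_compose2[OF continuous_H continuous_on_Pair[OF continuous_on_id continuous_on_const[of _ p]]]
  by (auto simp: image_subset_iff)

lemma H_zero_bounded: obtains M where "\<And>x. x \<in> cball 0 R0 \<Longrightarrow> \<bar>H x 0\<bar> \<le> M"
proof -
  have "bounded ((\<lambda>x. H x 0) ` cball 0 R0)"
    by (intro compact_imp_bounded compact_continuous_image continuous_H_x compact_cball)
  then obtain M where "\<forall>x\<in>cball 0 R0. \<bar>H x 0\<bar> \<le> M" unfolding bounded_iff by auto
  then show thesis using that by blast
qed

lemma fenchel: "x \<in> cball 0 R0 \<Longrightarrow> p \<bullet> v - H x p \<le> L x v"
  unfolding lagrangian_def using H4 by (intro cSUP_upper) (auto simp: assm_H4_def)

lemma L_leI: "(\<And>p. p \<bullet> v - H x p \<le> a) \<Longrightarrow> L x v \<le> a"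
  unfolding lagrangian_def by (rule cSUP_least) auto

text \<open>Finiteness of the Lagrangian at finitely many large velocities, uniformly in the
  position by continuity on the compact ball, bounds \<open>H\<close> below through Fenchel's
  inequality. The slope \<open>h + 1\<close> beats every velocity of norm at most
  \<open>h\<close>.\<close>

lemma superlinear:
  obtains M where "\<And>x p. x \<in> cball 0 R0 \<Longrightarrow> (h + 1) * norm p - M \<le> H x p"
proof -
  \<comment> \<open>Some coordinate of \<open>p\<close> has modulus at least
    \<open>norm p / DIM('a)\<close>; a velocity of length \<open>k\<close> along that axis makes
    \<open>p \<bullet> v\<close> at least \<open>(h + 1) * norm p\<close>.\<close>
  define k where "k = (h + 1) * real DIM('a)"
  define V where "V = (\<lambda>b. k *\<^sub>R b) ` (Basis :: 'a set) \<union> (\<lambda>b. - k *\<^sub>R b) ` Basis"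
  have k: "k > 0" using h_pos by (simp add: k_def)
  have "\<exists>M. \<forall>x\<in>cball 0 R0. L x v \<le> M" for v
  proof -
    obtain D where "\<And>x. x \<in> cball 0 R0 \<Longrightarrow>
        ((\<lambda>y. L y v) has_derivative (\<lambda>y. D x \<bullet> y)) (at x within cball 0 R0)"
      using H4 unfolding assm_H4_def by blast
    then have "continuous_on (cball 0 R0) (\<lambda>x. L x v)"
      by (rule has_derivative_continuous_on)
    then have "bounded ((\<lambda>x. L x v) ` cball 0 R0)"
      by (intro compact_imp_bounded compact_continuous_image) auto
    then obtain M where "\<forall>x\<in>cball 0 R0. \<bar>L x v\<bar> \<le> M"
      by (auto simp: bounded_iff)
    then show ?thesis by (meson abs_le_D1)
  qed
  then obtain M0 where M0: "\<And>v x. x \<in> cball 0 R0 \<Longrightarrow> L x v \<le> M0 v" by metis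
  define M where "M = Max (M0 ` V)"
  have finV: "finite V" by (simp add: V_def)
  show thesis
  proof (rule that[of M])
    fix x p :: 'a assume x: "x \<in> cball 0 R0"
    have "\<exists>b\<in>Basis. norm p \<le> real DIM('a) * \<bar>p \<bullet> b\<bar>"
    proof (rule ccontr)
      assume "\<not> ?thesis"
      then have "\<bar>p \<bullet> b\<bar> < norm p / real DIM('a)" if "b \<in> Basis" for b
        using that by (force simp: field_simps)
      then have "(\<Sum>b\<in>Basis. \<bar>p \<bullet> b\<bar>) < (\<Sum>b\<in>(Basis::'a set). norm p / real DIM('a))"
        by (rule sum_strict_mono[OF finite_Basis nonempty_Basis])
      then show False using norm_le_l1[of p] by simp
    qed
    then obtain b where b: "b \<in> Basis" "norm p \<le> real DIM('a) * \<bar>p \<bullet> b\<bar>" by blast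
    define v where "v = (if p \<bullet> b \<ge> 0 then k *\<^sub>R b else - k *\<^sub>R b)"
    have vV: "v \<in> V" using b by (auto simp: V_def v_def)
    have "p \<bullet> v = k * \<bar>p \<bullet> b\<bar>" by (simp add: v_def)
    moreover have "(h + 1) * norm p \<le> k * \<bar>p \<bullet> b\<bar>"
      using mult_left_mono[OF b(2), of "h + 1"] h_pos by (simp add: k_def mult.assoc)
    moreover have "p \<bullet> v - H x p \<le> M"
    proof -
      have "M0 v \<le> M" unfolding M_def by (rule Max_ge) (use finV vV in auto)
      then show ?thesis using fenchel[OF x, of p v] M0[OF x, of v] by linarith
    qed
    ultimately show "(h + 1) * norm p - M \<le> H x p" by linarith
  qed
qed

text \<open>For velocities in the ball of radius \<open>h\<close> only bounded \<open>p\<close> matter in the supremum defining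
  the Lagrangian, so that it inherits the Lipschitz bounds of the Hamiltonian.\<close>

lemma L_lipschitz:
  obtains \<Lambda> where "\<Lambda> \<ge> 0" "\<And>x y v w. x \<in> cball 0 R0 \<Longrightarrow> y \<in> cball 0 R0 \<Longrightarrow> norm v \<le> h \<Longrightarrow> norm w \<le> h \<Longrightarrow>
    \<bar>L x v - L y w\<bar> \<le> \<Lambda> * (norm (x - y) + norm (v - w))"
proof -
  obtain M where M: "\<And>x p. x \<in> cball 0 R0 \<Longrightarrow> (h + 1) * norm p - M \<le> H x p"
    using superlinear by blast
  obtain M0 where M0: "\<And>x. x \<in> cball 0 R0 \<Longrightarrow> \<bar>H x 0\<bar> \<le> M0" using H_zero_bounded by blast
  \<comment> \<open>Beyond this radius \<open>p \<bullet> v - H x p\<close> is below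
    \<open>- M0\<close>, which bounds the Lagrangian from below already through
    \<open>p = 0\<close>.\<close>
  define R where "R = max 1 (M + M0)"
  have R: "R > 0" "R \<ge> M + M0" by (auto simp: R_def)
  obtain C where C: "\<And>x y p. x \<in> cball 0 R0 \<Longrightarrow> y \<in> cball 0 R0 \<Longrightarrow> norm p \<le> R \<Longrightarrow>
      \<bar>H x p - H y p\<bar> \<le> C * norm (x - y)"
  proof -
    have "\<exists>C. \<forall>x\<in>cball 0 R0. \<forall>y\<in>cball 0 R0. \<forall>p\<in>cball 0 R. \<forall>q\<in>cball 0 R.
        \<bar>H x p - H y p\<bar> \<le> C * norm (x - y) \<and> \<bar>H x p - H x q\<bar> \<le> C * norm (p - q)"
      using H1 R(1) unfolding assm_H1_def by blast
    then obtain C where C: "\<forall>x\<in>cball 0 R0. \<forall>y\<in>cball 0 R0. \<forall>p\<in>cball 0 R. \<forall>q\<in>cball 0 R.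
        \<bar>H x p - H y p\<bar> \<le> C * norm (x - y) \<and> \<bar>H x p - H x q\<bar> \<le> C * norm (p - q)" ..
    show thesis
    proof (rule that[of C])
      fix x y p :: 'a assume "x \<in> cball 0 R0" "y \<in> cball 0 R0" "norm p \<le> R"
      then have "p \<in> cball 0 R" by simp
      then show "\<bar>H x p - H y p\<bar> \<le> C * norm (x - y)" using C \<open>x \<in> _\<close> \<open>y \<in> _\<close> by blast
    qed
  qed
  define \<Lambda> where "\<Lambda> = max \<bar>C\<bar> R"
  have half: "L x v \<le> L y w + \<Lambda> * (norm (x - y) + norm (v - w))"
    if xy: "x \<in> cball 0 R0" "y \<in> cball 0 R0" and vw: "norm v \<le> h" "norm w \<le> h" for x y v w
  proof (rule L_leI)
    fix p
    have \<Lambda>0: "0 \<le> \<Lambda> * (norm (x - y) + norm (v - w))" using R by (simp add: \<Lambda>_def)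
    show "p \<bullet> v - H x p \<le> L y w + \<Lambda> * (norm (x - y) + norm (v - w))"
    proof (cases "norm p \<le> R")
      case True
      have "p \<bullet> v - H x p = (p \<bullet> w - H y p) + (H y p - H x p) + p \<bullet> (v - w)"
        by (simp add: inner_diff_right)
      moreover have "H y p - H x p \<le> \<Lambda> * norm (x - y)"
      proof -
        have "H y p - H x p \<le> C * norm (x - y)" using C[OF xy True] by linarith
        also have "\<dots> \<le> \<Lambda> * norm (x - y)" by (intro mult_right_mono) (auto simp: \<Lambda>_def)
        finally show ?thesis .
      qed
      moreover have "p \<bullet> (v - w) \<le> \<Lambda> * norm (v - w)"
      proof -
        have "p \<bullet> (v - w) \<le> norm p * norm (v - w)" by (rule norm_cauchy_schwarz)
        also have "\<dots> \<le> \<Lambda> * norm (v - w)" using True by (intro mult_right_mono) (auto simp: \<Lambda>_def)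
        finally show ?thesis .
      qed
      ultimately show ?thesis using fenchel[OF xy(2), of p w] by (simp add: distrib_left)
    next
      case False
      have "p \<bullet> v \<le> norm p * h"
        using norm_cauchy_schwarz[of p v] mult_left_mono[OF vw(1), of "norm p"] by simp
      then have "p \<bullet> v - H x p \<le> M - norm p" using M[OF xy(1), of p] by (simp add: algebra_simps)
      also have "\<dots> \<le> - M0" using False R by simp
      also have "\<dots> \<le> L y w" using fenchel[OF xy(2), of 0 w] M0[OF xy(2)] by simp
      finally show ?thesis using \<Lambda>0 by linarith
    qed
  qed
  show thesis
  proof (rule that[of \<Lambda>])
    show "\<Lambda> \<ge> 0" by (simp add: \<Lambda>_def)
    fix x y v w :: 'a assume "x \<in> cball 0 R0" "y \<in> cball 0 R0" "norm v \<le> h" "norm w \<le> h"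
    with half[of x y v w] half[of y x w v]
    show "\<bar>L x v - L y w\<bar> \<le> \<Lambda> * (norm (x - y) + norm (v - w))"
      by (simp add: norm_minus_commute abs_le_iff)
  qed
qed

lemma continuous_L: "continuous_on (cball 0 R0 \<times> cball 0 h) (\<lambda>(x, v). L x v)"
proof -
  obtain \<Lambda> where \<Lambda>: "\<Lambda> \<ge> 0" "\<And>x y v w. x \<in> cball 0 R0 \<Longrightarrow> y \<in> cball 0 R0 \<Longrightarrow> norm v \<le> h \<Longrightarrow> norm w \<le> h \<Longrightarrow>
    \<bar>L x v - L y w\<bar> \<le> \<Lambda> * (norm (x - y) + norm (v - w))"
    using L_lipschitz by blast
  have "(2 * \<Lambda>)-lipschitz_on (cball 0 R0 \<times> cball 0 h) (\<lambda>(x, v). L x v)"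
  proof (rule lipschitz_onI)
    fix z z' assume z: "z \<in> cball (0::'a) R0 \<times> cball (0::'a) h" "z' \<in> cball (0::'a) R0 \<times> cball (0::'a) h"
    obtain x v y w where eq: "z = (x, v)" "z' = (y, w)" by (metis prod.exhaust)
    have "norm (x - y) \<le> dist z z'" "norm (v - w) \<le> dist z z'"
      using dist_fst_le[of z z'] dist_snd_le[of z z'] by (auto simp: eq dist_norm)
    then have "\<Lambda> * (norm (x - y) + norm (v - w)) \<le> \<Lambda> * (2 * dist z z')"
      using \<Lambda>(1) by (intro mult_left_mono) auto
    then show "dist (case z of (x, v) \<Rightarrow> L x v) (case z' of (x, v) \<Rightarrow> L x v) \<le> 2 * \<Lambda> * dist z z'"
      using \<Lambda>(2)[of x y v w] z by (simp add: eq dist_real_def)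
  qed (use \<Lambda> in auto)
  then show ?thesis by (rule lipschitz_on_continuous_on)
qed

lemma continuous_L_closure: "continuous_on (closure \<Omega> \<times> cball 0 h) (\<lambda>(x, v). L x v)"
  using continuous_L by (rule continuous_on_subset) (auto dest: closure_\<Omega>_cball)

lemma L_bounded:
  obtains M where "M > 0" "\<And>x v. x \<in> cball 0 R0 \<Longrightarrow> norm v \<le> h \<Longrightarrow> \<bar>L x v\<bar> \<le> M"
proof -
  have "bounded ((\<lambda>(x, v). L x v) ` (cball 0 R0 \<times> cball 0 h))"
    by (intro compact_imp_bounded compact_continuous_image continuous_L compact_Times) auto
  then obtain M where "M > 0" "\<And>z. z \<in> cball 0 R0 \<times> cball 0 h \<Longrightarrow> \<bar>case z of (x, v) \<Rightarrow> L x v\<bar> \<le> M"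
    by (auto simp: bounded_pos)
  then show thesis using that[of M] by fastforce
qed

section \<open>Levels of the Hamiltonian\<close>

lemma subsolution_imp_segment_subsolution:
  assumes "viscosity_subsolution \<Omega> H c u"
  shows "segment_subsolution \<Omega> h (\<lambda>x v. L x v + c) u"
proof (rule viscosity_imp_segment_subsolution[OF open_\<Omega> h_pos assms])
  fix x p v :: 'a assume "x \<in> \<Omega>" "H x p \<le> c" "norm v \<le> h"
  then show "p \<bullet> v \<le> L x v + c" using fenchel[OF \<Omega>_cball, of x p v] by simp
next
  have "continuous_on (\<Omega> \<times> cball 0 h) (\<lambda>z. (case z of (x, v) \<Rightarrow> L x v) + c)"
    by (intro continuous_intros continuous_on_subset[OF continuous_L]) (auto dest: \<Omega>_cball)
  then show "continuous_on (\<Omega> \<times> cball 0 h) (\<lambda>(x, v). L x v + c)"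
    by (simp add: case_prod_unfold)
qed

lemma subsolution_level_bound:
  assumes "viscosity_subsolution \<Omega> H c u" "x \<in> \<Omega>"
  shows "- c \<le> L x 0"
  using segment_subsolutionD[OF subsolution_imp_segment_subsolution[OF assms(1)], of 0 1 x "L x 0 + c"]
    assms(2) h_pos by simp

text \<open>Constants are subsolutions at any level bounding \<open>H x 0\<close>. With
  \<open>levels_bdd_below\<close> this makes the real infimum that defines c(0) a genuine
  one.\<close>

lemma levels_nonempty: "\<exists>c u. viscosity_subsolution \<Omega> H c u"
proof -
  obtain M0 where M0: "\<And>x. x \<in> cball 0 R0 \<Longrightarrow> \<bar>H x 0\<bar> \<le> M0" using H_zero_bounded by blast
  have "viscosity_subsolution \<Omega> H M0 (\<lambda>_. 0)"
  proof (rule difference_bound_imp_viscosity[OF open_\<Omega>, of h _ "\<lambda>_ _. 0"])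
    fix x p :: 'a assume x: "x \<in> \<Omega>" and p: "\<And>v. norm v \<le> h \<Longrightarrow> p \<bullet> v \<le> 0"
    have "p = 0"
    proof (rule ccontr)
      assume "p \<noteq> 0"
      then have "p \<bullet> ((h / norm p) *\<^sub>R p) = h * norm p"
        by (simp add: dot_square_norm power2_eq_square)
      moreover have "p \<bullet> ((h / norm p) *\<^sub>R p) \<le> 0" using h_pos by (intro p) auto
      ultimately show False using h_pos \<open>p \<noteq> 0\<close> by (simp add: mult_le_0_iff)
    qed
    then show "H x p \<le> M0" using M0[OF \<Omega>_cball[OF x]] by simp
  next
    fix \<epsilon> :: real assume \<epsilon>: "\<epsilon> > 0"
    show "\<forall>\<^sub>F t in at_right 0. 0 - 0 \<le> t * (0 + \<epsilon>)"
      using eventually_at_right_less[of 0] by eventually_elim (use \<epsilon> in auto)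
  qed (use h_pos in auto)
  then show ?thesis by blast
qed

lemma levels_bdd_below: "bdd_below {c. \<exists>u. viscosity_subsolution \<Omega> H c u}"
  using subsolution_level_bound[OF _ zero_in_\<Omega>]
  by (intro bdd_belowI[of _ "- L 0 0"]) (auto simp: minus_le_iff)

lemma c0_le: "viscosity_subsolution \<Omega> H c u \<Longrightarrow> c0 \<le> c"
  unfolding additive_eigenvalue_def using levels_bdd_below by (intro cInf_lower) auto

lemma subsolution_above_c0:
  assumes "c0 < c" obtains c' u where "c0 \<le> c'" "c' < c" "viscosity_subsolution \<Omega> H c' u"
proof -
  have "{c. \<exists>u. viscosity_subsolution \<Omega> H c u} \<noteq> {}" using levels_nonempty by blast
  then obtain c' where "c' \<in> {c. \<exists>u. viscosity_subsolution \<Omega> H c u}" "c' < c"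
    using assms unfolding additive_eigenvalue_def by (rule cInf_lessD[THEN bexE])
  then show thesis using that c0_le by blast
qed

lemma L_zero_ge: "x \<in> \<Omega> \<Longrightarrow> - c0 \<le> L x 0"
proof (rule field_le_epsilon)
  fix \<epsilon> :: real assume x: "x \<in> \<Omega>" and "\<epsilon> > 0"
  then have "c0 < c0 + \<epsilon>" by simp
  then obtain c u where "c < c0 + \<epsilon>" "viscosity_subsolution \<Omega> H c u"
    by (rule subsolution_above_c0)
  then show "- c0 \<le> L x 0 + \<epsilon>" using subsolution_level_bound[of c u x] x by simp
qed

text \<open>Otherwise coercivity would keep \<open>H x\<close> above c(0) by a positive gap, and
  L(x, 0), the supremum of \<open>- H x\<close>, would fall below -c(0). The point found here starts
  the convexity argument for the truncated Hamiltonian.\<close>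

lemma level_c0_nonempty:
  assumes x: "x \<in> \<Omega>" shows "\<exists>p. H x p \<le> c0"
proof (rule ccontr)
  assume "\<nexists>p. H x p \<le> c0"
  then have gt: "H x p > c0" for p by (force simp: not_le)
  have "\<forall>\<^sub>F p in at_infinity. c0 + 1 \<le> (INF x\<in>cball 0 R0. H x p)"
    using H2 unfolding assm_H2_def filterlim_at_top by blast
  then obtain R where R: "\<And>p. norm p \<ge> R \<Longrightarrow> c0 + 1 \<le> (INF x\<in>cball 0 R0. H x p)"
    by (auto simp: eventually_at_infinity)
  have big: "c0 + 1 \<le> H x p" if "norm p \<ge> R" for p
  proof -
    have "bdd_below ((\<lambda>x. H x p) ` cball 0 R0)"
      by (intro bounded_imp_bdd_below compact_imp_bounded compact_continuous_image continuous_H_x) auto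
    then have "(INF x\<in>cball 0 R0. H x p) \<le> H x p"
      by (intro cINF_lower \<Omega>_cball x)
    then show ?thesis using R[OF that] by linarith
  qed
  have "\<exists>p0\<in>cball 0 \<bar>R\<bar>. \<forall>p\<in>cball 0 \<bar>R\<bar>. H x p0 \<le> H x p"
    by (rule continuous_attains_inf) (auto intro!: continuous_H_p \<Omega>_cball x)
  then obtain p0 where "\<forall>p\<in>cball 0 \<bar>R\<bar>. H x p0 \<le> H x p" by blast
  then have p0: "H x p0 \<le> H x p" if "norm p \<le> \<bar>R\<bar>" for p using that by simp
  have "L x 0 \<le> - min (H x p0) (c0 + 1)"
  proof (rule L_leI)
    fix p show "p \<bullet> 0 - H x p \<le> - min (H x p0) (c0 + 1)"
      using p0[of p] big[of p] abs_ge_self[of R]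
      by (cases "norm p \<le> \<bar>R\<bar>") (auto simp: min_le_iff_disj)
  qed
  then show False using L_zero_ge[OF x] gt[of p0] by auto
qed

text \<open>By convexity of the truncated Hamiltonian its sublevel sets up to \<open>c(0)\<close> lie in the ball on
  which it agrees with \<open>H\<close>.\<close>

lemma truncated_level_imp_level:
  assumes x: "x \<in> \<Omega>" and c: "c \<le> c0" and p: "\<And>v. norm v \<le> h \<Longrightarrow> p \<bullet> v \<le> L x v + c"
  shows "H x p \<le> c"
proof -
  obtain C where C: "\<And>p. H x p \<le> c0 \<Longrightarrow> norm p < C"
      "\<And>p. norm p \<le> C \<Longrightarrow> H x p = hamiltonian_of h L x p"
    using normalizing \<Omega>_closure[OF x] unfolding normalizing_bound_def by blast
  obtain p0 where p0: "H x p0 \<le> c0" using level_c0_nonempty[OF x] by blast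
  have p0C: "norm p0 < C" using C(1)[OF p0] .
  have "norm p \<le> C"
  proof (rule ccontr)
    assume "\<not> norm p \<le> C"
    \<comment> \<open>The segment from \<open>p0\<close> to \<open>p\<close> would meet the sphere
      of radius \<open>C\<close>. There \<open>H\<close> still equals its truncation and is
      therefore at most c(0), while points of that sublevel have norm strictly less than
      \<open>C\<close>.\<close>
    define q where "q \<theta> = (1 - \<theta>) *\<^sub>R p0 + \<theta> *\<^sub>R p" for \<theta> :: real
    have "\<exists>\<theta>\<ge>0. \<theta> \<le> 1 \<and> norm (q \<theta>) = C"
      by (rule IVT') (use \<open>\<not> norm p \<le> C\<close> p0C in \<open>auto simp: q_def intro!: continuous_intros\<close>)
    then obtain \<theta> where \<theta>: "0 \<le> \<theta>" "\<theta> \<le> 1" "norm (q \<theta>) = C" by blast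
    have "hamiltonian_of h L x (q \<theta>) \<le> c0"
    proof (rule hamiltonian_of_leI)
      fix v :: 'a assume v: "norm v \<le> h"
      have "q \<theta> \<bullet> v - L x v = (1 - \<theta>) * (p0 \<bullet> v - L x v) + \<theta> * (p \<bullet> v - L x v)"
        by (simp add: q_def inner_add_left algebra_simps)
      also have "\<dots> \<le> (1 - \<theta>) * c0 + \<theta> * c0"
        using \<theta> fenchel[OF \<Omega>_cball[OF x], of p0 v] p0 p[OF v] c
        by (intro add_mono mult_left_mono) auto
      finally show "q \<theta> \<bullet> v - L x v \<le> c0" by (simp add: algebra_simps)
    qed (use h_pos in simp)
    then have "H x (q \<theta>) \<le> c0" using C(2) \<theta> by simp
    then show False using C(1) \<theta>(3) by force
  qed
  then have "H x p = hamiltonian_of h L x p" by (rule C(2))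
  also have "\<dots> \<le> c" by (rule hamiltonian_of_leI) (use h_pos p in \<open>auto simp: diff_le_eq add.commute\<close>)
  finally show ?thesis .
qed

end

section \<open>The discounted value function\<close>

lemma one_minus_exp_quotient_tendsto:
  fixes a :: real
  shows "((\<lambda>s. (1 - exp (- (a * s))) / s) \<longlongrightarrow> a) (at 0)"
proof -
  have "((\<lambda>s. 1 - exp (- (a * s))) has_real_derivative a) (at 0)"
    by (auto intro!: derivative_eq_intros)
  then show ?thesis by (simp add: has_field_derivative_iff)
qed

text \<open>McShane's formula, the lower envelope of the cones with slope \<Lambda>. It gives the
  value functions continuous representatives on the closure without increasing the Lipschitz
  constant.\<close>

lemma lipschitz_extension_real:
  fixes f :: "'a::metric_space \<Rightarrow> real"
  assumes \<Lambda>: "0 \<le> \<Lambda>" and f: "\<And>x y. x \<in> S \<Longrightarrow> y \<in> S \<Longrightarrow> f x - f y \<le> \<Lambda> * dist x y" and S: "S \<noteq> {}"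
  obtains g where "\<And>x. x \<in> S \<Longrightarrow> g x = f x" "\<And>x y. \<bar>g x - g y\<bar> \<le> \<Lambda> * dist x y"
proof -
  define g where "g x = (INF y\<in>S. f y + \<Lambda> * dist x y)" for x
  obtain y0 where y0: "y0 \<in> S" using S by blast
  have bdd: "bdd_below ((\<lambda>y. f y + \<Lambda> * dist x y) ` S)" for x
  proof (rule bdd_belowI2)
    fix y assume y: "y \<in> S"
    have "f y0 - f y \<le> \<Lambda> * dist y0 y" by (rule f[OF y0 y])
    also have "\<dots> \<le> \<Lambda> * (dist x y + dist x y0)"
      using \<Lambda> dist_triangle[of y0 y x] by (intro mult_left_mono) (auto simp: dist_commute)
    finally show "f y0 - \<Lambda> * dist x y0 \<le> f y + \<Lambda> * dist x y" by (simp add: algebra_simps)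
  qed
  have half: "g x \<le> g y + \<Lambda> * dist x y" for x y
  proof -
    have "g x - \<Lambda> * dist x y \<le> g y"
      unfolding g_def[of y]
    proof (rule cINF_greatest[OF S])
      fix z assume z: "z \<in> S"
      have "g x \<le> f z + \<Lambda> * dist x z" unfolding g_def by (rule cINF_lower[OF bdd z])
      also have "\<dots> \<le> f z + \<Lambda> * (dist x y + dist y z)"
        using \<Lambda> dist_triangle[of x z y] by (intro add_left_mono mult_left_mono) auto
      finally show "g x - \<Lambda> * dist x y \<le> f z + \<Lambda> * dist y z" by (simp add: algebra_simps)
    qed
    then show ?thesis by linarith
  qed
  show thesis
  proof (rule that[of g])
    fix x assume x: "x \<in> S"
    have "g x \<le> f x" unfolding g_def using cINF_lower[OF bdd x, of x] by simp
    moreover have "f x \<le> g x" unfolding g_def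
      by (rule cINF_greatest[OF S]) (use f[OF x] in \<open>auto simp: algebra_simps\<close>)
    ultimately show "g x = f x" by simp
  next
    fix x y show "\<bar>g x - g y\<bar> \<le> \<Lambda> * dist x y"
      using half[of x y] half[of y x] by (simp add: dist_commute abs_le_iff)
  qed
qed

context star_shaped_hamiltonian
begin

section \<open>Geometry of the star-shaped domain\<close>

lemma star: "x \<in> \<Omega> \<Longrightarrow> 0 \<le> t \<Longrightarrow> t \<le> 1 \<Longrightarrow> t *\<^sub>R x \<in> \<Omega>"
proof -
  assume "x \<in> \<Omega>" "0 \<le> t" "t \<le> 1"
  then have "t *\<^sub>R x \<in> closed_segment 0 x" by (auto simp: in_segment)
  then show ?thesis using A1 \<open>x \<in> \<Omega>\<close> unfolding assm_A1_def by blast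
qed

text \<open>The segment from 0 to \<open>t *\<^sub>R q\<close> crosses the frontier at some
  \<open>b\<close>, and \<open>q\<close> is a dilation of \<open>b\<close> by a factor of at least
  \<open>1 / t\<close>; (A1) then bounds the distance of \<open>q\<close> from the closure.\<close>

lemma gauge_bound:
  obtains \<kappa> where "\<kappa> > 0" "\<And>q t. 0 < t \<Longrightarrow> t < 1 \<Longrightarrow> t *\<^sub>R q \<notin> \<Omega> \<Longrightarrow> \<kappa> * (1 / t - 1) \<le> infdist q (closure \<Omega>)"
proof -
  obtain \<kappa> where \<kappa>: "\<kappa> > 0"
      "\<And>s x. s > 0 \<Longrightarrow> x \<in> (\<lambda>y. (1 + s) *\<^sub>R y) ` frontier \<Omega> \<Longrightarrow> \<kappa> * s \<le> infdist x (closure \<Omega>)"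
    using A1 unfolding assm_A1_def by blast
  show thesis
  proof (rule that[OF \<kappa>(1)])
    fix q :: 'a and t :: real assume t: "0 < t" "t < 1" and q: "t *\<^sub>R q \<notin> \<Omega>"
    have "closed_segment 0 (t *\<^sub>R q) \<inter> frontier \<Omega> \<noteq> {}"
    proof (rule connected_Int_frontier)
      show "closed_segment 0 (t *\<^sub>R q) \<inter> \<Omega> \<noteq> {}" using zero_in_\<Omega> by (metis IntI empty_iff ends_in_segment(1))
      show "closed_segment 0 (t *\<^sub>R q) - \<Omega> \<noteq> {}" using q by (metis DiffI empty_iff ends_in_segment(2))
    qed simp
    then obtain b where b: "b \<in> frontier \<Omega>" "b \<in> closed_segment 0 (t *\<^sub>R q)" by blast
    then obtain r where r: "0 \<le> r" "r \<le> 1" "b = r *\<^sub>R t *\<^sub>R q" by (auto simp: in_segment)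
    have "b \<notin> \<Omega>" using b(1) open_\<Omega> by (simp add: frontier_def interior_open)
    then have "r \<noteq> 0" using r zero_in_\<Omega> by auto
    then have r0: "r > 0" using r by simp
    define s where "s = 1 / (r * t) - 1"
    have rt: "0 < r * t" "r * t \<le> t" using r0 r t by (auto simp: mult_left_le_one_le)
    have rt1: "r * t < 1" using rt(2) t(2) by (rule order_le_less_trans)
    have s: "s > 0" using rt(1) rt1 by (simp add: s_def less_divide_eq)
    have s': "1 / t - 1 \<le> s"
      unfolding s_def using rt by (intro diff_right_mono divide_left_mono) (use t in auto)
    have "q = (1 + s) *\<^sub>R b" using r0 t by (simp add: s_def r(3))
    then have "\<kappa> * s \<le> infdist q (closure \<Omega>)" using \<kappa>(2)[OF s] b(1) by blast
    moreover have "\<kappa> * (1 / t - 1) \<le> \<kappa> * s" using s' \<kappa>(1) by simp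
    ultimately show "\<kappa> * (1 / t - 1) \<le> infdist q (closure \<Omega>)" by linarith
  qed
qed

lemma star_closure:
  assumes "x \<in> closure \<Omega>" "0 < t" "t < 1" shows "t *\<^sub>R x \<in> \<Omega>"
proof (rule ccontr)
  assume no: "t *\<^sub>R x \<notin> \<Omega>"
  obtain \<kappa> where \<kappa>: "\<kappa> > 0"
      "\<And>q t. 0 < t \<Longrightarrow> t < 1 \<Longrightarrow> t *\<^sub>R q \<notin> \<Omega> \<Longrightarrow> \<kappa> * (1 / t - 1) \<le> infdist q (closure \<Omega>)"
    using gauge_bound by blast
  have "\<kappa> * (1 / t - 1) \<le> infdist x (closure \<Omega>)" using \<kappa>(2)[OF assms(2,3) no] .
  also have "\<dots> = 0" using assms(1) by simp
  finally have "1 / t - 1 \<le> 0" using \<kappa>(1) by (simp add: mult_le_0_iff)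
  then show False using assms(2,3) by (simp add: field_simps)
qed

text \<open>Two points of \<open>\<Omega>\<close> are joined inside \<open>\<Omega>\<close> by moving both towards the origin by an amount
  proportional to their distance.\<close>

lemma quasiconvex:
  obtains Q where "Q > 0"
    "\<And>u C x y. 0 \<le> C \<Longrightarrow> (\<And>a b. closed_segment a b \<subseteq> \<Omega> \<Longrightarrow> u a - u b \<le> C * norm (a - b)) \<Longrightarrow>
      x \<in> \<Omega> \<Longrightarrow> y \<in> \<Omega> \<Longrightarrow> u x - u y \<le> C * Q * norm (x - y)"
proof -
  obtain \<kappa> where \<kappa>: "\<kappa> > 0"
      "\<And>q t. 0 < t \<Longrightarrow> t < 1 \<Longrightarrow> t *\<^sub>R q \<notin> \<Omega> \<Longrightarrow> \<kappa> * (1 / t - 1) \<le> infdist q (closure \<Omega>)"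
    using gauge_bound by blast
  \<comment> \<open>Two radial pieces, each of length at most
    \<open>(2 * d / \<kappa>) * R0\<close>, and a middle piece of length at most
    \<open>d\<close>.\<close>
  define Q where "Q = 4 * R0 / \<kappa> + 1"
  show thesis
  proof (rule that[of Q])
    show "Q > 0" using R0_pos \<kappa>(1) by (simp add: Q_def add_pos_pos)
    fix u :: "'a \<Rightarrow> real" and C x y assume C: "0 \<le> C" and x: "x \<in> \<Omega>" and y: "y \<in> \<Omega>"
      and seg: "\<And>a b. closed_segment a b \<subseteq> \<Omega> \<Longrightarrow> u a - u b \<le> C * norm (a - b)"
    show "u x - u y \<le> C * Q * norm (x - y)"
    proof (cases "x = y")
      case False
      define d where "d = norm (x - y)"
      have d: "d > 0" using False by (simp add: d_def)
      \<comment> \<open>Leaving \<Omega> after contraction by \<open>1 - \<tau>\<close> would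
        require distance at least \<open>\<kappa> * \<tau> = 2 * d\<close> from the closure, but
        points between \<open>x\<close> and \<open>y\<close> are within \<open>d\<close> of
        \<open>x\<close>. At the cap 1 the middle piece collapses to the origin.\<close>
      define \<tau> where "\<tau> = min 1 (2 * d / \<kappa>)"
      have \<tau>: "0 < \<tau>" "\<tau> \<le> 1" "\<tau> \<le> 2 * d / \<kappa>" using d \<kappa>(1) by (auto simp: \<tau>_def)
      have radial: "closed_segment w ((1 - \<tau>) *\<^sub>R w) \<subseteq> \<Omega>" if w: "w \<in> \<Omega>" for w
      proof
        fix q assume "q \<in> closed_segment w ((1 - \<tau>) *\<^sub>R w)"
        then obtain \<theta> where \<theta>: "0 \<le> \<theta>" "\<theta> \<le> 1" "q = (1 - \<theta>) *\<^sub>R w + \<theta> *\<^sub>R (1 - \<tau>) *\<^sub>R w"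
          by (auto simp: in_segment)
        have "q = (1 - \<theta> * \<tau>) *\<^sub>R w" by (simp add: \<theta>(3) algebra_simps)
        moreover have "\<theta> * \<tau> \<le> 1" using \<theta> \<tau> by (intro mult_le_one) auto
        ultimately show "q \<in> \<Omega>" using star[OF w, of "1 - \<theta> * \<tau>"] \<theta> \<tau> by simp
      qed
      have across: "closed_segment ((1 - \<tau>) *\<^sub>R x) ((1 - \<tau>) *\<^sub>R y) \<subseteq> \<Omega>"
      proof
        fix q' assume "q' \<in> closed_segment ((1 - \<tau>) *\<^sub>R x) ((1 - \<tau>) *\<^sub>R y)"
        then obtain \<theta> where \<theta>: "0 \<le> \<theta>" "\<theta> \<le> 1"
            "q' = (1 - \<theta>) *\<^sub>R (1 - \<tau>) *\<^sub>R x + \<theta> *\<^sub>R (1 - \<tau>) *\<^sub>R y"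
          by (auto simp: in_segment)
        define q where "q = (1 - \<theta>) *\<^sub>R x + \<theta> *\<^sub>R y"
        have q: "q \<in> closed_segment x y" "q' = (1 - \<tau>) *\<^sub>R q"
          using \<theta> by (auto simp: q_def in_segment scaleR_add_right mult.commute)
        show "q' \<in> \<Omega>"
        proof (cases "\<tau> = 1")
          case False
          then have \<tau>eq: "\<tau> = 2 * d / \<kappa>" "\<tau> < 1" using \<tau>(2) by (auto simp: \<tau>_def min_def split: if_splits)
          show ?thesis
          proof (rule ccontr)
            assume "q' \<notin> \<Omega>"
            then have "\<kappa> * (1 / (1 - \<tau>) - 1) \<le> infdist q (closure \<Omega>)"
              using \<kappa>(2)[of "1 - \<tau>" q] q \<tau>eq \<tau>(1) by simp
            also have "\<dots> \<le> dist q x" by (rule infdist_le[OF \<Omega>_closure[OF x]])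
            also have "\<dots> \<le> d" using segment_bound(1)[OF q(1)] by (simp add: dist_norm d_def norm_minus_commute)
            finally have "\<kappa> * (1 / (1 - \<tau>) - 1) \<le> d" .
            moreover have "\<tau> \<le> 1 / (1 - \<tau>) - 1"
            proof -
              have "(1 + \<tau>) * (1 - \<tau>) \<le> 1" by (simp add: algebra_simps)
              then have "1 + \<tau> \<le> 1 / (1 - \<tau>)" using \<tau>eq by (simp add: le_divide_eq)
              then show ?thesis by simp
            qed
            then have "\<kappa> * \<tau> \<le> \<kappa> * (1 / (1 - \<tau>) - 1)" using \<kappa>(1) by simp
            ultimately show False using \<tau>eq d \<kappa>(1) by simp
          qed
        qed (use q zero_in_\<Omega> in simp)
      qed
      have nrm: "norm w \<le> R0" if "w \<in> \<Omega>" for w using \<Omega>_cball[OF that] by simp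
      have rn: "norm (w - (1 - \<tau>) *\<^sub>R w) = \<tau> * norm w" for w :: 'a
        using \<tau>(1) by (simp add: algebra_simps)
      have 1: "u x - u ((1 - \<tau>) *\<^sub>R x) \<le> C * (\<tau> * norm x)"
        using seg[OF radial[OF x]] by (simp only: rn)
      have 2: "u ((1 - \<tau>) *\<^sub>R y) - u y \<le> C * (\<tau> * norm y)"
        using seg[of "(1 - \<tau>) *\<^sub>R y" y] radial[OF y] rn[of y] closed_segment_commute[of y]
        by (simp add: norm_minus_commute)
      have 3: "u ((1 - \<tau>) *\<^sub>R x) - u ((1 - \<tau>) *\<^sub>R y) \<le> C * d"
      proof -
        have "norm ((1 - \<tau>) *\<^sub>R x - (1 - \<tau>) *\<^sub>R y) = (1 - \<tau>) * d"
          using \<tau> by (simp add: d_def scaleR_diff_right[symmetric])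
        also have "\<dots> \<le> d" using \<tau> d by (simp add: mult_left_le_one_le)
        finally show ?thesis using order_trans[OF seg[OF across] mult_left_mono[OF _ C]] by blast
      qed
      have "\<tau> * norm w \<le> (2 * d / \<kappa>) * R0" if "w \<in> \<Omega>" for w
        by (rule mult_mono) (use \<tau> nrm[OF that] d \<kappa>(1) in auto)
      note this[OF x] this[OF y]
      then have "\<tau> * norm x + d + \<tau> * norm y \<le> Q * d"
      proof -
        have "Q * d = (2 * d / \<kappa>) * R0 + d + (2 * d / \<kappa>) * R0"
          using \<kappa>(1) by (simp add: Q_def field_simps)
        then show ?thesis using \<open>\<tau> * norm x \<le> _\<close> \<open>\<tau> * norm y \<le> _\<close> by linarith
      qed
      then have "C * (\<tau> * norm x + d + \<tau> * norm y) \<le> C * (Q * d)"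
        using C by (rule mult_left_mono)
      then show ?thesis using 1 2 3 by (simp add: d_def algebra_simps)
    qed simp
  qed
qed

text \<open>The segment is traversed at full speed \<open>h\<close>, which takes time
  \<open>norm (a - b) / h\<close>.\<close>

lemma segment_bound_imp_lipschitz_segments:
  assumes step: "\<And>x v t. norm v \<le> h \<Longrightarrow> 0 \<le> t \<Longrightarrow> closed_segment (x - t *\<^sub>R v) x \<subseteq> \<Omega> \<Longrightarrow>
      u x - u (x - t *\<^sub>R v) \<le> t * m"
    and seg: "closed_segment a b \<subseteq> \<Omega>"
  shows "u a - u b \<le> m / h * norm (a - b)"
proof (cases "a = b")
  case False
  define t where "t = norm (a - b) / h"
  define v where "v = (1 / t) *\<^sub>R (a - b)"
  have t: "t > 0" using False h_pos by (simp add: t_def)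
  have v: "norm v = h" using t False h_pos by (simp add: v_def t_def)
  have b: "a - t *\<^sub>R v = b" using t by (simp add: v_def)
  show ?thesis using step[of v t a] t v b seg closed_segment_commute[of a b] by (simp add: t_def mult.commute)
qed simp

text \<open>Because occupation measures have mass 1, this is \<rho> times the discounted value
  function; the unnormalized one is \<open>value_fn \<rho> x / \<rho>\<close>.\<close>

definition "value_fn \<rho> x = (INF ps\<in>{ps. admissible \<Omega> h x ps}. discounted \<Omega> h \<rho> x ps L)"

lemma continuous_L_\<Omega>: "continuous_on (\<Omega> \<times> cball 0 h) (\<lambda>(x, v). L x v)"
  using continuous_L by (rule continuous_on_subset) (auto dest: \<Omega>_cball)

lemma L_bounded_\<Omega>:
  obtains M where "M > 0" "\<forall>x\<in>\<Omega>. \<forall>v\<in>cball 0 h. \<bar>L x v\<bar> \<le> M"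
proof -
  obtain M where "M > 0" "\<And>x v. x \<in> cball 0 R0 \<Longrightarrow> norm v \<le> h \<Longrightarrow> \<bar>L x v\<bar> \<le> M"
    using L_bounded by blast
  then show thesis using that[of M] \<Omega>_cball by auto
qed

lemma admissible_Nil: "x \<in> \<Omega> \<Longrightarrow> {ps. admissible \<Omega> h x ps} \<noteq> {}"
  by (auto intro!: exI[of _ "[]"])

lemma abs_discounted_L_le:
  assumes "\<rho> > 0" "admissible \<Omega> h x ps" "\<forall>x\<in>\<Omega>. \<forall>v\<in>cball 0 h. \<bar>L x v\<bar> \<le> M"
  shows "\<bar>discounted \<Omega> h \<rho> x ps L\<bar> \<le> M"
  using abs_discounted_le[OF open_\<Omega> less_imp_le[OF h_pos] assms(1,2) continuous_L_\<Omega> assms(3)] .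

lemma bdd_below_discounted_L:
  assumes "\<rho> > 0" shows "bdd_below ((\<lambda>ps. discounted \<Omega> h \<rho> x ps L) ` {ps. admissible \<Omega> h x ps})"
proof -
  obtain M where "M > 0" and M: "\<forall>x\<in>\<Omega>. \<forall>v\<in>cball 0 h. \<bar>L x v\<bar> \<le> M" by (rule L_bounded_\<Omega>)
  show ?thesis
  proof (rule bdd_belowI2)
    fix ps assume "ps \<in> {ps. admissible \<Omega> h x ps}"
    then have "\<bar>discounted \<Omega> h \<rho> x ps L\<bar> \<le> M" by (intro abs_discounted_L_le[OF assms _ M]) simp
    then show "- M \<le> discounted \<Omega> h \<rho> x ps L" by linarith
  qed
qed

lemma value_le: "\<rho> > 0 \<Longrightarrow> admissible \<Omega> h x ps \<Longrightarrow> value_fn \<rho> x \<le> discounted \<Omega> h \<rho> x ps L"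
  unfolding value_fn_def by (rule cINF_lower[OF bdd_below_discounted_L]) auto

lemma value_ge:
  "x \<in> \<Omega> \<Longrightarrow> (\<And>ps. admissible \<Omega> h x ps \<Longrightarrow> a \<le> discounted \<Omega> h \<rho> x ps L) \<Longrightarrow> a \<le> value_fn \<rho> x"
  unfolding value_fn_def by (rule cINF_greatest[OF admissible_Nil]) auto

lemma abs_value_le:
  assumes "\<rho> > 0" "x \<in> \<Omega>" "\<forall>x\<in>\<Omega>. \<forall>v\<in>cball 0 h. \<bar>L x v\<bar> \<le> M"
  shows "\<bar>value_fn \<rho> x\<bar> \<le> M"
proof -
  have "value_fn \<rho> x \<le> discounted \<Omega> h \<rho> x [] L" using assms by (intro value_le) auto
  moreover have "\<bar>discounted \<Omega> h \<rho> x [] L\<bar> \<le> M" using assms by (intro abs_discounted_L_le) auto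
  moreover have "- M \<le> value_fn \<rho> x"
  proof (rule value_ge[OF assms(2)])
    fix ps assume "admissible \<Omega> h x ps"
    then have "\<bar>discounted \<Omega> h \<rho> x ps L\<bar> \<le> M" by (rule abs_discounted_L_le[OF assms(1) _ assms(3)])
    then show "- M \<le> discounted \<Omega> h \<rho> x ps L" by linarith
  qed
  ultimately show ?thesis by linarith
qed

lemma value_step:
  assumes \<rho>: "\<rho> > 0" and v: "norm v \<le> h" and t: "0 \<le> t" and seg: "closed_segment (x - t *\<^sub>R v) x \<subseteq> \<Omega>"
    and m: "\<And>y. y \<in> closed_segment (x - t *\<^sub>R v) x \<Longrightarrow> L y v \<le> m"
  shows "value_fn \<rho> x \<le> (1 - exp (- \<rho> * t)) * m + exp (- \<rho> * t) * value_fn \<rho> (x - t *\<^sub>R v)"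
proof -
  obtain M where "M > 0" and M: "\<forall>x\<in>\<Omega>. \<forall>v\<in>cball 0 h. \<bar>L x v\<bar> \<le> M" by (rule L_bounded_\<Omega>)
  have "x - t *\<^sub>R v \<in> \<Omega>" using seg by auto
  then have "(value_fn \<rho> x - (1 - exp (- \<rho> * t)) * m) / exp (- \<rho> * t) \<le> value_fn \<rho> (x - t *\<^sub>R v)"
  proof (rule value_ge)
    fix ps assume ps: "admissible \<Omega> h (x - t *\<^sub>R v) ps"
    then have adm: "admissible \<Omega> h x ((t, v) # ps)" using v t seg by simp
    have "value_fn \<rho> x \<le> discounted \<Omega> h \<rho> x ((t, v) # ps) L" by (rule value_le[OF \<rho> adm])
    also have "\<dots> \<le> (1 - exp (- \<rho> * t)) * m + exp (- \<rho> * t) * discounted \<Omega> h \<rho> (x - t *\<^sub>R v) ps L"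
      by (rule discounted_le_segment[OF open_\<Omega> less_imp_le[OF h_pos] \<rho> adm continuous_L_\<Omega> M m])
    finally show "(value_fn \<rho> x - (1 - exp (- \<rho> * t)) * m) / exp (- \<rho> * t)
        \<le> discounted \<Omega> h \<rho> (x - t *\<^sub>R v) ps L"
      by (simp add: divide_le_eq algebra_simps)
  qed
  then show ?thesis by (simp add: divide_le_eq algebra_simps)
qed

text \<open>The estimate \<open>1 - exp (- \<rho> * t) \<le> \<rho> * t\<close> cancels the division
  by \<rho>, so the constant does not depend on the rate.\<close>

lemma value_lipschitz:
  obtains \<Lambda> where "\<Lambda> \<ge> 0" "\<And>\<rho> x y. \<rho> > 0 \<Longrightarrow> x \<in> \<Omega> \<Longrightarrow> y \<in> \<Omega> \<Longrightarrow>
    value_fn \<rho> x / \<rho> - value_fn \<rho> y / \<rho> \<le> \<Lambda> * norm (x - y)"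
proof -
  obtain M where M0: "M > 0" and M: "\<forall>x\<in>\<Omega>. \<forall>v\<in>cball 0 h. \<bar>L x v\<bar> \<le> M" by (rule L_bounded_\<Omega>)
  obtain Q where Q: "Q > 0"
    "\<And>u C x y. 0 \<le> C \<Longrightarrow> (\<And>a b. closed_segment a b \<subseteq> \<Omega> \<Longrightarrow> u a - u b \<le> C * norm (a - b)) \<Longrightarrow>
      x \<in> \<Omega> \<Longrightarrow> y \<in> \<Omega> \<Longrightarrow> u x - u y \<le> C * Q * norm (x - y)"
    using quasiconvex by blast
  have C: "0 \<le> 2 * M / h" using M0 h_pos by simp
  show thesis
  proof (rule that[of "2 * M / h * Q"])
    show "0 \<le> 2 * M / h * Q" using M0 h_pos Q(1) by simp
    fix \<rho> x y assume \<rho>: "(\<rho>::real) > 0" and x: "x \<in> \<Omega>" and y: "y \<in> \<Omega>"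
    have step: "value_fn \<rho> x / \<rho> - value_fn \<rho> (x - t *\<^sub>R v) / \<rho> \<le> t * (2 * M)"
      if v: "norm v \<le> h" and t: "0 \<le> t" and seg: "closed_segment (x - t *\<^sub>R v) x \<subseteq> \<Omega>" for x v t
    proof -
      define e where "e = exp (- \<rho> * t)"
      have e: "0 \<le> 1 - e" "1 - e \<le> \<rho> * t"
        using exp_ge_add_one_self[of "- \<rho> * t"] \<rho> t by (auto simp: e_def)
      have "value_fn \<rho> x \<le> (1 - e) * M + e * value_fn \<rho> (x - t *\<^sub>R v)"
        unfolding e_def by (rule value_step[OF \<rho> v t seg]) (use M v seg in \<open>force simp: abs_le_iff\<close>)
      then have "value_fn \<rho> x - value_fn \<rho> (x - t *\<^sub>R v) \<le> (1 - e) * (M - value_fn \<rho> (x - t *\<^sub>R v))"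
        by (simp add: algebra_simps)
      also have "\<dots> \<le> (\<rho> * t) * (2 * M)"
        using abs_value_le[OF \<rho> _ M, of "x - t *\<^sub>R v"] seg e \<rho> t M0
        by (intro mult_mono) (auto simp: abs_le_iff)
      finally show ?thesis using \<rho> by (simp add: diff_divide_distrib[symmetric] divide_le_eq algebra_simps)
    qed
    show "value_fn \<rho> x / \<rho> - value_fn \<rho> y / \<rho> \<le> 2 * M / h * Q * norm (x - y)"
      by (rule Q(2)[OF C segment_bound_imp_lipschitz_segments[of "\<lambda>x. value_fn \<rho> x / \<rho>"] x y])
         (use step in auto)
  qed
qed

lemma continuous_value: 
  assumes "\<rho> > 0" shows "continuous_on \<Omega> (value_fn \<rho>)"
proof -
  obtain \<Lambda> where \<Lambda>: "\<Lambda> \<ge> 0" "\<And>\<rho> x y. \<rho> > 0 \<Longrightarrow> x \<in> \<Omega> \<Longrightarrow> y \<in> \<Omega> \<Longrightarrow>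
    value_fn \<rho> x / \<rho> - value_fn \<rho> y / \<rho> \<le> \<Lambda> * norm (x - y)" using value_lipschitz by blast
  have "\<Lambda>-lipschitz_on \<Omega> (\<lambda>x. value_fn \<rho> x / \<rho>)"
  proof (rule lipschitz_onI)
    fix x y assume "x \<in> \<Omega>" "y \<in> \<Omega>"
    then show "dist (value_fn \<rho> x / \<rho>) (value_fn \<rho> y / \<rho>) \<le> \<Lambda> * dist x y"
      using \<Lambda>(2)[OF assms, of x y] \<Lambda>(2)[OF assms, of y x]
      by (simp add: dist_norm norm_minus_commute abs_le_iff)
  qed (rule \<Lambda>(1))
  then have "continuous_on \<Omega> (\<lambda>x. \<rho> * (value_fn \<rho> x / \<rho>))"
    by (intro continuous_intros lipschitz_on_continuous_on)
  then show ?thesis using assms by simp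
qed

text \<open>Infinitesimal dynamic programming: \<open>value_fn \<rho> x / \<rho>\<close> satisfies
  the discounted equation as a subsolution, for velocities up to \<open>h\<close>. The zeroth order
  term is \<open>value_fn \<rho> x\<close> itself.\<close>

lemma value_difference_bound:
  assumes \<rho>: "\<rho> > 0" and x: "x \<in> \<Omega>" and v: "norm v \<le> h" and \<epsilon>: "\<epsilon> > 0"
  shows "\<forall>\<^sub>F t in at_right 0. value_fn \<rho> x / \<rho> - value_fn \<rho> (x - t *\<^sub>R v) / \<rho> \<le> t * (L x v - value_fn \<rho> x + \<epsilon>)"
proof -
  \<comment> \<open>Half of \<epsilon> absorbs the variation of the Lagrangian and of the value
    along the short segment, a quarter each; the other half absorbs the error of
    \<open>(1 - exp (- (\<rho> * t))) / t\<close> against \<rho>.\<close>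
  define K where "K = L x v - value_fn \<rho> x + \<epsilon> / 2"
  have contLv: "continuous_on \<Omega> (\<lambda>y. L y v)"
    by (rule continuous_on_section[OF continuous_L_\<Omega> v order_refl])
  have op: "open {y \<in> \<Omega>. L y v < L x v + \<epsilon> / 4 \<and> value_fn \<rho> x - \<epsilon> / 4 < value_fn \<rho> y}"
  proof -
    have "{y \<in> \<Omega>. L y v < L x v + \<epsilon> / 4 \<and> value_fn \<rho> x - \<epsilon> / 4 < value_fn \<rho> y}
        = (\<Omega> \<inter> (\<lambda>y. L y v) -` {..<L x v + \<epsilon> / 4}) \<inter> (\<Omega> \<inter> value_fn \<rho> -` {value_fn \<rho> x - \<epsilon> / 4<..})"
      by auto
    then show ?thesis
      using continuous_open_preimage[OF contLv open_\<Omega>] continuous_open_preimage[OF continuous_value[OF \<rho>] open_\<Omega>]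
      by (simp add: open_Int)
  qed
  have seg: "\<forall>\<^sub>F t in at_right 0. closed_segment (x - t *\<^sub>R v) x
      \<subseteq> {y \<in> \<Omega>. L y v < L x v + \<epsilon> / 4 \<and> value_fn \<rho> x - \<epsilon> / 4 < value_fn \<rho> y}"
    by (rule eventually_backward_segment_subset[OF op]) (use x \<epsilon> in auto)
  have "((\<lambda>t. (1 - exp (- (\<rho> * t))) / t) \<longlongrightarrow> \<rho>) (at_right 0)"
    by (rule tendsto_mono[OF at_le one_minus_exp_quotient_tendsto]) auto
  then have "((\<lambda>t. (1 - exp (- (\<rho> * t))) / t * K) \<longlongrightarrow> \<rho> * K) (at_right 0)"
    by (intro tendsto_intros)
  moreover have "\<rho> * K < \<rho> * (K + \<epsilon> / 2)" using \<rho> \<epsilon> by simp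
  ultimately have "\<forall>\<^sub>F t in at_right 0. (1 - exp (- (\<rho> * t))) / t * K < \<rho> * (K + \<epsilon> / 2)"
    by (rule order_tendstoD(2))
  with seg eventually_at_right_less[of 0] show ?thesis
  proof eventually_elim
    case (elim t)
    have t: "t > 0" using elim by simp
    have x': "x - t *\<^sub>R v \<in> {y \<in> \<Omega>. L y v < L x v + \<epsilon> / 4 \<and> value_fn \<rho> x - \<epsilon> / 4 < value_fn \<rho> y}"
      using elim(1) by auto
    define e where "e = exp (- (\<rho> * t))"
    have e: "e \<le> 1" using \<rho> t by (simp add: e_def)
    have "value_fn \<rho> x \<le> (1 - e) * (L x v + \<epsilon> / 4) + e * value_fn \<rho> (x - t *\<^sub>R v)"
      using value_step[OF \<rho> v, of t x "L x v + \<epsilon> / 4"] elim t by (force simp: e_def)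
    then have "value_fn \<rho> x - value_fn \<rho> (x - t *\<^sub>R v) \<le> (1 - e) * (L x v + \<epsilon> / 4 - value_fn \<rho> (x - t *\<^sub>R v))"
      by (simp add: algebra_simps)
    also have "\<dots> \<le> (1 - e) * K"
      using x' e by (intro mult_left_mono) (auto simp: K_def)
    also have "\<dots> \<le> t * (\<rho> * (K + \<epsilon> / 2))"
      using elim(3) t by (simp add: e_def divide_less_eq mult.commute less_imp_le)
    finally have "(value_fn \<rho> x - value_fn \<rho> (x - t *\<^sub>R v)) / \<rho> \<le> t * (K + \<epsilon> / 2)"
      using \<rho> by (simp add: divide_le_eq algebra_simps)
    then show ?case by (simp add: diff_divide_distrib K_def algebra_simps)
  qed
qed

text \<open>The oscillation over \<Omega> is at most \<open>\<Lambda> * R0\<close>. A larger value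
  somewhere would make the normalized function at least \<delta> > 0 everywhere, so that the value
  function would be a subsolution at the level \<open>c0 - \<rho> * \<delta>\<close>, against the
  minimality of c(0).\<close>

lemma normalized_value_upper:
  assumes \<rho>: "\<rho> > 0" and \<Lambda>: "\<Lambda> \<ge> 0" "\<And>x y. x \<in> \<Omega> \<Longrightarrow> y \<in> \<Omega> \<Longrightarrow>
    value_fn \<rho> x / \<rho> - value_fn \<rho> y / \<rho> \<le> \<Lambda> * norm (x - y)" and x: "x \<in> \<Omega>"
  shows "(value_fn \<rho> x + c0) / \<rho> \<le> \<Lambda> * R0"
proof (rule ccontr)
  assume no: "\<not> ?thesis"
  define \<delta> where "\<delta> = (value_fn \<rho> x + c0) / \<rho> - \<Lambda> * R0"
  have \<delta>: "\<delta> > 0" using no by (simp add: \<delta>_def)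
  have low: "\<delta> \<le> (value_fn \<rho> y + c0) / \<rho>" if y: "y \<in> \<Omega>" for y
  proof -
    have "norm (x - y) \<le> R0"
      using norm_triangle_ineq4[of x y] norm_closure_\<Omega>[OF \<Omega>_closure[OF x]] norm_closure_\<Omega>[OF \<Omega>_closure[OF y]]
      by linarith
    then have "\<Lambda> * norm (x - y) \<le> \<Lambda> * R0" using \<Lambda>(1) by (rule mult_left_mono)
    then show ?thesis using \<Lambda>(2)[OF x y] by (simp add: \<delta>_def add_divide_distrib)
  qed
  have "viscosity_subsolution \<Omega> H (c0 - \<rho> * \<delta>) (\<lambda>x. value_fn \<rho> x / \<rho>)"
  proof (rule difference_bound_imp_viscosity[OF open_\<Omega> less_imp_le[OF h_pos]])
    show "continuous_on \<Omega> (\<lambda>x. value_fn \<rho> x / \<rho>)"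
      using \<rho> by (intro continuous_intros continuous_value) auto
    show "\<forall>\<^sub>F t in at_right 0. value_fn \<rho> x / \<rho> - value_fn \<rho> (x - t *\<^sub>R v) / \<rho> \<le> t * (L x v - value_fn \<rho> x + \<epsilon>)"
      if "x \<in> \<Omega>" "norm v \<le> h" "\<epsilon> > 0" for x v \<epsilon> using that by (rule value_difference_bound[OF \<rho>])
    fix y p assume y: "y \<in> \<Omega>" and p: "\<And>v. norm v \<le> h \<Longrightarrow> p \<bullet> v \<le> L y v - value_fn \<rho> y"
    show "H y p \<le> c0 - \<rho> * \<delta>"
    proof (rule truncated_level_imp_level[OF y])
      show "c0 - \<rho> * \<delta> \<le> c0" using \<rho> \<delta> by simp
      fix v :: 'a assume v: "norm v \<le> h"
      have "\<rho> * \<delta> \<le> value_fn \<rho> y + c0" using low[OF y] \<rho> by (simp add: le_divide_eq mult.commute)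
      then show "p \<bullet> v \<le> L y v + (c0 - \<rho> * \<delta>)" using p[OF v] by linarith
    qed
  qed
  then have "c0 \<le> c0 - \<rho> * \<delta>" by (rule c0_le)
  then show False using \<rho> \<delta> by (simp add: mult_le_0_iff)
qed

text \<open>Subsolutions at levels slightly above c(0) serve as potentials. Their Lipschitz
  constants, hence their oscillations, are bounded uniformly for levels in [c(0), c(0) + 1], so the
  level can tend to c(0) without a subsolution at c(0) itself.\<close>

lemma normalized_value_lower:
  obtains B where "\<And>\<rho> x. \<rho> > 0 \<Longrightarrow> x \<in> \<Omega> \<Longrightarrow> - B \<le> (value_fn \<rho> x + c0) / \<rho>"
proof -
  obtain M where M0: "M > 0" and M: "\<forall>x\<in>\<Omega>. \<forall>v\<in>cball 0 h. \<bar>L x v\<bar> \<le> M" by (rule L_bounded_\<Omega>)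
  obtain Q where Q: "Q > 0"
    "\<And>u C x y. 0 \<le> C \<Longrightarrow> (\<And>a b. closed_segment a b \<subseteq> \<Omega> \<Longrightarrow> u a - u b \<le> C * norm (a - b)) \<Longrightarrow>
      x \<in> \<Omega> \<Longrightarrow> y \<in> \<Omega> \<Longrightarrow> u x - u y \<le> C * Q * norm (x - y)"
    using quasiconvex by blast
  define m where "m = M + \<bar>c0\<bar> + 1"
  have m: "m > 0" using M0 by (simp add: m_def)
  define B where "B = m / h * Q * R0"
  show thesis
  proof (rule that[of B])
    fix \<rho> x assume \<rho>: "(\<rho>::real) > 0" and x: "x \<in> \<Omega>"
    have "- \<rho> * B - c0 \<le> value_fn \<rho> x"
    proof (rule field_le_epsilon)
      fix e :: real assume "e > 0"
      define \<epsilon> where "\<epsilon> = min e 1"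
      have \<epsilon>: "\<epsilon> > 0" "\<epsilon> \<le> 1" "\<epsilon> \<le> e" using \<open>e > 0\<close> by (auto simp: \<epsilon>_def)
      then have "c0 < c0 + \<epsilon>" by simp
      then obtain c w where c: "c0 \<le> c" "c < c0 + \<epsilon>" and w: "viscosity_subsolution \<Omega> H c w"
        by (rule subsolution_above_c0)
      have ss: "segment_subsolution \<Omega> h (\<lambda>x v. L x v + c) w" by (rule subsolution_imp_segment_subsolution[OF w])
      have fb: "\<forall>x\<in>\<Omega>. \<forall>v\<in>cball 0 h. \<bar>L x v + c\<bar> \<le> m"
      proof (intro ballI)
        fix y v :: 'a assume "y \<in> \<Omega>" "v \<in> cball 0 h"
        then have "\<bar>L y v\<bar> \<le> M" using M by blast
        then show "\<bar>L y v + c\<bar> \<le> m" using c \<epsilon> by (simp add: m_def)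
      qed
      have lip: "w a - w b \<le> m / h * Q * norm (a - b)" if "a \<in> \<Omega>" "b \<in> \<Omega>" for a b
      proof (rule Q(2)[OF _ segment_bound_imp_lipschitz_segments[of w] that])
        show "0 \<le> m / h" using m h_pos by simp
        fix x v t assume "norm v \<le> h" "0 \<le> t" "closed_segment (x - t *\<^sub>R v) x \<subseteq> \<Omega>"
        then show "w x - w (x - t *\<^sub>R v) \<le> t * m"
          by (intro segment_subsolutionD[OF ss]) (use fb in \<open>force simp: abs_le_iff\<close>)+
      qed
      have osc: "\<bar>w y - w x\<bar> \<le> B" if y: "y \<in> \<Omega>" for y
      proof -
        have "norm (x - y) \<le> R0"
          using norm_triangle_ineq4[of x y] norm_closure_\<Omega>[OF \<Omega>_closure[OF x]] norm_closure_\<Omega>[OF \<Omega>_closure[OF y]]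
          by linarith
        then have "m / h * Q * norm (x - y) \<le> B"
          unfolding B_def using m h_pos Q(1) by (intro mult_left_mono) auto
        then show ?thesis using lip[OF x y] lip[OF y x] by (simp add: norm_minus_commute abs_le_iff)
      qed
      define u where "u y = w y - w x" for y
      have contu: "continuous_on \<Omega> u"
        using w unfolding u_def viscosity_subsolution_def by (intro continuous_intros) auto
      have cont_uv: "continuous_on (\<Omega> \<times> cball (0::'a) h) (\<lambda>(x, v). u x)"
        by (auto simp: case_prod_unfold intro!: continuous_on_compose2[OF contu] continuous_intros)
      have contf: "continuous_on (\<Omega> \<times> cball 0 h) (\<lambda>(x, v). L x v + c)"
        using continuous_L_\<Omega> by (auto simp: case_prod_unfold intro!: continuous_intros)
      have ssu: "segment_subsolution \<Omega> h (\<lambda>x v. L x v + c) u"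
        using ss by (simp add: segment_subsolution_def u_def)
      have "- \<rho> * B - c \<le> value_fn \<rho> x"
      proof (rule value_ge[OF x])
        fix ps assume adm: "admissible \<Omega> h x ps"
        have "\<rho> * (u x - discounted \<Omega> h \<rho> x ps (\<lambda>x v. u x)) \<le> discounted \<Omega> h \<rho> x ps (\<lambda>x v. L x v + c)"
          by (rule discounted_ge_potential[OF open_\<Omega> less_imp_le[OF h_pos] \<rho> adm contf fb contu _ ssu, of B])
            (use osc in \<open>simp add: u_def\<close>)
        also have "\<dots> = discounted \<Omega> h \<rho> x ps L + c"
          by (rule discounted_add_const[OF open_\<Omega> less_imp_le[OF h_pos] \<rho> adm continuous_L_\<Omega> M])
        finally have "\<rho> * (u x - discounted \<Omega> h \<rho> x ps (\<lambda>x v. u x)) \<le> discounted \<Omega> h \<rho> x ps L + c" .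
        moreover have "\<bar>discounted \<Omega> h \<rho> x ps (\<lambda>x v. u x)\<bar> \<le> B"
          by (rule abs_discounted_le[OF open_\<Omega> less_imp_le[OF h_pos] \<rho> adm cont_uv])
            (use osc in \<open>simp add: u_def\<close>)
        then have "\<rho> * (- B) \<le> \<rho> * (u x - discounted \<Omega> h \<rho> x ps (\<lambda>x v. u x))"
          using \<rho> by (intro mult_left_mono) (auto simp: u_def)
        ultimately show "- \<rho> * B - c \<le> discounted \<Omega> h \<rho> x ps L" by simp
      qed
      then show "- \<rho> * B - c0 \<le> value_fn \<rho> x + e" using c \<epsilon> by linarith
    qed
    then show "- B \<le> (value_fn \<rho> x + c0) / \<rho>" using \<rho> by (simp add: le_divide_eq algebra_simps)
  qed
qed

end

section \<open>Mather measures and the limit of the normalized value functions\<close>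

context star_shaped_hamiltonian
begin

text \<open>The extensions to the closure share one Lipschitz constant and one bound, so
  Arzela-Ascoli applies on a compact set. The \<open>g n\<close> are kept along with
  \<open>w\<close> because the later inequalities hold for each rate before the limit.\<close>

lemma normalized_value_limit:
  obtains \<sigma> :: "nat \<Rightarrow> real" and g :: "nat \<Rightarrow> 'a \<Rightarrow> real" and w B where
    "\<And>n. \<sigma> n > 0" "\<sigma> \<longlonglongrightarrow> 0" "\<And>n. continuous_on (closure \<Omega>) (g n)"
    "\<And>n x. x \<in> \<Omega> \<Longrightarrow> g n x = (value_fn (\<sigma> n) x + c0) / \<sigma> n"
    "\<And>n x. x \<in> closure \<Omega> \<Longrightarrow> \<bar>g n x\<bar> \<le> B"
    "\<And>x. x \<in> closure \<Omega> \<Longrightarrow> (\<lambda>n. g n x) \<longlonglongrightarrow> w x" "continuous_on (closure \<Omega>) w"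
proof -
  obtain \<Lambda> where \<Lambda>: "\<Lambda> \<ge> 0" "\<And>\<rho> x y. \<rho> > 0 \<Longrightarrow> x \<in> \<Omega> \<Longrightarrow> y \<in> \<Omega> \<Longrightarrow>
    value_fn \<rho> x / \<rho> - value_fn \<rho> y / \<rho> \<le> \<Lambda> * norm (x - y)" using value_lipschitz by blast
  obtain B0 where B0: "\<And>\<rho> x. \<rho> > 0 \<Longrightarrow> x \<in> \<Omega> \<Longrightarrow> - B0 \<le> (value_fn \<rho> x + c0) / \<rho>"
    using normalized_value_lower by blast
  define B where "B = max B0 (\<Lambda> * R0)"
  define s where "s n = 1 / real (Suc n)" for n
  have s: "s n > 0" for n by (simp add: s_def)
  have "\<exists>G. (\<forall>x\<in>\<Omega>. G x = (value_fn (s n) x + c0) / s n) \<and> (\<forall>x y. \<bar>G x - G y\<bar> \<le> \<Lambda> * dist x y)" for n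
  proof -
    have "(value_fn (s n) x + c0) / s n - (value_fn (s n) y + c0) / s n \<le> \<Lambda> * dist x y"
      if "x \<in> \<Omega>" "y \<in> \<Omega>" for x y
      using \<Lambda>(2)[OF s that] by (simp add: dist_norm add_divide_distrib)
    then obtain G where "\<And>x. x \<in> \<Omega> \<Longrightarrow> G x = (value_fn (s n) x + c0) / s n"
        "\<And>x y. \<bar>G x - G y\<bar> \<le> \<Lambda> * dist x y"
      by (rule lipschitz_extension_real[OF \<Lambda>(1)]) (use zero_in_\<Omega> in auto)
    then show ?thesis by blast
  qed
  then obtain G where G: "\<And>n x. x \<in> \<Omega> \<Longrightarrow> G n x = (value_fn (s n) x + c0) / s n"
      "\<And>n x y. \<bar>G n x - G n y\<bar> \<le> \<Lambda> * dist x y" by metis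
  have contG: "continuous_on S (G n)" for n S
    by (rule lipschitz_on_continuous_on[of \<Lambda>]) (use G(2) \<Lambda>(1) in \<open>auto intro!: lipschitz_onI simp: dist_real_def\<close>)
  have GB: "\<bar>G n x\<bar> \<le> B" if "x \<in> closure \<Omega>" for n x
  proof -
    have "closed {x. \<bar>G n x\<bar> \<le> B}"
      by (rule closed_Collect_le) (auto intro!: continuous_intros contG)
    moreover have "\<Omega> \<subseteq> {x. \<bar>G n x\<bar> \<le> B}"
    proof
      fix x assume x: "x \<in> \<Omega>"
      have "(value_fn (s n) x + c0) / s n \<le> \<Lambda> * R0"
        by (rule normalized_value_upper[OF s \<Lambda>(1) \<Lambda>(2)[OF s] x])
      then show "x \<in> {x. \<bar>G n x\<bar> \<le> B}"
        using B0[OF s[of n] x] by (auto simp: G(1)[OF x] B_def abs_le_iff)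
    qed
    ultimately have "closure \<Omega> \<subseteq> {x. \<bar>G n x\<bar> \<le> B}" by (rule closure_minimal[rotated])
    then show ?thesis using that by blast
  qed
  obtain w k where w: "continuous_on (closure \<Omega>) w" and k: "strict_mono (k :: nat \<Rightarrow> nat)"
    and conv: "\<And>e. 0 < e \<Longrightarrow> \<exists>N. \<forall>n x. n \<ge> N \<and> x \<in> closure \<Omega> \<longrightarrow> norm (G (k n) x - w x) < e"
  proof (rule Arzela_Ascoli[OF compact_closure_\<Omega>, of G B])
    show "norm (G n x) \<le> B" if "x \<in> closure \<Omega>" for n x using GB[OF that] by simp
    show "\<exists>d>0. \<forall>n y. y \<in> closure \<Omega> \<and> norm (x - y) < d \<longrightarrow> norm (G n x - G n y) < e"
      if "0 < e" for x e
    proof (intro exI[of _ "e / (\<Lambda> + 1)"] conjI allI impI)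
      show "0 < e / (\<Lambda> + 1)" using that \<Lambda>(1) by simp
      fix n y assume "y \<in> closure \<Omega> \<and> norm (x - y) < e / (\<Lambda> + 1)"
      then have "(\<Lambda> + 1) * norm (x - y) < e" using \<Lambda>(1) by (simp add: less_divide_eq mult.commute)
      moreover have "\<Lambda> * norm (x - y) \<le> (\<Lambda> + 1) * norm (x - y)" by (intro mult_right_mono) auto
      ultimately show "norm (G n x - G n y) < e" using G(2)[of n x y] by (simp add: dist_norm)
    qed
  qed blast
  have lim: "(\<lambda>n. G (k n) x) \<longlonglongrightarrow> w x" if "x \<in> closure \<Omega>" for x
    unfolding lim_sequentially dist_norm using conv that by blast
  have "s \<longlonglongrightarrow> 0" unfolding s_def by (rule LIMSEQ_Suc[OF lim_1_over_n])
  then have "(\<lambda>n. s (k n)) \<longlonglongrightarrow> 0" using LIMSEQ_subseq_LIMSEQ[OF _ k] by (auto simp: o_def)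
  then show thesis
    using that[of "\<lambda>n. s (k n)" "\<lambda>n. G (k n)" B w] s contG G(1) GB lim w by blast
qed

lemma segment_subsolution_imp_subsolution:
  assumes "segment_subsolution \<Omega> h (\<lambda>x v. L x v + c0) u" "continuous_on \<Omega> u"
  shows "viscosity_subsolution \<Omega> H c0 u"
proof (rule difference_bound_imp_viscosity[OF open_\<Omega> less_imp_le[OF h_pos] assms(2)])
  fix x v :: 'a and \<epsilon> :: real assume x: "x \<in> \<Omega>" and v: "norm v \<le> h" and \<epsilon>: "\<epsilon> > 0"
  have "continuous_on \<Omega> (\<lambda>y. L y v + c0)"
    by (intro continuous_intros continuous_on_section[OF continuous_L_\<Omega> v]) simp
  then show "\<forall>\<^sub>F t in at_right 0. u x - u (x - t *\<^sub>R v) \<le> t * ((L x v + c0) + \<epsilon>)"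
    by (rule segment_subsolution_difference_bound[OF open_\<Omega> x v assms(1) _ \<epsilon>])
qed (rule truncated_level_imp_level, auto)

section \<open>Membership in \<open>G0\<close> and integration against measures in its dual\<close>

lemma G0I:
  assumes "continuous_on (closure \<Omega> \<times> cball 0 h) (\<lambda>(x, v). f x v)" "continuous_on (closure \<Omega>) u"
    and "\<And>x v \<epsilon>. x \<in> \<Omega> \<Longrightarrow> norm v \<le> h \<Longrightarrow> \<epsilon> > 0 \<Longrightarrow>
      \<forall>\<^sub>F t in at_right 0. u x - u (x - t *\<^sub>R v) \<le> t * (f x v + \<epsilon>)"
  shows "f \<in> G0 \<Omega> h"
proof -
  have "viscosity_subsolution \<Omega> (hamiltonian_of h f) 0 u"
  proof (rule difference_bound_imp_viscosity[OF open_\<Omega> less_imp_le[OF h_pos] _ assms(3)])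
    show "continuous_on \<Omega> u" using assms(2) closure_subset by (rule continuous_on_subset)
    fix x p assume p: "\<And>v. norm v \<le> h \<Longrightarrow> p \<bullet> v \<le> f x v"
    show "hamiltonian_of h f x p \<le> 0"
      by (rule hamiltonian_of_leI) (use h_pos p in auto)
  qed
  then show ?thesis using assms(1,2) by (auto simp: G0_def)
qed

lemma G0I_segment:
  assumes f: "continuous_on (closure \<Omega> \<times> cball 0 h) (\<lambda>(x, v). f x v)" and u: "continuous_on (closure \<Omega>) u"
    and sub: "segment_subsolution \<Omega> h f u"
  shows "f \<in> G0 \<Omega> h"
proof (rule G0I[OF f u])
  fix x v :: 'a and \<epsilon> :: real assume x: "x \<in> \<Omega>" and v: "norm v \<le> h" and \<epsilon>: "\<epsilon> > 0"
  have "continuous_on \<Omega> (\<lambda>y. f y v)"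
    by (rule continuous_on_section[OF f v closure_subset])
  then show "\<forall>\<^sub>F t in at_right 0. u x - u (x - t *\<^sub>R v) \<le> t * (f x v + \<epsilon>)"
    by (rule segment_subsolution_difference_bound[OF open_\<Omega> x v sub _ \<epsilon>])
qed

lemma continuous_L_add: "continuous_on (closure \<Omega> \<times> cball 0 h) (\<lambda>(x, v). L x v + c)"
  using continuous_L_closure by (auto simp: case_prod_unfold intro!: continuous_intros)

lemma continuous_fst_extend:
  fixes u :: "'a \<Rightarrow> real"
  shows "continuous_on S u \<Longrightarrow> continuous_on (S \<times> cball (0::'a) h) (\<lambda>(x, v). u x)"
  by (auto simp: case_prod_unfold intro!: continuous_on_compose2[of S u] continuous_intros)

lemma integrable_pairing:
  fixes f :: "'a \<Rightarrow> 'a \<Rightarrow> real"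
  assumes "finite_measure \<mu>" "sets \<mu> = sets (restrict_space borel (closure \<Omega> \<times> cball 0 h))"
    and f: "continuous_on (closure \<Omega> \<times> cball 0 h) (\<lambda>(x, v). f x v)"
  shows "integrable \<mu> (\<lambda>z. f (fst z) (snd z))"
proof -
  have space: "space \<mu> = closure \<Omega> \<times> cball 0 h"
    using sets_eq_imp_space_eq[OF assms(2)] by (simp add: space_restrict_space)
  have "compact (closure \<Omega> \<times> cball (0::'a) h)" by (intro compact_Times compact_closure_\<Omega> compact_cball)
  then have "bounded ((\<lambda>(x, v). f x v) ` (closure \<Omega> \<times> cball 0 h))"
    by (intro compact_imp_bounded compact_continuous_image f)
  then obtain B where "\<And>z. z \<in> closure \<Omega> \<times> cball 0 h \<Longrightarrow> \<bar>f (fst z) (snd z)\<bar> \<le> B"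
    by (force simp: bounded_iff case_prod_unfold)
  moreover have "(\<lambda>z. f (fst z) (snd z)) \<in> borel_measurable \<mu>"
    using borel_measurable_continuous_on_restrict[OF f] measurable_cong_sets[OF assms(2) refl]
    by (auto simp: case_prod_unfold)
  ultimately show ?thesis
    by (intro finite_measure.integrable_const_bound[OF assms(1), of _ B]) (auto simp: space)
qed

lemma mather_measuresD:
  assumes "\<mu> \<in> mather_measures \<Omega> H h"
  shows "prob_space \<mu>" "finite_measure \<mu>" "sets \<mu> = sets (restrict_space borel (closure \<Omega> \<times> cball 0 h))"
    "space \<mu> = closure \<Omega> \<times> cball 0 h" "f \<in> G0 \<Omega> h \<Longrightarrow> 0 \<le> pairing \<mu> f" "pairing \<mu> L = - c0"
proof -
  show sets: "sets \<mu> = sets (restrict_space borel (closure \<Omega> \<times> cball 0 h))"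
    using assms by (auto simp: mather_measures_def G0_dual_def)
  show "space \<mu> = closure \<Omega> \<times> cball 0 h"
    using sets_eq_imp_space_eq[OF sets] by (simp add: space_restrict_space)
qed (use assms in \<open>auto simp: mather_measures_def G0_dual_def\<close>)

lemma pairing_add_const:
  assumes "prob_space \<mu>" "sets \<mu> = sets (restrict_space borel (closure \<Omega> \<times> cball 0 h))"
    and f: "continuous_on (closure \<Omega> \<times> cball 0 h) (\<lambda>(x, v). f x v)"
  shows "pairing \<mu> (\<lambda>x v. f x v + c) = pairing \<mu> f + c"
proof -
  interpret prob_space \<mu> by fact
  have "integrable \<mu> (\<lambda>z. f (fst z) (snd z))"
    by (rule integrable_pairing[OF _ assms(2) f]) unfold_locales
  then show ?thesis unfolding pairing_def using prob_space by simp
qed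

section \<open>The corrector and the optimal Mather measure\<close>

context
  fixes \<sigma> :: "nat \<Rightarrow> real" and g :: "nat \<Rightarrow> 'a \<Rightarrow> real" and w :: "'a \<Rightarrow> real" and B :: real
  assumes \<sigma>_pos: "\<And>n. \<sigma> n > 0" and \<sigma>_lim: "\<sigma> \<longlonglongrightarrow> 0" and g_cont: "\<And>n. continuous_on (closure \<Omega>) (g n)"
    and g_eq: "\<And>n x. x \<in> \<Omega> \<Longrightarrow> g n x = (value_fn (\<sigma> n) x + c0) / \<sigma> n"
    and g_bound: "\<And>n x. x \<in> closure \<Omega> \<Longrightarrow> \<bar>g n x\<bar> \<le> B"
    and g_lim: "\<And>x. x \<in> closure \<Omega> \<Longrightarrow> (\<lambda>n. g n x) \<longlonglongrightarrow> w x"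
    and w_cont: "continuous_on (closure \<Omega>) w"
begin

text \<open>After adding c(0) and dividing by \<open>\<sigma> n\<close>, the dynamic programming
  step bounds the increment of \<open>g n\<close> by
  \<open>(1 - exp (- (t * \<sigma> n))) / \<sigma> n * m\<close>, up to a discount factor tending to
  1, and the quotient tends to \<open>t\<close>.\<close>

lemma w_segment_subsolution: "segment_subsolution \<Omega> h (\<lambda>x v. L x v + c0) w"
  unfolding segment_subsolution_def
proof (intro allI impI)
  fix x v t m assume v: "norm v \<le> h" and t: "0 \<le> t" and seg: "closed_segment (x - t *\<^sub>R v) x \<subseteq> \<Omega>"
    and m: "\<forall>y\<in>closed_segment (x - t *\<^sub>R v) x. L y v + c0 \<le> m"
  have x: "x \<in> \<Omega>" "x - t *\<^sub>R v \<in> \<Omega>" using seg by auto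
  have le: "g n x - exp (- (t * \<sigma> n)) * g n (x - t *\<^sub>R v) \<le> (1 - exp (- (t * \<sigma> n))) / \<sigma> n * m" for n
  proof -
    define e where "e = exp (- (t * \<sigma> n))"
    have "value_fn (\<sigma> n) x \<le> (1 - exp (- \<sigma> n * t)) * (m - c0) + exp (- \<sigma> n * t) * value_fn (\<sigma> n) (x - t *\<^sub>R v)"
      by (rule value_step[OF \<sigma>_pos v t seg]) (use m in \<open>auto simp: le_diff_eq\<close>)
    then have "(value_fn (\<sigma> n) x + c0) - e * (value_fn (\<sigma> n) (x - t *\<^sub>R v) + c0) \<le> (1 - e) * m"
      by (simp add: e_def algebra_simps)
    then have "((value_fn (\<sigma> n) x + c0) - e * (value_fn (\<sigma> n) (x - t *\<^sub>R v) + c0)) / \<sigma> n \<le> (1 - e) * m / \<sigma> n"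
      using \<sigma>_pos[of n] by (intro divide_right_mono) auto
    moreover have "g n x - e * g n (x - t *\<^sub>R v)
        = ((value_fn (\<sigma> n) x + c0) - e * (value_fn (\<sigma> n) (x - t *\<^sub>R v) + c0)) / \<sigma> n"
      unfolding g_eq[OF x(1)] g_eq[OF x(2)] by (simp add: diff_divide_distrib)
    ultimately show ?thesis unfolding e_def[symmetric] by simp
  qed
  have "filterlim \<sigma> (at 0) sequentially"
    using \<sigma>_lim \<sigma>_pos by (intro filterlim_atI) (auto intro!: always_eventually simp: less_imp_neq[symmetric])
  then have "(\<lambda>n. (1 - exp (- (t * \<sigma> n))) / \<sigma> n) \<longlonglongrightarrow> t"
    by (rule filterlim_compose[OF one_minus_exp_quotient_tendsto])
  then have r: "(\<lambda>n. (1 - exp (- (t * \<sigma> n))) / \<sigma> n * m) \<longlonglongrightarrow> t * m" by (intro tendsto_intros)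
  have "(\<lambda>n. g n x - exp (- (t * \<sigma> n)) * g n (x - t *\<^sub>R v)) \<longlonglongrightarrow> w x - exp (- (t * 0)) * w (x - t *\<^sub>R v)"
    by (intro tendsto_intros \<sigma>_lim g_lim \<Omega>_closure x)
  then have "(\<lambda>n. g n x - exp (- (t * \<sigma> n)) * g n (x - t *\<^sub>R v)) \<longlonglongrightarrow> w x - w (x - t *\<^sub>R v)" by simp
  then show "w x - w (x - t *\<^sub>R v) \<le> t * m" by (rule LIMSEQ_le[OF _ r]) (use le in auto)
qed

lemma w_cont_\<Omega>: "continuous_on \<Omega> w" using w_cont closure_subset by (rule continuous_on_subset)

lemma L_add_c0_in_G0: "(\<lambda>x v. L x v + c0) \<in> G0 \<Omega> h"
  by (rule G0I_segment[OF continuous_L_add w_cont w_segment_subsolution])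

text \<open>By the discounted equation \<open>g n\<close> is a potential for
  \<open>L x v + c0 - \<sigma> n * g n x\<close>. A Mather measure pairs nonnegatively with this
  cost and annihilates L + c(0), which leaves the sign of the pairing with
  \<open>g n\<close>.\<close>

lemma pairing_normalized_value_le:
  assumes \<mu>: "\<mu> \<in> mather_measures \<Omega> H h" shows "pairing \<mu> (\<lambda>x v. g n x) \<le> 0"
proof -
  note [simp] = mather_measuresD(6)[OF \<mu>]
  interpret prob_space \<mu> by (rule mather_measuresD[OF \<mu>])
  have cg: "continuous_on (closure \<Omega> \<times> cball (0::'a) h) (\<lambda>(x, v). g n x)"
    by (rule continuous_fst_extend[OF g_cont])
  have cont: "continuous_on (closure \<Omega> \<times> cball 0 h) (\<lambda>(x, v). L x v + c0 - \<sigma> n * g n x)"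
    using continuous_L_add[of c0] cg by (auto simp: case_prod_unfold intro!: continuous_intros)
  have "(\<lambda>x v. L x v + c0 - \<sigma> n * g n x) \<in> G0 \<Omega> h"
  proof (rule G0I[OF cont g_cont[of n]])
    fix x v :: 'a and \<epsilon> :: real assume x: "x \<in> \<Omega>" and v: "norm v \<le> h" and \<epsilon>: "\<epsilon> > 0"
    have eq: "L x v + c0 - \<sigma> n * g n x = L x v - value_fn (\<sigma> n) x"
      using \<sigma>_pos[of n] by (simp add: g_eq[OF x])
    show "\<forall>\<^sub>F t in at_right 0. g n x - g n (x - t *\<^sub>R v) \<le> t * (L x v + c0 - \<sigma> n * g n x + \<epsilon>)"
      using value_difference_bound[OF \<sigma>_pos[of n] x v \<epsilon>] eventually_backward_segment_subset[OF open_\<Omega> x, of v]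
    proof eventually_elim
      case (elim t)
      then have "x - t *\<^sub>R v \<in> \<Omega>" by auto
      then have "g n x - g n (x - t *\<^sub>R v) = value_fn (\<sigma> n) x / \<sigma> n - value_fn (\<sigma> n) (x - t *\<^sub>R v) / \<sigma> n"
        by (simp add: g_eq x add_divide_distrib)
      then show ?case unfolding eq using elim by simp
    qed
  qed
  then have "0 \<le> pairing \<mu> (\<lambda>x v. L x v + c0 - \<sigma> n * g n x)"
    by (rule mather_measuresD(5)[OF \<mu>])
  also have "\<dots> = pairing \<mu> (\<lambda>x v. L x v + c0) - \<sigma> n * pairing \<mu> (\<lambda>x v. g n x)"
    using integrable_pairing[OF mather_measuresD(2,3)[OF \<mu>] continuous_L_add[of c0]]
      integrable_pairing[OF mather_measuresD(2,3)[OF \<mu>] cg]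
    unfolding pairing_def by simp
  also have "pairing \<mu> (\<lambda>x v. L x v + c0) = 0"
    using pairing_add_const[OF mather_measuresD(1,3)[OF \<mu>] continuous_L_closure] by simp
  finally show ?thesis using \<sigma>_pos[of n] by (simp add: mult_le_0_iff)
qed

lemma pairing_w_le:
  assumes \<mu>: "\<mu> \<in> mather_measures \<Omega> H h" shows "pairing \<mu> (\<lambda>x v. w x) \<le> 0"
proof -
  interpret prob_space \<mu> by (rule mather_measuresD[OF \<mu>])
  note int = integrable_pairing[OF mather_measuresD(2,3)[OF \<mu>] continuous_fst_extend]
  have "(\<lambda>n. pairing \<mu> (\<lambda>x v. g n x)) \<longlonglongrightarrow> pairing \<mu> (\<lambda>x v. w x)"
    unfolding pairing_def
  proof (rule integral_dominated_convergence[where w = "\<lambda>_. B"])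
    show "(\<lambda>z. w (fst z)) \<in> borel_measurable \<mu>" using int[OF w_cont] by auto
    show "(\<lambda>z. g n (fst z)) \<in> borel_measurable \<mu>" for n using int[OF g_cont[of n]] by auto
    show "AE z in \<mu>. (\<lambda>n. g n (fst z)) \<longlonglongrightarrow> w (fst z)"
      by (rule AE_I2) (auto simp: mather_measuresD(4)[OF \<mu>] intro!: g_lim)
    show "AE z in \<mu>. norm (g n (fst z)) \<le> B" for n
      by (rule AE_I2) (auto simp: mather_measuresD(4)[OF \<mu>] intro!: g_bound)
  qed simp
  then show ?thesis by (rule LIMSEQ_le_const2) (use pairing_normalized_value_le[OF \<mu>] in auto)
qed

lemma w_in_E_family: "w \<in> E_family \<Omega> H h 0"
  using w_cont segment_subsolution_imp_subsolution[OF w_segment_subsolution w_cont_\<Omega>] pairing_w_le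
  by (auto simp: E_family_def)

text \<open>Scaling a segment by \<tau> while keeping its velocity shortens its duration to
  \<open>\<tau> * t\<close>; the division of \<open>w\<close> by \<tau> compensates exactly, so only
  the position argument of the Lagrangian changes.\<close>

lemma dilated_L_in_G0:
  assumes \<tau>: "0 < \<tau>" "\<tau> < 1" shows "(\<lambda>x v. L (\<tau> *\<^sub>R x) v + c0) \<in> G0 \<Omega> h"
proof (rule G0I_segment)
  have sub: "\<tau> *\<^sub>R x \<in> closure \<Omega>" if "x \<in> closure \<Omega>" for x
    using star_closure[OF that \<tau>] \<Omega>_closure by blast
  have "continuous_on (closure \<Omega> \<times> cball 0 h) (\<lambda>z. (\<lambda>(x, v). L x v + c0) (\<tau> *\<^sub>R fst z, snd z))"
    by (rule continuous_on_compose2[OF continuous_L_add]) (auto intro!: continuous_intros sub)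
  then show "continuous_on (closure \<Omega> \<times> cball 0 h) (\<lambda>(x, v). L (\<tau> *\<^sub>R x) v + c0)"
    by (simp add: case_prod_unfold)
  show "continuous_on (closure \<Omega>) (\<lambda>x. w (\<tau> *\<^sub>R x) / \<tau>)"
    by (intro continuous_intros continuous_on_compose2[OF w_cont]) (use \<tau> in \<open>auto intro!: sub\<close>)
  show "segment_subsolution \<Omega> h (\<lambda>x v. L (\<tau> *\<^sub>R x) v + c0) (\<lambda>x. w (\<tau> *\<^sub>R x) / \<tau>)"
    unfolding segment_subsolution_def
  proof (intro allI impI)
    fix x v t m assume v: "norm v \<le> h" and t: "0 \<le> t" and seg: "closed_segment (x - t *\<^sub>R v) x \<subseteq> \<Omega>"
      and m: "\<forall>y\<in>closed_segment (x - t *\<^sub>R v) x. L (\<tau> *\<^sub>R y) v + c0 \<le> m"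
    have eq: "\<tau> *\<^sub>R x - (\<tau> * t) *\<^sub>R v = \<tau> *\<^sub>R (x - t *\<^sub>R v)" by (simp add: algebra_simps)
    have img: "\<exists>q\<in>closed_segment (x - t *\<^sub>R v) x. y = \<tau> *\<^sub>R q"
      if y: "y \<in> closed_segment (\<tau> *\<^sub>R x - (\<tau> * t) *\<^sub>R v) (\<tau> *\<^sub>R x)" for y
    proof -
      have "0 \<le> \<tau> * t" using \<tau> t by simp
      from backward_segment_cases[OF this y] obtain s where s: "0 \<le> s" "s \<le> \<tau> * t" "y = \<tau> *\<^sub>R x - s *\<^sub>R v" .
      have "x - (s / \<tau>) *\<^sub>R v \<in> closed_segment (x - t *\<^sub>R v) x"
        using s \<tau> by (intro in_backward_segment) (auto simp: divide_le_eq mult.commute)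
      moreover have "y = \<tau> *\<^sub>R (x - (s / \<tau>) *\<^sub>R v)" using \<tau> s(3) by (simp add: algebra_simps)
      ultimately show ?thesis by blast
    qed
    have "w (\<tau> *\<^sub>R x) - w (\<tau> *\<^sub>R x - (\<tau> * t) *\<^sub>R v) \<le> (\<tau> * t) * m"
    proof (rule segment_subsolutionD[OF w_segment_subsolution v])
      show "closed_segment (\<tau> *\<^sub>R x - (\<tau> * t) *\<^sub>R v) (\<tau> *\<^sub>R x) \<subseteq> \<Omega>"
      proof
        fix y assume "y \<in> closed_segment (\<tau> *\<^sub>R x - (\<tau> * t) *\<^sub>R v) (\<tau> *\<^sub>R x)"
        then obtain q where "q \<in> \<Omega>" "y = \<tau> *\<^sub>R q" using img seg by blast
        then show "y \<in> \<Omega>" using star[of q \<tau>] \<tau> by simp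
      qed
      show "L y v + c0 \<le> m" if "y \<in> closed_segment (\<tau> *\<^sub>R x - (\<tau> * t) *\<^sub>R v) (\<tau> *\<^sub>R x)" for y
        using img[OF that] m by blast
    qed (use \<tau> t in simp)
    then have "(w (\<tau> *\<^sub>R x) - w (\<tau> *\<^sub>R (x - t *\<^sub>R v))) / \<tau> \<le> t * m"
      unfolding eq using \<tau> by (simp add: divide_le_eq algebra_simps)
    then show "w (\<tau> *\<^sub>R x) / \<tau> - w (\<tau> *\<^sub>R (x - t *\<^sub>R v)) / \<tau> \<le> t * m"
      by (simp add: diff_divide_distrib)
  qed
qed

text \<open>The measure comes from near-minimizers ending at \<open>z\<close> and does not depend on
  \<open>v\<close>. This uniformity lets one measure both identify the supremum at \<open>z\<close>
  for \<gamma> = 0 and bound it for \<gamma> > 0.\<close>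

lemma subsolution_le_w_plus_pairing:
  assumes z: "z \<in> \<Omega>"
  obtains \<nu> where "\<nu> \<in> mather_measures \<Omega> H h"
    "\<And>v. continuous_on (closure \<Omega>) v \<Longrightarrow> viscosity_subsolution \<Omega> H c0 v \<Longrightarrow> v z \<le> w z + pairing \<nu> (\<lambda>x _. v x)"
proof -
  have h0: "0 \<le> h" using h_pos by simp
  obtain M where "M > 0" and M: "\<forall>x\<in>\<Omega>. \<forall>v\<in>cball 0 h. \<bar>L x v\<bar> \<le> M" by (rule L_bounded_\<Omega>)
  define K where "K = closure \<Omega> \<times> cball (0::'a) h"
  have K: "compact K" unfolding K_def by (intro compact_Times compact_closure_\<Omega> compact_cball)
  \<comment> \<open>The quadratic error leaves a vanishing \<open>\<sigma> n\<close> after the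
    division by \<open>\<sigma> n\<close> that compares \<open>v z\<close> with
    \<open>g n z\<close>.\<close>
  have "\<exists>ps. admissible \<Omega> h z ps \<and> discounted \<Omega> h (\<sigma> n) z ps L < value_fn (\<sigma> n) z + (\<sigma> n)\<^sup>2" for n
  proof -
    have "value_fn (\<sigma> n) z < value_fn (\<sigma> n) z + (\<sigma> n)\<^sup>2" using \<sigma>_pos[of n] by simp
    then show ?thesis
      unfolding value_fn_def[of "\<sigma> n" z]
      using cINF_less_iff[OF admissible_Nil[OF z] bdd_below_discounted_L[OF \<sigma>_pos]] by blast
  qed
  then obtain ps where ps: "\<And>n. admissible \<Omega> h z (ps n)"
      "\<And>n. discounted \<Omega> h (\<sigma> n) z (ps n) L < value_fn (\<sigma> n) z + (\<sigma> n)\<^sup>2" by metis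
  define \<mu> where "\<mu> n = occupation (\<sigma> n) z (ps n)" for n
  have AE\<Omega>: "AE y in \<mu> n. y \<in> \<Omega> \<times> cball 0 h" for n
    unfolding \<mu>_def by (rule AE_occupation[OF \<sigma>_pos ps(1) open_\<Omega> h0])
  have AEK: "AE y in \<mu> n. y \<in> K" for n
    using AE\<Omega>[of n] by eventually_elim (auto simp: K_def \<Omega>_closure)
  have "prob_space (\<mu> n)" "sets (\<mu> n) = sets borel" for n
    unfolding \<mu>_def by (auto intro: prob_space_occupation[OF \<sigma>_pos])
  from compact_prob_measures_weak_limit[of K \<mu>, OF K this AEK]
  obtain r :: "nat \<Rightarrow> nat" and \<nu> where r: "strict_mono r" and \<nu>: "prob_space \<nu>" "sets \<nu> = sets (restrict_space borel K)"
    and lim: "\<And>f. continuous_on K (f :: 'a \<times> 'a \<Rightarrow> real) \<Longrightarrow>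
       (\<lambda>n. \<integral>y. (if y \<in> K then f y else 0) \<partial>\<mu> (r n)) \<longlonglongrightarrow> (\<integral>y. f y \<partial>\<nu>)"
    by blast
  note \<nu>K = \<nu>(2)[unfolded K_def]
  \<comment> \<open>The paths stay in the open set while the limit measure lives over its closure;
    the two cutoffs agree almost everywhere for each occupation measure.\<close>
  have disc_lim: "(\<lambda>n. discounted \<Omega> h (\<sigma> (r n)) z (ps (r n)) f) \<longlonglongrightarrow> pairing \<nu> f"
    if f: "continuous_on (closure \<Omega> \<times> cball 0 h) (\<lambda>(x, v). f x v)" for f
  proof -
    have fK: "continuous_on K (\<lambda>y. f (fst y) (snd y))" using f by (simp add: K_def case_prod_unfold)
    have f\<Omega>: "continuous_on (\<Omega> \<times> cball 0 h) (\<lambda>(x, v). f x v)"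
      by (rule continuous_on_subset[OF f]) (auto simp: \<Omega>_closure)
    have "discounted \<Omega> h (\<sigma> n) z (ps n) f = (\<integral>y. (if y \<in> K then f (fst y) (snd y) else 0) \<partial>\<mu> n)" for n
      unfolding discounted_def \<mu>_def[symmetric]
    proof (rule integral_cong_AE)
      have sets: "sets (\<mu> n) = sets borel" by (simp add: \<mu>_def)
      show "(\<lambda>y. if y \<in> \<Omega> \<times> cball 0 h then f (fst y) (snd y) else 0) \<in> borel_measurable (\<mu> n)"
        using extension_measurable[OF open_\<Omega> h0 \<sigma>_pos[of n] f\<Omega>] by (simp add: measurable_cong_sets[OF sets refl])
      have "(\<lambda>y. if y \<in> K then f (fst y) (snd y) else 0) \<in> borel_measurable borel"
        using borel_compact[OF K] fK by (intro borel_measurable_continuous_on_if) auto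
      then show "(\<lambda>y. if y \<in> K then f (fst y) (snd y) else 0) \<in> borel_measurable (\<mu> n)"
        by (simp add: measurable_cong_sets[OF sets refl])
      show "AE y in \<mu> n. (if y \<in> \<Omega> \<times> cball 0 h then f (fst y) (snd y) else 0)
          = (if y \<in> K then f (fst y) (snd y) else 0)"
        using AE\<Omega>[of n] AEK[of n] by eventually_elim auto
    qed
    then show ?thesis using lim[OF fK] by (simp add: pairing_def)
  qed
  have \<sigma>r: "(\<lambda>n. \<sigma> (r n)) \<longlonglongrightarrow> 0" using LIMSEQ_subseq_LIMSEQ[OF \<sigma>_lim r] by (simp add: o_def)
  have gr: "(\<lambda>n. g (r n) z) \<longlonglongrightarrow> w z"
    using LIMSEQ_subseq_LIMSEQ[OF g_lim[OF \<Omega>_closure[OF z]] r] by (simp add: o_def)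
  have bounded_closure: "\<exists>C. \<forall>x\<in>\<Omega>. \<bar>u x\<bar> \<le> C" if u: "continuous_on (closure \<Omega>) u" for u :: "'a \<Rightarrow> real"
  proof -
    have "bounded (u ` closure \<Omega>)" by (intro compact_imp_bounded compact_continuous_image u compact_closure_\<Omega>)
    then show ?thesis using \<Omega>_closure by (auto simp: bounded_iff)
  qed
  have potential: "\<sigma> n * (u z - discounted \<Omega> h (\<sigma> n) z (ps n) (\<lambda>x v. u x)) \<le> discounted \<Omega> h (\<sigma> n) z (ps n) f"
    if f: "continuous_on (closure \<Omega> \<times> cball 0 h) (\<lambda>(x, v). f x v)" and u: "continuous_on (closure \<Omega>) u"
      and sub: "segment_subsolution \<Omega> h f u" for f u n
  proof -
    have "bounded ((\<lambda>(x, v). f x v) ` K)"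
      unfolding K_def[symmetric] using f by (intro compact_imp_bounded compact_continuous_image K) (simp add: K_def)
    then obtain C where "\<forall>y\<in>K. \<bar>(\<lambda>(x, v). f x v) y\<bar> \<le> C" by (auto simp: bounded_iff)
    then have fb: "\<forall>x\<in>\<Omega>. \<forall>v\<in>cball 0 h. \<bar>f x v\<bar> \<le> C" by (auto simp: K_def \<Omega>_closure)
    obtain C' where C': "\<forall>x\<in>\<Omega>. \<bar>u x\<bar> \<le> C'" using bounded_closure[OF u] by blast
    show ?thesis
    proof (rule discounted_ge_potential[OF open_\<Omega> h0 \<sigma>_pos ps(1) _ fb _ C' sub])
      show "continuous_on (\<Omega> \<times> cball 0 h) (\<lambda>(x, v). f x v)"
        by (rule continuous_on_subset[OF f]) (auto simp: \<Omega>_closure)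
      show "continuous_on \<Omega> u" using u closure_subset by (rule continuous_on_subset)
    qed
  qed
  have G0_pos: "0 \<le> pairing \<nu> f" if fG: "f \<in> G0 \<Omega> h" for f
  proof -
    obtain u where f: "continuous_on (closure \<Omega> \<times> cball 0 h) (\<lambda>(x, v). f x v)"
      and u: "continuous_on (closure \<Omega>) u" and visc: "viscosity_subsolution \<Omega> (hamiltonian_of h f) 0 u"
      using fG by (auto simp: G0_def)
    have sub: "segment_subsolution \<Omega> h f u"
    proof (rule viscosity_imp_segment_subsolution[OF open_\<Omega> h_pos visc])
      show "continuous_on (\<Omega> \<times> cball 0 h) (\<lambda>(x, v). f x v)"
        by (rule continuous_on_subset[OF f]) (auto simp: \<Omega>_closure)
      fix x p v :: 'a assume x: "x \<in> \<Omega>" and "hamiltonian_of h f x p \<le> 0" "norm v \<le> h"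
      moreover have "continuous_on (cball 0 h) (f x)"
      proof -
        have "continuous_on (cball 0 h) (\<lambda>v. (\<lambda>(x, v). f x v) (x, v))"
          by (rule continuous_on_compose2[OF f]) (use x in \<open>auto intro!: continuous_intros \<Omega>_closure\<close>)
        then show ?thesis by simp
      qed
      ultimately have "p \<bullet> v - f x v \<le> 0" by (intro hamiltonian_of_leD[of h f x p 0 v]) auto
      then show "p \<bullet> v \<le> f x v" by simp
    qed
    have "(\<lambda>n. \<sigma> (r n) * (u z - discounted \<Omega> h (\<sigma> (r n)) z (ps (r n)) (\<lambda>x v. u x)))
        \<longlonglongrightarrow> 0 * (u z - pairing \<nu> (\<lambda>x v. u x))"
      by (intro tendsto_intros \<sigma>r disc_lim continuous_fst_extend u)
    then have "(\<lambda>n. \<sigma> (r n) * (u z - discounted \<Omega> h (\<sigma> (r n)) z (ps (r n)) (\<lambda>x v. u x))) \<longlonglongrightarrow> 0"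
      by simp
    from LIMSEQ_le[OF this disc_lim[OF f]] show ?thesis using potential[OF f u sub] by blast
  qed
  \<comment> \<open>This half holds because L + c(0) lies in \<open>G0\<close> with potential
    \<open>w\<close>. The converse is near-optimality: \<open>value_fn (\<sigma> n) z\<close> equals
    \<open>\<sigma> n * g n z - c0\<close>, which tends to -c(0).\<close>
  have "- c0 \<le> pairing \<nu> L"
    using G0_pos[OF L_add_c0_in_G0] pairing_add_const[OF \<nu>(1) \<nu>K continuous_L_closure, of c0] by simp
  moreover have "pairing \<nu> L \<le> - c0"
  proof -
    have "(\<lambda>n. \<sigma> (r n) * g (r n) z - c0 + (\<sigma> (r n))\<^sup>2) \<longlonglongrightarrow> 0 * w z - c0 + 0\<^sup>2"
      by (intro tendsto_intros \<sigma>r gr)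
    then have l: "(\<lambda>n. \<sigma> (r n) * g (r n) z - c0 + (\<sigma> (r n))\<^sup>2) \<longlonglongrightarrow> - c0" by simp
    have "discounted \<Omega> h (\<sigma> n) z (ps n) L \<le> \<sigma> n * g n z - c0 + (\<sigma> n)\<^sup>2" for n
      using ps(2)[of n] \<sigma>_pos[of n] by (simp add: g_eq[OF z])
    then show ?thesis by (intro LIMSEQ_le[OF disc_lim[OF continuous_L_closure] l]) auto
  qed
  ultimately have "\<nu> \<in> mather_measures \<Omega> H h"
    using \<nu>(1) \<nu>K G0_pos by (auto simp: mather_measures_def G0_dual_def prob_space_def)
  moreover have "v z \<le> w z + pairing \<nu> (\<lambda>x _. v x)"
    if v: "continuous_on (closure \<Omega>) v" and visc: "viscosity_subsolution \<Omega> H c0 v" for v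
  proof -
    have "v z \<le> g n z + \<sigma> n + discounted \<Omega> h (\<sigma> n) z (ps n) (\<lambda>x _. v x)" for n
    proof -
      have "\<sigma> n * (v z - discounted \<Omega> h (\<sigma> n) z (ps n) (\<lambda>x _. v x))
          \<le> discounted \<Omega> h (\<sigma> n) z (ps n) (\<lambda>x v. L x v + c0)"
        by (rule potential[OF continuous_L_add v subsolution_imp_segment_subsolution[OF visc]])
      also have "\<dots> = discounted \<Omega> h (\<sigma> n) z (ps n) L + c0"
        by (rule discounted_add_const[OF open_\<Omega> h0 \<sigma>_pos ps(1) continuous_L_\<Omega> M])
      also have "\<dots> \<le> \<sigma> n * (g n z + \<sigma> n)"
      proof -
        have "\<sigma> n * g n z = value_fn (\<sigma> n) z + c0" using \<sigma>_pos[of n] by (simp add: g_eq[OF z])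
        then show ?thesis using ps(2)[of n] by (simp add: distrib_left power2_eq_square)
      qed
      finally show ?thesis using \<sigma>_pos[of n] by simp
    qed
    moreover have "(\<lambda>n. g (r n) z + \<sigma> (r n) + discounted \<Omega> h (\<sigma> (r n)) z (ps (r n)) (\<lambda>x _. v x))
        \<longlonglongrightarrow> w z + 0 + pairing \<nu> (\<lambda>x _. v x)"
      by (intro tendsto_intros gr \<sigma>r disc_lim continuous_fst_extend v)
    ultimately have "v z \<le> w z + 0 + pairing \<nu> (\<lambda>x _. v x)" by (intro LIMSEQ_le_const) auto
    then show ?thesis by simp
  qed
  ultimately show thesis by (rule that)
qed

section \<open>The scaling density as a radial derivative, and its pairings\<close>

lemma scaling_density_limit:
  assumes x: "x \<in> closure \<Omega>"
  shows "((\<lambda>s. (L ((1 - s) *\<^sub>R x) v - L x v) / s) \<longlongrightarrow> scaling_density H x v) (at 0)"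
proof -
  obtain D where D: "\<And>x. x \<in> cball 0 R0 \<Longrightarrow>
      ((\<lambda>y. L y v) has_derivative (\<lambda>y. D x \<bullet> y)) (at x within cball 0 R0)"
    using H4 unfolding assm_H4_def by blast
  \<comment> \<open>Since 2\<Omega> lies in the ball, the closure of \<Omega> lies in the concentric
    ball of half the radius, and the derivative within the large ball is a full derivative.\<close>
  have "x \<in> interior (cball 0 R0)" using norm_closure_\<Omega>[OF x] R0_pos by simp
  then have "at x within cball 0 R0 = at x" by (rule at_within_interior)
  then have der: "((\<lambda>y. L y v) has_derivative (\<lambda>y. y \<bullet> D x)) (at x)"
    using D[OF closure_\<Omega>_cball[OF x]] by (simp add: inner_commute)
  then have gd: "GDERIV (\<lambda>y. L y v) x :> D x" by (simp add: gderiv_def)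
  have "grad_x_lagrangian H x v = D x"
    unfolding grad_x_lagrangian_def
  proof (rule the_equality)
    show "GDERIV (\<lambda>y. L y v) x :> D x" by (rule gd)
    fix D' assume "GDERIV (\<lambda>y. L y v) x :> D'"
    then have "(\<lambda>y. y \<bullet> D') = (\<lambda>y. y \<bullet> D x)"
      using has_derivative_unique[OF _ der] by (simp add: gderiv_def)
    then show "D' = D x" by (metis vector_eq_ldot)
  qed
  then have sd: "scaling_density H x v = (- x) \<bullet> D x" by (simp add: scaling_density_def)
  have in0: "((\<lambda>s. (1 - s) *\<^sub>R x) has_derivative (\<lambda>s. (- s) *\<^sub>R x)) (at 0)"
    by (auto intro!: derivative_eq_intros)
  have "((\<lambda>s. L ((1 - s) *\<^sub>R x) v) has_derivative (\<lambda>s. ((- s) *\<^sub>R x) \<bullet> D x)) (at 0)"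
    using has_derivative_compose[OF in0, of "\<lambda>y. L y v" "\<lambda>y. y \<bullet> D x"] der by simp
  then have "((\<lambda>s. L ((1 - s) *\<^sub>R x) v) has_field_derivative (- x) \<bullet> D x) (at 0)"
    unfolding has_field_derivative_def by (rule has_derivative_eq_rhs) (auto simp: fun_eq_iff)
  then show ?thesis by (simp add: has_field_derivative_iff sd)
qed

text \<open>The density is a pointwise limit of continuous radial difference quotients bounded by
  \<open>\<Lambda> * R0\<close>, which yields measurability and convergence of the integrals. Each
  quotient pairs nonnegatively because the dilated cost is in \<open>G0\<close> and L + c(0) has
  pairing 0. The uniform bound \<open>S\<close> later makes the family for \<gamma>
  nonempty.\<close>

lemma scaling_density_pairing:
  obtains S where "\<And>\<mu>. \<mu> \<in> mather_measures \<Omega> H h \<Longrightarrow>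
    0 \<le> pairing \<mu> (scaling_density H) \<and> pairing \<mu> (scaling_density H) \<le> S"
proof -
  obtain \<Lambda> where \<Lambda>: "\<Lambda> \<ge> 0" "\<And>x y v w. x \<in> cball 0 R0 \<Longrightarrow> y \<in> cball 0 R0 \<Longrightarrow> norm v \<le> h \<Longrightarrow> norm w \<le> h \<Longrightarrow>
    \<bar>L x v - L y w\<bar> \<le> \<Lambda> * (norm (x - y) + norm (v - w))"
    using L_lipschitz by blast
  \<comment> \<open>The double successor keeps \<open>s n\<close> below 1, so that the dilation
    factor \<open>1 - s n\<close> is positive for every \<open>n\<close>.\<close>
  define s where "s n = 1 / real (Suc (Suc n))" for n
  have s: "0 < s n" "s n < 1" for n by (auto simp: s_def)
  have "s \<longlonglongrightarrow> 0" unfolding s_def by (intro LIMSEQ_Suc[where f = "\<lambda>n. 1 / real (Suc n)"] LIMSEQ_Suc[OF lim_1_over_n])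
  then have s0: "filterlim s (at 0) sequentially"
    using s by (intro filterlim_atI) (auto intro!: always_eventually simp: less_imp_neq[symmetric])
  define d where "d n x v = (L ((1 - s n) *\<^sub>R x) v - L x v) / s n" for n x v
  have dil: "(1 - s n) *\<^sub>R x \<in> closure \<Omega>" if "x \<in> closure \<Omega>" for n x
    using star_closure[OF that, of "1 - s n"] s[of n] \<Omega>_closure by simp
  have d_bound: "\<bar>d n x v\<bar> \<le> \<Lambda> * R0" if x: "x \<in> closure \<Omega>" and v: "norm v \<le> h" for n x v
  proof -
    have "\<bar>L ((1 - s n) *\<^sub>R x) v - L x v\<bar> \<le> \<Lambda> * (norm ((1 - s n) *\<^sub>R x - x) + norm (v - v))"
      by (rule \<Lambda>(2)[OF closure_\<Omega>_cball[OF dil[OF x]] closure_\<Omega>_cball[OF x] v v])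
    also have "norm ((1 - s n) *\<^sub>R x - x) = s n * norm x" using s[of n] by (simp add: algebra_simps)
    also have "\<Lambda> * (s n * norm x + norm (v - v)) \<le> \<Lambda> * (s n * R0)"
      using \<Lambda>(1) s[of n] closure_\<Omega>_cball[OF x] by (intro mult_left_mono) auto
    finally show ?thesis using s[of n] by (simp add: d_def divide_le_eq abs_divide algebra_simps)
  qed
  have d_lim: "(\<lambda>n. d n x v) \<longlonglongrightarrow> scaling_density H x v" if "x \<in> closure \<Omega>" for x v
    unfolding d_def by (rule filterlim_compose[OF scaling_density_limit[OF that] s0])
  have d_cont: "continuous_on (closure \<Omega> \<times> cball 0 h) (\<lambda>(x, v). d n x v)" for n
  proof -
    have "continuous_on (closure \<Omega> \<times> cball 0 h) (\<lambda>z. (\<lambda>(x, v). L x v) ((1 - s n) *\<^sub>R fst z, snd z))"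
      by (rule continuous_on_compose2[OF continuous_L_closure]) (auto intro!: continuous_intros dil)
    then show ?thesis using continuous_L_closure s[of n]
      by (auto simp: d_def case_prod_unfold intro!: continuous_intros)
  qed
  show thesis
  proof (rule that[of "\<Lambda> * R0"])
    fix \<mu> assume \<mu>: "\<mu> \<in> mather_measures \<Omega> H h"
    interpret prob_space \<mu> by (rule mather_measuresD[OF \<mu>])
    note space = mather_measuresD(4)[OF \<mu>]
    note int = integrable_pairing[OF mather_measuresD(2,3)[OF \<mu>]]
    have dm: "(\<lambda>z. d n (fst z) (snd z)) \<in> borel_measurable \<mu>" for n using int[OF d_cont] by auto
    have lim: "(\<lambda>n. pairing \<mu> (d n)) \<longlonglongrightarrow> pairing \<mu> (scaling_density H)"
      unfolding pairing_def
    proof (rule integral_dominated_convergence[where w = "\<lambda>_. \<Lambda> * R0"])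
      show "(\<lambda>z. scaling_density H (fst z) (snd z)) \<in> borel_measurable \<mu>"
        by (rule borel_measurable_LIMSEQ_real[OF _ dm]) (auto simp: space intro!: d_lim)
      show "AE z in \<mu>. (\<lambda>n. d n (fst z) (snd z)) \<longlonglongrightarrow> scaling_density H (fst z) (snd z)"
        by (rule AE_I2) (auto simp: space intro!: d_lim)
      show "AE z in \<mu>. norm (d n (fst z) (snd z)) \<le> \<Lambda> * R0" for n
        by (rule AE_I2) (auto simp: space intro!: d_bound)
    qed (use dm in auto)
    have nonneg: "0 \<le> pairing \<mu> (d n)" for n
    proof -
      have G: "(\<lambda>x v. L ((1 - s n) *\<^sub>R x) v + c0) \<in> G0 \<Omega> h"
        by (rule dilated_L_in_G0) (use s[of n] in auto)
      then have "0 \<le> pairing \<mu> (\<lambda>x v. L ((1 - s n) *\<^sub>R x) v + c0)" by (rule mather_measuresD(5)[OF \<mu>])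
      moreover have "pairing \<mu> (\<lambda>x v. L x v + c0) = 0"
        using pairing_add_const[OF mather_measuresD(1,3)[OF \<mu>] continuous_L_closure, of c0]
          mather_measuresD(6)[OF \<mu>] by simp
      moreover have "integrable \<mu> (\<lambda>z. L ((1 - s n) *\<^sub>R fst z) (snd z) + c0)"
        using int[of "\<lambda>x v. L ((1 - s n) *\<^sub>R x) v + c0"] G by (simp add: G0_def)
      then have "pairing \<mu> (d n) = (pairing \<mu> (\<lambda>x v. L ((1 - s n) *\<^sub>R x) v + c0) - pairing \<mu> (\<lambda>x v. L x v + c0)) / s n"
        using int[OF continuous_L_add[of c0]] unfolding pairing_def d_def
        by (subst Bochner_Integration.integral_diff[symmetric]) auto
      ultimately show ?thesis using s[of n] by simp
    qed
    have upper: "pairing \<mu> (d n) \<le> \<Lambda> * R0" for n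
      unfolding pairing_def
      by (rule integral_le_const[OF int[OF d_cont]])
        (rule AE_I2, use d_bound in \<open>force simp: space abs_le_iff\<close>)
    show "0 \<le> pairing \<mu> (scaling_density H) \<and> pairing \<mu> (scaling_density H) \<le> \<Lambda> * R0"
      using LIMSEQ_le_const[OF lim] LIMSEQ_le_const2[OF lim] nonneg upper by blast
  qed
qed

lemma is_minimum_zero:
  assumes z: "z \<in> \<Omega>" and \<gamma>: "\<gamma> > 0" and eq: "u_limit \<Omega> H h 0 z = u_limit \<Omega> H h \<gamma> z"
  shows "is_minimum 0 ((\<lambda>\<mu>. pairing \<mu> (scaling_density H)) ` mather_measures \<Omega> H h)"
proof -
  obtain S where S: "\<And>\<mu>. \<mu> \<in> mather_measures \<Omega> H h \<Longrightarrow>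
      0 \<le> pairing \<mu> (scaling_density H) \<and> pairing \<mu> (scaling_density H) \<le> S"
    using scaling_density_pairing by blast
  obtain \<nu> where \<nu>: "\<nu> \<in> mather_measures \<Omega> H h"
    and opt: "\<And>v. continuous_on (closure \<Omega>) v \<Longrightarrow> viscosity_subsolution \<Omega> H c0 v \<Longrightarrow>
      v z \<le> w z + pairing \<nu> (\<lambda>x _. v x)"
    using subsolution_le_w_plus_pairing[OF z] by blast
  have "u_limit \<Omega> H h 0 z = w z"
    unfolding u_limit_def
  proof (rule cSup_eq_maximum)
    show "w z \<in> (\<lambda>w. w z) ` E_family \<Omega> H h 0" using w_in_E_family by blast
    fix y assume "y \<in> (\<lambda>w. w z) ` E_family \<Omega> H h 0"
    then obtain v where "v \<in> E_family \<Omega> H h 0" "y = v z" by blast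
    then show "y \<le> w z" using opt[of v] \<nu> by (force simp: E_family_def)
  qed
  moreover have "u_limit \<Omega> H h \<gamma> z \<le> w z - \<gamma> * pairing \<nu> (scaling_density H)"
    unfolding u_limit_def
  proof (rule cSUP_least)
    \<comment> \<open>Lowering \<open>w\<close> by \<open>\<gamma> * S\<close> satisfies every
      constraint of the family. A member is needed because the real supremum of an empty family
      carries no upper bound.\<close>
    define v where "v x = w x - \<gamma> * S" for x
    have vc: "continuous_on (closure \<Omega>) v" unfolding v_def by (intro continuous_intros w_cont)
    have "segment_subsolution \<Omega> h (\<lambda>x v. L x v + c0) v"
      using w_segment_subsolution by (simp add: segment_subsolution_def v_def)
    then have "viscosity_subsolution \<Omega> H c0 v"
      by (rule segment_subsolution_imp_subsolution) (rule continuous_on_subset[OF vc closure_subset])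
    moreover have "\<gamma> * pairing \<mu> (scaling_density H) + pairing \<mu> (\<lambda>x _. v x) \<le> 0"
      if \<mu>: "\<mu> \<in> mather_measures \<Omega> H h" for \<mu>
    proof -
      have "pairing \<mu> (\<lambda>x _. v x) = pairing \<mu> (\<lambda>x _. w x) - \<gamma> * S"
        using pairing_add_const[OF mather_measuresD(1,3)[OF \<mu>] continuous_fst_extend[OF w_cont], of "- (\<gamma> * S)"]
        by (simp add: v_def)
      moreover have "\<gamma> * pairing \<mu> (scaling_density H) \<le> \<gamma> * S" using S[OF \<mu>] \<gamma> by simp
      ultimately show ?thesis using pairing_w_le[OF \<mu>] by simp
    qed
    ultimately show "E_family \<Omega> H h \<gamma> \<noteq> {}" using vc by (auto simp: E_family_def)
    fix v assume "v \<in> E_family \<Omega> H h \<gamma>"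
    then show "v z \<le> w z - \<gamma> * pairing \<nu> (scaling_density H)"
      using opt[of v] \<nu> by (force simp: E_family_def)
  qed
  ultimately have "\<gamma> * pairing \<nu> (scaling_density H) \<le> 0" using eq by simp
  then have "pairing \<nu> (scaling_density H) \<le> 0" using \<gamma> by (simp add: mult_le_0_iff)
  then have "pairing \<nu> (scaling_density H) = 0" using S[OF \<nu>] by simp
  then have "0 \<in> (\<lambda>\<mu>. pairing \<mu> (scaling_density H)) ` mather_measures \<Omega> H h" using \<nu> by force
  then show ?thesis using S by (auto simp: is_minimum_def)
qed

end

end

theorem corollary1p6:
  fixes \<Omega> :: "'a::euclidean_space set"
    and H :: "'a \<Rightarrow> 'a \<Rightarrow> real"
    and R0 h \<gamma> :: real
    and z :: 'a
  assumes "open \<Omega>" and "bounded \<Omega>" and "connected \<Omega>" and "0 \<in> \<Omega>"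
    and "(\<lambda>x. 2 *\<^sub>R x) ` \<Omega> \<subseteq> ball 0 R0"
    and "continuous_on (cball 0 R0 \<times> UNIV) (\<lambda>(x, p). H x p)"
    and "assm_H1 R0 H" and "assm_H2 R0 H" and "assm_H3 R0 H" and "assm_H4 R0 H"
    and "assm_A1 \<Omega>"
    and "normalizing_bound \<Omega> H h"
    and "z \<in> \<Omega>" and "\<gamma> > 0"
    and "u_limit \<Omega> H h 0 z = u_limit \<Omega> H h \<gamma> z"
  shows "is_minimum 0 ((\<lambda>\<mu>. pairing \<mu> (scaling_density H)) ` mather_measures \<Omega> H h)"
proof -
  interpret star_shaped_hamiltonian \<Omega> H R0 h
    using assms by unfold_locales
  show ?thesis
  proof (rule normalized_value_limit)
    fix \<sigma> g w B assume "\<And>n. \<sigma> n > 0" "\<sigma> \<longlonglongrightarrow> 0" "\<And>n. continuous_on (closure \<Omega>) (g n)"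
      "\<And>n x. x \<in> \<Omega> \<Longrightarrow> g n x = (value_fn (\<sigma> n) x + c0) / \<sigma> n"
      "\<And>n x. x \<in> closure \<Omega> \<Longrightarrow> \<bar>g n x\<bar> \<le> B"
      "\<And>x. x \<in> closure \<Omega> \<Longrightarrow> (\<lambda>n. g n x) \<longlonglongrightarrow> w x" "continuous_on (closure \<Omega>) w"
    show ?thesis
      by (rule is_minimum_zero[where \<sigma> = \<sigma> and g = g and w = w and B = B]) (fact | rule assms)+
  qed
qed

end
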